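(* Let $\frac12\le\beta<1$ and let $S_t$ follow the CEV model $dS_t=(r-q)S_t\,dt+\sigma S_t^\beta\,dW_t$ with $S_0>0$. Let $C(T)$ and $P(T)$ be the prices of the at-the-money Asian call and put options, i.e. with strike $K=S_0$ and maturity $T$. Then, as $T\to0$, $$C(T)=\sigma S_0^\beta\frac{\sqrt T}{\sqrt{6\pi}}+O(T),\qquad P(T)=\sigma S_0^\beta\frac{\sqrt T}{\sqrt{6\pi}}+O(T).$$
   Context: $W$ is a standard Brownian motion with $W_0=0$; $r\ge0$, $q\ge0$, $\sigma>0$ are constants; $S$ is the (unique) nonnegative solution of the stated SDE. The Asian option prices with strike $K$ are $$C(T)=e^{-rT}\mathbb{E}\left[\left(\tfrac1T\int_0^TS_t\,dt-K\right)^+\right],\qquad P(T)=e^{-rT}\mathbb{E}\left[\left(K-\tfrac1T\int_0^TS_t\,dt\right)^+\right].$$ *)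

theory Defs
  imports "HOL-Probability.Probability" "HOL-Library.Landau_Symbols"
begin

text \<open>
  Time is the type of reals. Only times \<open>t \<ge> 0\<close> are relevant; a filtration on \<open>[0, \<infinity>)\<close> is extended
  to negative times by its value at time \<open>0\<close>.
\<close>

locale filtered_prob_space = prob_space M + filtration "space M" F
  for M :: "'a measure" and F :: "real \<Rightarrow> 'a measure" +
  assumes subalgebra_F: "\<And>t. subalgebra M (F t)"

definition adapted :: "(real \<Rightarrow> 'a measure) \<Rightarrow> (real \<Rightarrow> 'a \<Rightarrow> real) \<Rightarrow> bool" where
  "adapted F X \<longleftrightarrow> (\<forall>t\<ge>0. X t \<in> borel_measurable (F t))"

definition progressively_measurable ::
    "(real \<Rightarrow> 'a measure) \<Rightarrow> (real \<Rightarrow> 'a \<Rightarrow> real) \<Rightarrow> bool" where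
  "progressively_measurable F X \<longleftrightarrow>
     (\<forall>t\<ge>0. (\<lambda>(s, \<omega>). X s \<omega>) \<in> borel_measurable (restrict_space borel {0..t} \<Otimes>\<^sub>M F t))"

definition brownian_motion ::
    "'a measure \<Rightarrow> (real \<Rightarrow> 'a measure) \<Rightarrow> (real \<Rightarrow> 'a \<Rightarrow> real) \<Rightarrow> bool" where
  "brownian_motion M F W \<longleftrightarrow>
     adapted F W \<and>
     (\<forall>\<omega>\<in>space M. continuous_on {0..} (\<lambda>t. W t \<omega>)) \<and>
     (AE \<omega> in M. W 0 \<omega> = 0) \<and>
     (\<forall>s t. 0 \<le> s \<and> s < t \<longrightarrow>
        distributed M lborel (\<lambda>\<omega>. W t \<omega> - W s \<omega>) (\<lambda>x. ennreal (normal_density 0 (sqrt (t - s)) x)) \<and>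
        prob_space.indep_set M (sets (F s))
          (sets (vimage_algebra (space M) (\<lambda>\<omega>. W t \<omega> - W s \<omega>) borel)))"

text \<open>
  The data \<open>n\<close>, \<open>\<tau>\<close>, \<open>\<xi>\<close> represent the simple process that equals \<open>\<xi> i\<close> on \<open>(\<tau> i, \<tau> (i + 1)]\<close> for
  \<open>i < n\<close> and vanishes elsewhere.
\<close>

definition simple_process ::
    "'a measure \<Rightarrow> (real \<Rightarrow> 'a measure) \<Rightarrow> nat \<Rightarrow> (nat \<Rightarrow> real) \<Rightarrow> (nat \<Rightarrow> 'a \<Rightarrow> real) \<Rightarrow> bool" where
  "simple_process M F n \<tau> \<xi> \<longleftrightarrow>
     0 \<le> \<tau> 0 \<and> (\<forall>i<n. \<tau> i < \<tau> (Suc i)) \<and>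
     (\<forall>i<n. \<xi> i \<in> borel_measurable (F (\<tau> i)) \<and> (\<exists>B. \<forall>\<omega>\<in>space M. \<bar>\<xi> i \<omega>\<bar> \<le> B))"

definition simple_value ::
    "nat \<Rightarrow> (nat \<Rightarrow> real) \<Rightarrow> (nat \<Rightarrow> 'a \<Rightarrow> real) \<Rightarrow> real \<Rightarrow> 'a \<Rightarrow> real" where
  "simple_value n \<tau> \<xi> s \<omega> = (\<Sum>i<n. \<xi> i \<omega> * indicator {\<tau> i<..\<tau> (Suc i)} s)"

definition simple_integral ::
    "(real \<Rightarrow> 'a \<Rightarrow> real) \<Rightarrow> nat \<Rightarrow> (nat \<Rightarrow> real) \<Rightarrow> (nat \<Rightarrow> 'a \<Rightarrow> real) \<Rightarrow> real \<Rightarrow> 'a \<Rightarrow> real" where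
  "simple_integral W n \<tau> \<xi> t \<omega> =
     (\<Sum>i<n. \<xi> i \<omega> * (W (min t (\<tau> (Suc i))) \<omega> - W (min t (\<tau> i)) \<omega>))"

definition vanishes_in_prob :: "'a measure \<Rightarrow> (nat \<Rightarrow> 'a \<Rightarrow> ennreal) \<Rightarrow> bool" where
  "vanishes_in_prob M D \<longleftrightarrow>
     (\<forall>\<epsilon>>0::real. (\<lambda>k. measure M {\<omega>\<in>space M. ennreal \<epsilon> < D k \<omega>}) \<longlonglongrightarrow> 0)"

text \<open>
  \<open>X\<close> is (a version with continuous paths of) the Ito integral process \<open>t \<mapsto> \<integral>\<^sub>0\<^sup>t H\<^sub>s dW\<^sub>s\<close> of a progressively
  measurable integrand whose square is almost surely locally integrable in time. Such an integral is
  the limit in probability of the integrals of simple processes that approximate \<open>H\<close> in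
  \<open>L\<^sup>2([0, t])\<close>, in probability, for every \<open>t\<close>.
\<close>

definition has_ito_integral ::
    "'a measure \<Rightarrow> (real \<Rightarrow> 'a measure) \<Rightarrow> (real \<Rightarrow> 'a \<Rightarrow> real) \<Rightarrow> (real \<Rightarrow> 'a \<Rightarrow> real) \<Rightarrow>
     (real \<Rightarrow> 'a \<Rightarrow> real) \<Rightarrow> bool" where
  "has_ito_integral M F W H X \<longleftrightarrow>
     progressively_measurable F H \<and>
     (AE \<omega> in M. \<forall>t\<ge>0. (\<integral>\<^sup>+s\<in>{0..t}. ennreal ((H s \<omega>)\<^sup>2) \<partial>lborel) < \<infinity>) \<and>
     (\<forall>t\<ge>0. X t \<in> borel_measurable M) \<and>
     (AE \<omega> in M. continuous_on {0..} (\<lambda>t. X t \<omega>)) \<and>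
     (\<exists>n \<tau> \<xi>.
        (\<forall>k. simple_process M F (n k) (\<tau> k) (\<xi> k)) \<and>
        (\<forall>t\<ge>0.
           vanishes_in_prob M (\<lambda>k \<omega>. \<integral>\<^sup>+s\<in>{0..t}.
             ennreal ((simple_value (n k) (\<tau> k) (\<xi> k) s \<omega> - H s \<omega>)\<^sup>2) \<partial>lborel) \<and>
           vanishes_in_prob M (\<lambda>k \<omega>.
             ennreal \<bar>simple_integral W (n k) (\<tau> k) (\<xi> k) t \<omega> - X t \<omega>\<bar>)))"

text \<open>Continuous adapted solutions of \<open>dX\<^sub>t = b(X\<^sub>t) dt + a(X\<^sub>t) dW\<^sub>t\<close> with \<open>X\<^sub>0 = x0\<close>.\<close>

definition sde_solution ::
    "'a measure \<Rightarrow> (real \<Rightarrow> 'a measure) \<Rightarrow> (real \<Rightarrow> 'a \<Rightarrow> real) \<Rightarrow> (real \<Rightarrow> real) \<Rightarrow> (real \<Rightarrow> real) \<Rightarrow>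
     real \<Rightarrow> (real \<Rightarrow> 'a \<Rightarrow> real) \<Rightarrow> bool" where
  "sde_solution M F W b a x0 X \<longleftrightarrow>
     adapted F X \<and>
     (\<forall>\<omega>\<in>space M. continuous_on {0..} (\<lambda>t. X t \<omega>)) \<and>
     (AE \<omega> in M. \<forall>t\<ge>0. set_integrable lborel {0..t} (\<lambda>s. b (X s \<omega>))) \<and>
     (\<exists>I. has_ito_integral M F W (\<lambda>s \<omega>. a (X s \<omega>)) I \<and>
        (AE \<omega> in M. \<forall>t\<ge>0. X t \<omega> = x0 + (LBINT s:{0..t}. b (X s \<omega>)) + I t \<omega>))"

definition cev_process ::
    "'a measure \<Rightarrow> (real \<Rightarrow> 'a measure) \<Rightarrow> (real \<Rightarrow> 'a \<Rightarrow> real) \<Rightarrow> real \<Rightarrow> real \<Rightarrow> real \<Rightarrow> real \<Rightarrow>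
     real \<Rightarrow> (real \<Rightarrow> 'a \<Rightarrow> real) \<Rightarrow> bool" where
  "cev_process M F W r q \<sigma> \<beta> S0 S \<longleftrightarrow>
     sde_solution M F W (\<lambda>x. (r - q) * x) (\<lambda>x. \<sigma> * x powr \<beta>) S0 S \<and>
     (AE \<omega> in M. \<forall>t\<ge>0. 0 \<le> S t \<omega>)"

definition asian_call :: "'a measure \<Rightarrow> (real \<Rightarrow> 'a \<Rightarrow> real) \<Rightarrow> real \<Rightarrow> real \<Rightarrow> real \<Rightarrow> real" where
  "asian_call M S r K T =
     exp (- r * T) * (\<integral>\<omega>. max 0 (1 / T * (LBINT t:{0..T}. S t \<omega>) - K) \<partial>M)"

definition asian_put :: "'a measure \<Rightarrow> (real \<Rightarrow> 'a \<Rightarrow> real) \<Rightarrow> real \<Rightarrow> real \<Rightarrow> real \<Rightarrow> real" where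
  "asian_put M S r K T =
     exp (- r * T) * (\<integral>\<omega>. max 0 (K - 1 / T * (LBINT t:{0..T}. S t \<omega>)) \<partial>M)"

end

theory Submission
  imports Defs
begin

text \<open>
  With \<open>c = \<sigma> S\<^sub>0\<^sup>\<beta>\<close> one has \<open>S\<^sub>t - S\<^sub>0 - c W\<^sub>t = (r - q) \<integral>\<^sub>0\<^sup>t S + \<integral>\<^sub>0\<^sup>t (\<sigma> S\<^sup>\<beta> - c) dW\<close>. Since
  \<open>x\<^sup>\<beta>\<close> is Lipschitz at \<open>S\<^sub>0\<close>, the Ito isometry and \<open>E (S\<^sub>t - S\<^sub>0)\<^sup>2 = O(t)\<close> make the right-hand side \<open>O(t)\<close> in
  \<open>L\<^sup>1\<close>. Payoffs are 1-Lipschitz in the average, so up to \<open>O(T)\<close> the price is that of the Gaussian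
  average \<open>c T\<^sup>-\<^sup>1 \<integral>\<^sub>0\<^sup>T W\<close>, of variance \<open>c\<^sup>2 T / 3\<close>.

  The second moment is not known to be finite beforehand. Instead of stopping times, the isometry is
  proved in the form \<open>E[X\<^sub>t\<^sup>2; A\<^sub>t < b] \<le> E[min b A\<^sub>t]\<close> with \<open>A\<^sub>t = \<integral>\<^sub>0\<^sup>t H\<^sup>2\<close>, which holds without any
  integrability assumption and suffices for a Gronwall argument for \<open>E[(S\<^sub>t - S\<^sub>0)\<^sup>2; A\<^sub>t < b]\<close>, uniformly in \<open>b\<close>.
\<close>

subsection \<open>Brownian increments\<close>

text \<open>Absorption in Gronwall needs a supremum that is finite beforehand. Energy below
  \<open>b\<close> bounds the noise by the isometry and, for \<beta> \<ge> 1/2, the time integral of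
  \<open>S\<close> as well, so the truncated second moment is finite for each fixed
  \<open>b\<close>; the bound left after absorption no longer contains \<open>b\<close>. Absorbing
  once on a short interval suffices, because only T near 0 matters. Truncating by an event instead
  of stopping has a price: the right-hand side of the isometry carries \<open>min b A\<close>, not
  an indicator, and continuity of \<open>A\<close> in time is needed to return to the truncated
  second moment. The isometry is proved for the integrand minus a constant \<open>c\<close>, so it
  applies to \<sigma> S^\<beta> - c directly, without linearity of the Ito integral. The constant in
  the theorem is half an absolute moment: max 0 x = (|x| + x) / 2, the Gaussian average is centred,
  and E|N(0, c^2 T / 3)| = c sqrt (2 T / (3 pi)), whose half is c sqrt (T / (6 pi)). Call and put
  differ only in the sign of the linear part, which has mean zero.\<close>

lemma (in prob_space) centered_normal_moments:
  assumes X: "distributed M lborel X (\<lambda>x. ennreal (normal_density 0 s x))" and s: "0 < s"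
  shows "integrable M X" "expectation X = 0"
    "integrable M (\<lambda>\<omega>. (X \<omega>)\<^sup>2)" "expectation (\<lambda>\<omega>. (X \<omega>)\<^sup>2) = s\<^sup>2"
    "expectation (\<lambda>\<omega>. \<bar>X \<omega>\<bar>) = s * sqrt (2 / pi)"
proof -
  have nn: "\<And>x. x \<in> space lborel \<Longrightarrow> 0 \<le> normal_density 0 s x" by (simp add: normal_density_nonneg)
  note int = distributed_integrable[OF X _ nn] and val = distributed_integral[OF X _ nn]
  have 1: "integrable lborel (\<lambda>x. normal_density 0 s x * x)"
    using integrable_normal_moment[OF s, of 0 1] by simp
  show "integrable M X" using int[of "\<lambda>x. x"] 1 by simp
  show "expectation X = 0" using val[of "\<lambda>x. x"] integral_normal_moment_nz_1[OF s, of 0] by simp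
  show "integrable M (\<lambda>\<omega>. (X \<omega>)\<^sup>2)"
    using int[of "\<lambda>x. x\<^sup>2"] integrable_normal_moment[OF s, of 0 2] by simp
  show "expectation (\<lambda>\<omega>. (X \<omega>)\<^sup>2) = s\<^sup>2"
    using val[of "\<lambda>x. x\<^sup>2"] integral_normal_moment_even[OF s, of 0 1] by simp
  show "expectation (\<lambda>\<omega>. \<bar>X \<omega>\<bar>) = s * sqrt (2 / pi)"
    using val[of "\<lambda>x. \<bar>x\<bar>"] integral_normal_moment_abs_odd[OF s, of 0 0] by simp
qed

text \<open>Rounding time down to a grid of mesh 1 / (n + 1) leaves countably many sections, so the
  rounded process is jointly measurable; continuity of the paths passes this to the limit. The clip
  \<open>max 0\<close> extends the paths constantly to negative times, so the product can be taken
  with all of \<open>lborel\<close>.\<close>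

lemma continuous_paths_jointly_measurable:
  fixes X :: "real \<Rightarrow> 'a \<Rightarrow> real"
  assumes meas: "\<And>t. 0 \<le> t \<Longrightarrow> X t \<in> borel_measurable M"
    and cont: "\<And>\<omega>. \<omega> \<in> space M \<Longrightarrow> continuous_on {0..} (\<lambda>t. X t \<omega>)"
  shows "(\<lambda>(\<omega>, t). X (max 0 t) \<omega>) \<in> borel_measurable (M \<Otimes>\<^sub>M lborel)"
proof (rule borel_measurable_LIMSEQ_real)
  define grid where "grid n t = max 0 (of_int \<lfloor>real (Suc n) * t\<rfloor> / real (Suc n))" for n and t :: real
  have "(\<lambda>p. X (max 0 (of_int i / real (Suc n))) (fst p)) \<in> borel_measurable (M \<Otimes>\<^sub>M lborel)" for i :: int and n
    using meas by simp
  then have "(\<lambda>p. X (max 0 (of_int \<lfloor>real (Suc n) * snd p\<rfloor> / real (Suc n))) (fst p))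
      \<in> borel_measurable (M \<Otimes>\<^sub>M lborel)" for n
    by (rule measurable_compose_countable) simp
  then show "(\<lambda>(\<omega>, t). X (grid n t) \<omega>) \<in> borel_measurable (M \<Otimes>\<^sub>M lborel)" for n
    by (simp add: grid_def split_beta')
  fix p :: "'a \<times> real" assume "p \<in> space (M \<Otimes>\<^sub>M lborel)"
  then obtain t \<omega> where p: "p = (\<omega>, t)" and \<omega>: "\<omega> \<in> space M" by (auto simp: space_pair_measure)
  have "(\<lambda>n. of_int \<lfloor>real (Suc n) * t\<rfloor> / real (Suc n)) \<longlonglongrightarrow> t"
  proof (rule tendsto_sandwich[of "\<lambda>n. t - 1 / real (Suc n)" _ _ "\<lambda>n. t"])
    have "of_int \<lfloor>real (Suc n) * t\<rfloor> / real (Suc n) \<le> (real (Suc n) * t) / real (Suc n)"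
      "(real (Suc n) * t - 1) / real (Suc n) \<le> of_int \<lfloor>real (Suc n) * t\<rfloor> / real (Suc n)" for n
      by (intro divide_right_mono; linarith)+
    then show "\<forall>\<^sub>F n in sequentially. t - 1 / real (Suc n) \<le> of_int \<lfloor>real (Suc n) * t\<rfloor> / real (Suc n)"
      "\<forall>\<^sub>F n in sequentially. of_int \<lfloor>real (Suc n) * t\<rfloor> / real (Suc n) \<le> t"
      by (auto intro!: always_eventually simp: diff_divide_distrib simp del: of_nat_Suc)
    show "(\<lambda>n. t - 1 / real (Suc n)) \<longlonglongrightarrow> t"
      using tendsto_diff[OF tendsto_const LIMSEQ_inverse_real_of_nat] by (simp add: inverse_eq_divide)
  qed auto
  then have "(\<lambda>n. grid n t) \<longlonglongrightarrow> max 0 t"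
    unfolding grid_def by (intro tendsto_max tendsto_const)
  then have "(\<lambda>n. X (grid n t) \<omega>) \<longlonglongrightarrow> X (max 0 t) \<omega>"
    by (rule continuous_on_tendsto_compose[OF cont[OF \<omega>]]) (auto simp: grid_def)
  then show "(\<lambda>n. case p of (\<omega>, t) \<Rightarrow> X (grid n t) \<omega>) \<longlonglongrightarrow> (case p of (\<omega>, t) \<Rightarrow> X (max 0 t) \<omega>)"
    by (simp add: p)
qed

locale brownian_filtration = filtered_prob_space M F
  for M :: "'a measure" and F :: "real \<Rightarrow> 'a measure" +
  fixes W :: "real \<Rightarrow> 'a \<Rightarrow> real"
  assumes brownian: "brownian_motion M F W"
begin

lemma measurable_F_mono:
  "f \<in> borel_measurable (F s) \<Longrightarrow> s \<le> t \<Longrightarrow> f \<in> borel_measurable (F t)"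
  using sets_F_mono[of s t] space_F by (auto simp: measurable_def)

lemma measurable_F_M: "f \<in> borel_measurable (F s) \<Longrightarrow> f \<in> borel_measurable M"
  using subalgebra_F[of s] by (rule measurable_from_subalg)

lemma W_measurable_F: "0 \<le> s \<Longrightarrow> s \<le> t \<Longrightarrow> W s \<in> borel_measurable (F t)"
  using brownian measurable_F_mono by (auto simp: brownian_motion_def adapted_def)

lemma W_measurable: "0 \<le> s \<Longrightarrow> W s \<in> borel_measurable M"
  using W_measurable_F measurable_F_M by blast

lemma W_continuous: "\<omega> \<in> space M \<Longrightarrow> continuous_on {0..} (\<lambda>t. W t \<omega>)"
  using brownian by (auto simp: brownian_motion_def)

lemma increment_distributed:
  "0 \<le> s \<Longrightarrow> s < t \<Longrightarrow>
    distributed M lborel (\<lambda>\<omega>. W t \<omega> - W s \<omega>) (\<lambda>x. ennreal (normal_density 0 (sqrt (t - s)) x))"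
  using brownian by (auto simp: brownian_motion_def)

lemma increment_moments:
  assumes "0 \<le> s" "s \<le> t"
  shows "integrable M (\<lambda>\<omega>. W t \<omega> - W s \<omega>)" "expectation (\<lambda>\<omega>. W t \<omega> - W s \<omega>) = 0"
    "integrable M (\<lambda>\<omega>. (W t \<omega> - W s \<omega>)\<^sup>2)" "expectation (\<lambda>\<omega>. (W t \<omega> - W s \<omega>)\<^sup>2) = t - s"
proof -
  have "integrable M (\<lambda>\<omega>. W t \<omega> - W s \<omega>) \<and> expectation (\<lambda>\<omega>. W t \<omega> - W s \<omega>) = 0 \<and>
    integrable M (\<lambda>\<omega>. (W t \<omega> - W s \<omega>)\<^sup>2) \<and> expectation (\<lambda>\<omega>. (W t \<omega> - W s \<omega>)\<^sup>2) = t - s"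
  proof (cases "s = t")
    case False
    then show ?thesis
      using assms centered_normal_moments[OF increment_distributed[of s t]] by simp
  qed simp
  then show "integrable M (\<lambda>\<omega>. W t \<omega> - W s \<omega>)" "expectation (\<lambda>\<omega>. W t \<omega> - W s \<omega>) = 0"
    "integrable M (\<lambda>\<omega>. (W t \<omega> - W s \<omega>)\<^sup>2)" "expectation (\<lambda>\<omega>. (W t \<omega> - W s \<omega>)\<^sup>2) = t - s"
    by auto
qed

text \<open>Independence from \<open>F s\<close> is inherited by the smaller sigma-algebra that
  \<open>Z\<close> generates.\<close>

lemma increment_indep:
  fixes Z :: "'a \<Rightarrow> real"
  assumes Z: "Z \<in> borel_measurable (F s)" and st: "0 \<le> s" "s < t"
  shows "indep_var borel Z borel (\<lambda>\<omega>. W t \<omega> - W s \<omega>)"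
proof -
  have ind: "indep_set (sets (F s)) (sets (vimage_algebra (space M) (\<lambda>\<omega>. W t \<omega> - W s \<omega>) borel))"
    using brownian st by (auto simp: brownian_motion_def)
  have "sigma_sets (space M) {Z -` A \<inter> space M | A. A \<in> sets borel} \<subseteq> sets (F s)"
    using sets_image_in_sets[OF space_F Z] by (simp add: sets_vimage_algebra)
  then have "indep_set (sigma_sets (space M) {Z -` A \<inter> space M | A. A \<in> sets borel})
     (sigma_sets (space M) {(\<lambda>\<omega>. W t \<omega> - W s \<omega>) -` A \<inter> space M | A. A \<in> sets borel})"
    using ind unfolding indep_sets2_eq sets_vimage_algebra by blast
  then show ?thesis
    unfolding indep_var_eq using st measurable_F_M[OF Z] W_measurable[of s] W_measurable[of t] by auto
qed

text \<open>Independence factors the expectations. The first pair is the vanishing cross term of the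
  isometry, the second its diagonal term. Coinciding times are split off because an increment over
  an empty interval has no density.\<close>

lemma increment_times_past:
  fixes Z :: "'a \<Rightarrow> real"
  assumes Z: "Z \<in> borel_measurable (F s)" "integrable M Z" and st: "0 \<le> s" "s \<le> t"
  shows "integrable M (\<lambda>\<omega>. Z \<omega> * (W t \<omega> - W s \<omega>))"
    "expectation (\<lambda>\<omega>. Z \<omega> * (W t \<omega> - W s \<omega>)) = 0"
    "integrable M (\<lambda>\<omega>. Z \<omega> * (W t \<omega> - W s \<omega>)\<^sup>2)"
    "expectation (\<lambda>\<omega>. Z \<omega> * (W t \<omega> - W s \<omega>)\<^sup>2) = expectation Z * (t - s)"
proof -
  note mom = increment_moments[OF st]
  have "integrable M (\<lambda>\<omega>. Z \<omega> * (W t \<omega> - W s \<omega>)) \<and>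
    expectation (\<lambda>\<omega>. Z \<omega> * (W t \<omega> - W s \<omega>)) = 0 \<and>
    integrable M (\<lambda>\<omega>. Z \<omega> * (W t \<omega> - W s \<omega>)\<^sup>2) \<and>
    expectation (\<lambda>\<omega>. Z \<omega> * (W t \<omega> - W s \<omega>)\<^sup>2) = expectation Z * (t - s)"
  proof (cases "s = t")
    case False
    then have ind: "indep_var borel Z borel (\<lambda>\<omega>. W t \<omega> - W s \<omega>)"
      using st Z by (intro increment_indep) auto
    have ind2: "indep_var borel Z borel (\<lambda>\<omega>. (W t \<omega> - W s \<omega>)\<^sup>2)"
      using indep_var_compose[OF ind, of "\<lambda>x. x" borel "\<lambda>x. x\<^sup>2" borel] by (simp add: comp_def)
    show ?thesis
      using indep_var_integrable[OF ind Z(2) mom(1)] indep_var_lebesgue_integral[OF ind Z(2) mom(1)]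
        indep_var_integrable[OF ind2 Z(2) mom(3)] indep_var_lebesgue_integral[OF ind2 Z(2) mom(3)] mom
      by simp
  qed simp
  then show "integrable M (\<lambda>\<omega>. Z \<omega> * (W t \<omega> - W s \<omega>))"
    "expectation (\<lambda>\<omega>. Z \<omega> * (W t \<omega> - W s \<omega>)) = 0"
    "integrable M (\<lambda>\<omega>. Z \<omega> * (W t \<omega> - W s \<omega>)\<^sup>2)"
    "expectation (\<lambda>\<omega>. Z \<omega> * (W t \<omega> - W s \<omega>)\<^sup>2) = expectation Z * (t - s)"
    by auto
qed

lemma integrable_bounded_F:
  fixes f :: "'a \<Rightarrow> real"
  assumes "f \<in> borel_measurable (F s)" "\<forall>\<omega>\<in>space M. \<bar>f \<omega>\<bar> \<le> B"
  shows "integrable M f"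
  using assms measurable_F_M by (intro integrable_const_bound[of _ B]) auto

text \<open>Orthogonality of martingale differences: on expanding the square, the past sum times the
  next weight is known at \<open>s k\<close>, so the mixed term has mean zero. The partition is only
  weakly increasing, so that clipping at a time horizon may produce empty intervals.\<close>

lemma discrete_isometry:
  fixes s :: "nat \<Rightarrow> real"
  assumes s: "0 \<le> s 0" "\<And>i. i < m \<Longrightarrow> s i \<le> s (Suc i)"
    and \<eta>: "\<And>i. i < m \<Longrightarrow> \<eta> i \<in> borel_measurable (F (s i))"
    and bdd: "\<And>i. i < m \<Longrightarrow> \<exists>B. \<forall>\<omega>\<in>space M. \<bar>\<eta> i \<omega>\<bar> \<le> B"
  defines "J \<equiv> \<lambda>m \<omega>. \<Sum>i<m. \<eta> i \<omega> * (W (s (Suc i)) \<omega> - W (s i) \<omega>)"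
  shows "J m \<in> borel_measurable (F (s m))" "integrable M (\<lambda>\<omega>. (J m \<omega>)\<^sup>2)"
    "expectation (\<lambda>\<omega>. (J m \<omega>)\<^sup>2) = expectation (\<lambda>\<omega>. \<Sum>i<m. (\<eta> i \<omega>)\<^sup>2 * (s (Suc i) - s i))"
proof -
  have nn: "k \<le> m \<Longrightarrow> 0 \<le> s k" for k
  proof (induction k)
    case (Suc k) then show ?case using s(2)[of k] by simp
  qed (use s in simp)
  have "k \<le> m \<Longrightarrow> J k \<in> borel_measurable (F (s k)) \<and> integrable M (\<lambda>\<omega>. (J k \<omega>)\<^sup>2) \<and>
      expectation (\<lambda>\<omega>. (J k \<omega>)\<^sup>2) = expectation (\<lambda>\<omega>. \<Sum>i<k. (\<eta> i \<omega>)\<^sup>2 * (s (Suc i) - s i))" for k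
  proof (induction k)
    case 0
    then show ?case by (simp add: J_def)
  next
    case (Suc k)
    let ?D = "\<lambda>\<omega>. W (s (Suc k)) \<omega> - W (s k) \<omega>"
    have k: "0 \<le> s k" "s k \<le> s (Suc k)" and \<eta>k[measurable]: "\<eta> k \<in> borel_measurable (F (s k))"
      using Suc.prems nn[of k] s(2)[of k] \<eta>[of k] by auto
    have JF[measurable]: "J k \<in> borel_measurable (F (s k))"
      and J2: "integrable M (\<lambda>\<omega>. (J k \<omega>)\<^sup>2)" using Suc by auto
    obtain B where B: "\<And>\<omega>. \<omega> \<in> space M \<Longrightarrow> \<bar>\<eta> k \<omega>\<bar> \<le> B" using bdd[of k] Suc.prems by auto
    have \<eta>2: "integrable M (\<lambda>\<omega>. (\<eta> k \<omega>)\<^sup>2)"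
      by (rule integrable_bounded_F[of _ "s k" "B\<^sup>2"]) (use B in \<open>auto simp: abs_le_square_iff[symmetric] intro: order_trans[OF B]\<close>)
    have JM: "J k \<in> borel_measurable M" "\<eta> k \<in> borel_measurable M" by (rule measurable_F_M; measurable)+
    \<comment> \<open>\<open>J k\<close> is square integrable but unbounded, so the product is
      dominated by the sum of the two squares.\<close>
    have J\<eta>: "integrable M (\<lambda>\<omega>. J k \<omega> * \<eta> k \<omega>)"
    proof (rule Bochner_Integration.integrable_bound[of _ "\<lambda>\<omega>. (J k \<omega>)\<^sup>2 + (\<eta> k \<omega>)\<^sup>2"])
      show "AE \<omega> in M. norm (J k \<omega> * \<eta> k \<omega>) \<le> norm ((J k \<omega>)\<^sup>2 + (\<eta> k \<omega>)\<^sup>2)"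
      proof (rule AE_I2)
        fix \<omega>
        have "2 * (\<bar>J k \<omega>\<bar> * \<bar>\<eta> k \<omega>\<bar>) \<le> (J k \<omega>)\<^sup>2 + (\<eta> k \<omega>)\<^sup>2"
          using sum_squares_bound[of "\<bar>J k \<omega>\<bar>" "\<bar>\<eta> k \<omega>\<bar>"] by simp
        moreover have "0 \<le> \<bar>J k \<omega>\<bar> * \<bar>\<eta> k \<omega>\<bar>" by simp
        ultimately have "\<bar>J k \<omega>\<bar> * \<bar>\<eta> k \<omega>\<bar> \<le> (J k \<omega>)\<^sup>2 + (\<eta> k \<omega>)\<^sup>2"
          by linarith
        then show "norm (J k \<omega> * \<eta> k \<omega>) \<le> norm ((J k \<omega>)\<^sup>2 + (\<eta> k \<omega>)\<^sup>2)"
          by (simp add: abs_mult)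
      qed
    qed (use J2 \<eta>2 JM in auto)
    have cross: "integrable M (\<lambda>\<omega>. 2 * (J k \<omega> * \<eta> k \<omega> * ?D \<omega>))"
      "expectation (\<lambda>\<omega>. 2 * (J k \<omega> * \<eta> k \<omega> * ?D \<omega>)) = 0"
      using increment_times_past(1,2)[OF _ J\<eta> k] by auto
    have sq: "integrable M (\<lambda>\<omega>. (\<eta> k \<omega>)\<^sup>2 * (?D \<omega>)\<^sup>2)"
      "expectation (\<lambda>\<omega>. (\<eta> k \<omega>)\<^sup>2 * (?D \<omega>)\<^sup>2) = expectation (\<lambda>\<omega>. (\<eta> k \<omega>)\<^sup>2) * (s (Suc k) - s k)"
      using increment_times_past(3,4)[OF _ \<eta>2 k] by auto
    have exp: "(J (Suc k) \<omega>)\<^sup>2 = (J k \<omega>)\<^sup>2 + 2 * (J k \<omega> * \<eta> k \<omega> * ?D \<omega>) + (\<eta> k \<omega>)\<^sup>2 * (?D \<omega>)\<^sup>2" for \<omega>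
      by (simp add: J_def power2_eq_square algebra_simps)
    have "\<eta> k \<in> borel_measurable (F (s (Suc k)))" "J k \<in> borel_measurable (F (s (Suc k)))"
      "W (s (Suc k)) \<in> borel_measurable (F (s (Suc k)))" "W (s k) \<in> borel_measurable (F (s (Suc k)))"
      using k W_measurable_F by (auto intro: measurable_F_mono[OF \<eta>k] measurable_F_mono[OF JF])
    then have "(\<lambda>\<omega>. J k \<omega> + \<eta> k \<omega> * ?D \<omega>) \<in> borel_measurable (F (s (Suc k)))"
      by measurable
    then have m: "J (Suc k) \<in> borel_measurable (F (s (Suc k)))" by (simp add: J_def)
    have ints: "integrable M (\<lambda>\<omega>. \<Sum>i<k. (\<eta> i \<omega>)\<^sup>2 * (s (Suc i) - s i))"
    proof (intro Bochner_Integration.integrable_sum integrable_mult_left)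
      fix i assume "i \<in> {..<k}"
      then have i: "i < m" using Suc.prems by simp
      obtain B where B: "\<And>\<omega>. \<omega> \<in> space M \<Longrightarrow> \<bar>\<eta> i \<omega>\<bar> \<le> B" using bdd[OF i] by auto
      note \<eta>[OF i, measurable]
      show "integrable M (\<lambda>\<omega>. (\<eta> i \<omega>)\<^sup>2)"
        by (rule integrable_bounded_F[of _ "s i" "B\<^sup>2"]) (use B in \<open>auto simp: abs_le_square_iff[symmetric] intro: order_trans[OF B]\<close>)
    qed
    show ?case
      using m J2 cross sq Suc ints \<eta>2 by (simp add: exp)
  qed
  then show "J m \<in> borel_measurable (F (s m))" "integrable M (\<lambda>\<omega>. (J m \<omega>)\<^sup>2)"
    "expectation (\<lambda>\<omega>. (J m \<omega>)\<^sup>2) = expectation (\<lambda>\<omega>. \<Sum>i<m. (\<eta> i \<omega>)\<^sup>2 * (s (Suc i) - s i))"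
    by auto
qed

end

subsection \<open>A truncated isometry for simple integrands\<close>

text \<open>Half-open intervals of a partition are disjoint, so at most one summand is nonzero at
  \<open>u\<close> and no mixed products survive.\<close>

lemma square_sum_disjoint_intervals:
  fixes s :: "nat \<Rightarrow> real" and a :: "nat \<Rightarrow> real"
  assumes "\<And>i. i < m \<Longrightarrow> s i \<le> s (Suc i)"
  shows "(\<Sum>i<m. a i * indicator {s i<..s (Suc i)} u)\<^sup>2 = (\<Sum>i<m. (a i)\<^sup>2 * indicator {s i<..s (Suc i)} u)"
proof -
  have mono: "j \<le> k \<Longrightarrow> k \<le> m \<Longrightarrow> s j \<le> s k" for j k
    by (induction k rule: dec_induct) (use assms in \<open>auto intro: order_trans\<close>)
  have "k \<le> m \<Longrightarrow> (\<Sum>i<k. a i * indicator {s i<..s (Suc i)} u)\<^sup>2 = (\<Sum>i<k. (a i)\<^sup>2 * indicator {s i<..s (Suc i)} u)" for k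
  proof (induction k)
    case (Suc k)
    show ?case
    proof (cases "u \<in> {s k<..s (Suc k)}")
      case True
      then have "i < k \<Longrightarrow> u \<notin> {s i<..s (Suc i)}" for i
        using mono[of "Suc i" k] Suc.prems by auto
      then have "(\<Sum>i<k. a i * indicator {s i<..s (Suc i)} u) = 0" "(\<Sum>i<k. (a i)\<^sup>2 * indicator {s i<..s (Suc i)} u) = 0"
        by (auto intro!: sum.neutral)
      then show ?thesis using True by simp
    qed (use Suc in simp)
  qed simp
  then show ?thesis by simp
qed

lemma nn_integral_sum_Ioc_indicators:
  fixes s :: "nat \<Rightarrow> real"
  assumes "\<And>i. i < m \<Longrightarrow> s i \<le> s (Suc i)" "\<And>i. i < m \<Longrightarrow> 0 \<le> a i"
  shows "(\<integral>\<^sup>+u. ennreal (\<Sum>i<m. a i * indicator {s i<..s (Suc i)} u) \<partial>lborel)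
    = ennreal (\<Sum>i<m. a i * (s (Suc i) - s i))"
proof -
  have "(\<integral>\<^sup>+u. ennreal (\<Sum>i<m. a i * indicator {s i<..s (Suc i)} u) \<partial>lborel)
      = (\<integral>\<^sup>+u. (\<Sum>i<m. ennreal (a i) * indicator {s i<..s (Suc i)} u) \<partial>lborel)"
  proof (rule nn_integral_cong)
    fix u :: real
    have "ennreal (\<Sum>i<m. a i * indicator {s i<..s (Suc i)} u) = (\<Sum>i<m. ennreal (a i * indicator {s i<..s (Suc i)} u))"
      using assms(2) by (intro sum_ennreal[symmetric]) auto
    also have "\<dots> = (\<Sum>i<m. ennreal (a i) * indicator {s i<..s (Suc i)} u)"
      by (rule sum.cong) (simp_all split: split_indicator)
    finally show "ennreal (\<Sum>i<m. a i * indicator {s i<..s (Suc i)} u) = (\<Sum>i<m. ennreal (a i) * indicator {s i<..s (Suc i)} u)" .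
  qed
  also have "\<dots> = (\<Sum>i<m. ennreal (a i * (s (Suc i) - s i)))"
    using assms
    by (subst nn_integral_sum) (auto simp: nn_integral_cmult_indicator ennreal_mult intro!: sum.cong)
  also have "\<dots> = ennreal (\<Sum>i<m. a i * (s (Suc i) - s i))"
    using assms by (intro sum_ennreal) auto
  finally show ?thesis .
qed

text \<open>The partition is 0, then the points \<tau> 0, ..., \<tau> n cut off at \<open>t\<close>,
  then \<open>t\<close>: index 0 is the gap before \<tau> 0, index \<open>Suc j\<close> the j-th
  interval of the simple process, index \<open>Suc n\<close> the gap after \<tau> n. The two gaps
  are there because the constant \<open>c\<close> must be subtracted on all of (0, t]. Where \<tau>
  j \<ge> t the interval is empty; its weight is reset because \<xi> j need not be known at time
  \<open>t\<close>. The function \<open>g\<close> is left general: a Brownian path gives the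
  stochastic integral, the step function v \<mapsto> \<open>of_bool (u \<le> v)\<close> gives the
  value of the process at \<open>u\<close>.\<close>

lemma clipped_partition_sum:
  fixes \<tau> :: "nat \<Rightarrow> real" and x :: "nat \<Rightarrow> real" and g :: "real \<Rightarrow> real" and t c :: real
  assumes "\<And>i. i < n \<Longrightarrow> \<tau> i < \<tau> (Suc i)"
  defines "s \<equiv> \<lambda>i. case i of 0 \<Rightarrow> 0 | Suc j \<Rightarrow> if j \<le> n then min t (\<tau> j) else t"
  defines "y \<equiv> \<lambda>i. (case i of 0 \<Rightarrow> 0 | Suc j \<Rightarrow> if j < n \<and> \<tau> j < t then x j else 0) - c"
  shows "(\<Sum>i<n+2. y i * (g (s (Suc i)) - g (s i)))
    = (\<Sum>j<n. x j * (g (min t (\<tau> (Suc j))) - g (min t (\<tau> j)))) - c * (g t - g 0)"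
proof -
  define z where "z i = (case i of 0 \<Rightarrow> 0 | Suc j \<Rightarrow> if j < n \<and> \<tau> j < t then x j else 0)" for i
  have "(\<Sum>i<n+2. y i * (g (s (Suc i)) - g (s i)))
     = (\<Sum>i<n+2. z i * (g (s (Suc i)) - g (s i))) - c * (\<Sum>i<n+2. g (s (Suc i)) - g (s i))"
    unfolding sum_distrib_left sum_subtractf[symmetric]
    by (intro sum.cong refl) (simp add: y_def z_def left_diff_distrib)
  also have "(\<Sum>i<n+2. g (s (Suc i)) - g (s i)) = g t - g 0"
    using sum_lessThan_telescope[of "\<lambda>i. g (s i)" "n+2"] by (simp add: s_def)
  also have "(\<Sum>i<n+2. z i * (g (s (Suc i)) - g (s i))) = (\<Sum>j<n. z (Suc j) * (g (s (Suc (Suc j))) - g (s (Suc j))))"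
  proof -
    have "z 0 = 0" "z (Suc n) = 0" by (auto simp: z_def)
    then show ?thesis
      using sum.lessThan_Suc_shift[of "\<lambda>i. z i * (g (s (Suc i)) - g (s i))" "Suc n"] by simp
  qed
  also have "\<dots> = (\<Sum>j<n. x j * (g (min t (\<tau> (Suc j))) - g (min t (\<tau> j))))"
  proof (rule sum.cong)
    fix j assume "j \<in> {..<n}"
    then show "z (Suc j) * (g (s (Suc (Suc j))) - g (s (Suc j))) = x j * (g (min t (\<tau> (Suc j))) - g (min t (\<tau> j)))"
      using assms(1)[of j] by (auto simp: z_def s_def min_def)
  qed simp
  finally show ?thesis .
qed

context brownian_filtration
begin

text \<open>
  Switching the integrand off before its accumulated square exceeds \<open>b\<close> keeps it adapted, because the
  accumulated square up to the end of an interval is already known at its beginning.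
\<close>

lemma discrete_truncated_isometry:
  fixes s :: "nat \<Rightarrow> real" and b :: real
  assumes s: "0 \<le> s 0" "\<And>i. i < m \<Longrightarrow> s i \<le> s (Suc i)"
    and \<eta>: "\<And>i. i < m \<Longrightarrow> \<eta> i \<in> borel_measurable (F (s i))"
    and bdd: "\<And>i. i < m \<Longrightarrow> \<exists>B. \<forall>\<omega>\<in>space M. \<bar>\<eta> i \<omega>\<bar> \<le> B"
    and b: "0 \<le> b"
  defines "Q \<equiv> \<lambda>\<omega>. \<Sum>i<m. (\<eta> i \<omega>)\<^sup>2 * (s (Suc i) - s i)"
  shows "\<exists>J\<in>borel_measurable M. (\<integral>\<^sup>+\<omega>. ennreal ((J \<omega>)\<^sup>2) \<partial>M) \<le> (\<integral>\<^sup>+\<omega>. ennreal (min b (Q \<omega>)) \<partial>M) \<and>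
    (\<forall>\<omega>. Q \<omega> \<le> b \<longrightarrow> J \<omega> = (\<Sum>i<m. \<eta> i \<omega> * (W (s (Suc i)) \<omega> - W (s i) \<omega>)))"
proof -
  define R where "R k \<omega> = (\<Sum>i<k. (\<eta> i \<omega>)\<^sup>2 * (s (Suc i) - s i))" for k \<omega>
  define \<zeta> where "\<zeta> i \<omega> = (if R (Suc i) \<omega> \<le> b then \<eta> i \<omega> else 0)" for i \<omega>
  define J where "J \<omega> = (\<Sum>i<m. \<zeta> i \<omega> * (W (s (Suc i)) \<omega> - W (s i) \<omega>))" for \<omega>
  have mono: "j \<le> k \<Longrightarrow> k \<le> m \<Longrightarrow> s j \<le> s k" for j k
    by (induction k rule: dec_induct) (use s in \<open>auto intro: order_trans\<close>)
  have \<zeta>: "\<zeta> i \<in> borel_measurable (F (s i))" if i: "i < m" for i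
  proof -
    have "\<eta> j \<in> borel_measurable (F (s i))" if "j \<le> i" for j
      using that i mono[of j i] \<eta>[of j] measurable_F_mono by auto
    then have [measurable]: "R (Suc i) \<in> borel_measurable (F (s i))" "\<eta> i \<in> borel_measurable (F (s i))"
      unfolding R_def[abs_def] by (auto intro!: borel_measurable_sum borel_measurable_times borel_measurable_power)
    show ?thesis unfolding \<zeta>_def[abs_def] by measurable
  qed
  have \<zeta>bdd: "\<exists>B. \<forall>\<omega>\<in>space M. \<bar>\<zeta> i \<omega>\<bar> \<le> B" if i: "i < m" for i
  proof -
    obtain B where "\<forall>\<omega>\<in>space M. \<bar>\<eta> i \<omega>\<bar> \<le> B" using bdd[OF i] by auto
    then show ?thesis by (intro exI[of _ "\<bar>B\<bar>"]) (auto simp: \<zeta>_def)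
  qed
  note iso = discrete_isometry[of s m \<zeta>, OF s \<zeta> \<zeta>bdd, folded J_def]
  have nonneg: "0 \<le> (\<eta> i \<omega>)\<^sup>2 * (s (Suc i) - s i)" if "i < m" for i \<omega>
    using s(2)[OF that] by simp
  have Rmono: "j \<le> k \<Longrightarrow> k \<le> m \<Longrightarrow> R j \<omega> \<le> R k \<omega>" for j k \<omega>
    unfolding R_def by (intro sum_mono2) (auto intro!: nonneg)
  \<comment> \<open>When adding a term would push \<open>R\<close> past \<open>b\<close>, that term
    has been set to zero: the sum keeps its old bound, and \<open>min b (R k \<omega>)\<close> can
    only grow with \<open>k\<close>.\<close>
  have trunc: "k \<le> m \<Longrightarrow> (\<Sum>i<k. (\<zeta> i \<omega>)\<^sup>2 * (s (Suc i) - s i)) \<le> min b (R k \<omega>)" for k \<omega>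
  proof (induction k)
    case (Suc k)
    then have IH: "(\<Sum>i<k. (\<zeta> i \<omega>)\<^sup>2 * (s (Suc i) - s i)) \<le> min b (R k \<omega>)" by simp
    show ?case
    proof (cases "R (Suc k) \<omega> \<le> b")
      case True
      then show ?thesis using IH by (simp add: \<zeta>_def R_def)
    next
      case False
      then show ?thesis using IH Rmono[of k "Suc k" \<omega>] Suc.prems by (simp add: \<zeta>_def)
    qed
  qed (use b in \<open>simp add: R_def\<close>)
  have RQ: "R m = Q" by (simp add: R_def Q_def fun_eq_iff)
  have zint: "integrable M (\<lambda>\<omega>. \<Sum>i<m. (\<zeta> i \<omega>)\<^sup>2 * (s (Suc i) - s i))"
  proof (intro Bochner_Integration.integrable_sum integrable_mult_left)
    fix i assume "i \<in> {..<m}"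
    then have i: "i < m" by simp
    obtain B where B: "\<And>\<omega>. \<omega> \<in> space M \<Longrightarrow> \<bar>\<zeta> i \<omega>\<bar> \<le> B" using \<zeta>bdd[OF i] by auto
    note \<zeta>[OF i, measurable]
    show "integrable M (\<lambda>\<omega>. (\<zeta> i \<omega>)\<^sup>2)"
      by (rule integrable_bounded_F[of _ "s i" "B\<^sup>2"]) (use B in \<open>auto simp: abs_le_square_iff[symmetric] intro: order_trans[OF B]\<close>)
  qed
  have "(\<integral>\<^sup>+\<omega>. ennreal ((J \<omega>)\<^sup>2) \<partial>M) = ennreal (expectation (\<lambda>\<omega>. (J \<omega>)\<^sup>2))"
    by (rule nn_integral_eq_integral) (use iso(2) in \<open>auto simp: J_def\<close>)
  also have "\<dots> = ennreal (expectation (\<lambda>\<omega>. \<Sum>i<m. (\<zeta> i \<omega>)\<^sup>2 * (s (Suc i) - s i)))"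
    using iso(3) by (simp add: J_def)
  also have "\<dots> = (\<integral>\<^sup>+\<omega>. ennreal (\<Sum>i<m. (\<zeta> i \<omega>)\<^sup>2 * (s (Suc i) - s i)) \<partial>M)"
    using s(2) by (intro nn_integral_eq_integral[symmetric] zint AE_I2 sum_nonneg) auto
  also have "\<dots> \<le> (\<integral>\<^sup>+\<omega>. ennreal (min b (Q \<omega>)) \<partial>M)"
    using trunc[of m] RQ by (intro nn_integral_mono ennreal_leI) auto
  finally have "(\<integral>\<^sup>+\<omega>. ennreal ((J \<omega>)\<^sup>2) \<partial>M) \<le> (\<integral>\<^sup>+\<omega>. ennreal (min b (Q \<omega>)) \<partial>M)" .
  moreover have "J \<in> borel_measurable M"
    using iso(1) measurable_F_M unfolding J_def[abs_def] by blast
  moreover have "J \<omega> = (\<Sum>i<m. \<eta> i \<omega> * (W (s (Suc i)) \<omega> - W (s i) \<omega>))" if "Q \<omega> \<le> b" for \<omega>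
    unfolding J_def
  proof (rule sum.cong)
    fix i assume "i \<in> {..<m}"
    then have "R (Suc i) \<omega> \<le> b" using Rmono[of "Suc i" m \<omega>] that RQ by auto
    then show "\<zeta> i \<omega> * (W (s (Suc i)) \<omega> - W (s i) \<omega>) = \<eta> i \<omega> * (W (s (Suc i)) \<omega> - W (s i) \<omega>)"
      by (simp add: \<zeta>_def)
  qed simp
  ultimately show ?thesis by blast
qed

text \<open>The discrete estimate on the clipped partition of [0, t]; there the accumulated square
  \<open>Q\<close> is the time integral \<open>A\<close>. A random variable \<open>J\<close> is
  produced, rather than an estimate of the integral itself, because switching off changes the
  integral wherever the accumulated square exceeds \<open>b\<close>.\<close>

lemma simple_truncated_isometry:
  fixes b c t :: real
  assumes sp: "simple_process M F n \<tau> \<xi>" and t: "0 \<le> t" and b: "0 \<le> b"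
  defines "A \<equiv> \<lambda>\<omega>. \<integral>\<^sup>+u\<in>{0..t}. ennreal ((simple_value n \<tau> \<xi> u \<omega> - c)\<^sup>2) \<partial>lborel"
  shows "\<exists>J\<in>borel_measurable M. (\<integral>\<^sup>+\<omega>. ennreal ((J \<omega>)\<^sup>2) \<partial>M) \<le> (\<integral>\<^sup>+\<omega>. min (ennreal b) (A \<omega>) \<partial>M) \<and>
    (\<forall>\<omega>. A \<omega> \<le> ennreal b \<longrightarrow> J \<omega> = simple_integral W n \<tau> \<xi> t \<omega> - c * (W t \<omega> - W 0 \<omega>))"
proof -
  have \<tau>0: "0 \<le> \<tau> 0" and \<tau>: "\<And>i. i < n \<Longrightarrow> \<tau> i < \<tau> (Suc i)"
    and \<xi>: "\<And>i. i < n \<Longrightarrow> \<xi> i \<in> borel_measurable (F (\<tau> i))"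
    and \<xi>b: "\<And>i. i < n \<Longrightarrow> \<exists>B. \<forall>\<omega>\<in>space M. \<bar>\<xi> i \<omega>\<bar> \<le> B"
    using sp by (auto simp: simple_process_def)
  have \<tau>nn: "i \<le> n \<Longrightarrow> 0 \<le> \<tau> i" for i
  proof (induction i)
    case (Suc i) then show ?case using \<tau>[of i] by simp
  qed (use \<tau>0 in simp)
  define s where "s i = (case i of 0 \<Rightarrow> 0 | Suc j \<Rightarrow> if j \<le> n then min t (\<tau> j) else t)" for i
  define \<eta> where "\<eta> i \<omega> = (case i of 0 \<Rightarrow> 0 | Suc j \<Rightarrow> if j < n \<and> \<tau> j < t then \<xi> j \<omega> else 0) - c" for i \<omega>
  have smono: "s i \<le> s (Suc i)" if "i < n + 2" for i
  proof (cases i)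
    case (Suc j)
    then show ?thesis using \<tau>[of j] by (auto simp: s_def min_def)
  qed (use t \<tau>nn in \<open>auto simp: s_def\<close>)
  have s0: "s 0 = 0" "s (n + 2) = t" by (auto simp: s_def)
  have \<eta>m: "\<eta> i \<in> borel_measurable (F (s i))" if "i < n + 2" for i
  proof (cases "\<exists>j<n. i = Suc j \<and> \<tau> j < t")
    case True
    then obtain j where j: "i = Suc j" "j < n" "\<tau> j < t" by auto
    note \<xi>[OF j(2), measurable]
    have "(\<lambda>\<omega>. \<xi> j \<omega> - c) \<in> borel_measurable (F (\<tau> j))" by measurable
    moreover have "\<eta> i = (\<lambda>\<omega>. \<xi> j \<omega> - c)" "s i = \<tau> j" using j by (auto simp: \<eta>_def s_def)
    ultimately show ?thesis by simp
  next
    case False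
    then have "\<eta> i = (\<lambda>\<omega>. - c)" by (auto simp: \<eta>_def fun_eq_iff split: nat.split)
    then show ?thesis by simp
  qed
  have \<eta>b: "\<exists>B. \<forall>\<omega>\<in>space M. \<bar>\<eta> i \<omega>\<bar> \<le> B" if "i < n + 2" for i
  proof (cases "\<exists>j<n. i = Suc j \<and> \<tau> j < t")
    case True
    then obtain j where j: "i = Suc j" "j < n" "\<tau> j < t" by auto
    then obtain B where "\<forall>\<omega>\<in>space M. \<bar>\<xi> j \<omega>\<bar> \<le> B" using \<xi>b by auto
    then show ?thesis using j by (intro exI[of _ "B + \<bar>c\<bar>"]) (force simp: \<eta>_def)
  next
    case False
    then have "\<eta> i = (\<lambda>\<omega>. - c)" by (auto simp: \<eta>_def fun_eq_iff split: nat.split)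
    then show ?thesis by auto
  qed
  define Q where "Q \<omega> = (\<Sum>i<n+2. (\<eta> i \<omega>)\<^sup>2 * (s (Suc i) - s i))" for \<omega>
  have SI: "(\<Sum>i<n+2. \<eta> i \<omega> * (W (s (Suc i)) \<omega> - W (s i) \<omega>))
      = simple_integral W n \<tau> \<xi> t \<omega> - c * (W t \<omega> - W 0 \<omega>)" for \<omega>
    using clipped_partition_sum[of n \<tau>, OF \<tau>, where x="\<lambda>j. \<xi> j \<omega>" and g="\<lambda>u. W u \<omega>" and t=t and c=c]
    by (simp add: \<eta>_def s_def simple_integral_def del: sum.lessThan_Suc)
  have SV: "(\<Sum>i<n+2. \<eta> i \<omega> * indicator {s i<..s (Suc i)} u) = (if 0 < u \<and> u \<le> t then simple_value n \<tau> \<xi> u \<omega> - c else 0)" for \<omega> u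
  proof -
    \<comment> \<open>The indicator of a half-open interval is a difference of step functions of its
      endpoints, so the clipping identity used for \<open>W\<close> also evaluates the
      process.\<close>
    have "(\<Sum>i<n+2. \<eta> i \<omega> * indicator {s i<..s (Suc i)} u)
        = (\<Sum>i<n+2. \<eta> i \<omega> * (of_bool (u \<le> s (Suc i)) - of_bool (u \<le> s i)))"
      using smono by (intro sum.cong) (auto simp: indicator_def, fastforce)
    also have "\<dots> = (\<Sum>j<n. \<xi> j \<omega> * (of_bool (u \<le> min t (\<tau> (Suc j))) - of_bool (u \<le> min t (\<tau> j)))) - c * (of_bool (u \<le> t) - of_bool (u \<le> 0))"
      using clipped_partition_sum[of n \<tau>, OF \<tau>, where x="\<lambda>j. \<xi> j \<omega>" and g="\<lambda>v. of_bool (u \<le> v)" and t=t and c=c]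
      by (simp add: \<eta>_def s_def del: sum.lessThan_Suc)
    also have "(\<Sum>j<n. \<xi> j \<omega> * (of_bool (u \<le> min t (\<tau> (Suc j))) - of_bool (u \<le> min t (\<tau> j))))
       = (if 0 < u \<and> u \<le> t then simple_value n \<tau> \<xi> u \<omega> else 0)"
    proof -
      have "of_bool (u \<le> min t (\<tau> (Suc j))) - of_bool (u \<le> min t (\<tau> j)) =
        (if 0 < u \<and> u \<le> t then indicator {\<tau> j<..\<tau> (Suc j)} u else (0::real))" if "j < n" for j
        using \<tau>[OF that] \<tau>nn[of j] that by (auto simp: indicator_def)
      then show ?thesis unfolding simple_value_def by (auto intro!: sum.cong sum.neutral)
    qed
    finally show ?thesis using t by auto
  qed
  have AQ: "A \<omega> = ennreal (Q \<omega>)" for \<omega>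
  proof -
    have "A \<omega> = (\<integral>\<^sup>+u. ennreal ((\<Sum>i<n+2. \<eta> i \<omega> * indicator {s i<..s (Suc i)} u)\<^sup>2) \<partial>lborel)"
      unfolding A_def
    proof (rule nn_integral_cong_AE)
      show "AE u in lborel. ennreal ((simple_value n \<tau> \<xi> u \<omega> - c)\<^sup>2) * indicator {0..t} u =
         ennreal ((\<Sum>i<n + 2. \<eta> i \<omega> * indicator {s i<..s (Suc i)} u)\<^sup>2)"
        \<comment> \<open>The half-open intervals miss time 0, which the closed interval in
          \<open>A\<close> contains; it is a null set.\<close>
        using AE_lborel_singleton[of "0::real"] by eventually_elim (unfold SV, auto simp: indicator_def)
    qed
    also have "\<dots> = ennreal (Q \<omega>)"
      unfolding Q_def by (subst square_sum_disjoint_intervals[of "n + 2" s, OF smono]) (assumption, rule nn_integral_sum_Ioc_indicators, erule smono, simp)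
    finally show ?thesis .
  qed
  have Qnn: "0 \<le> Q \<omega>" for \<omega> unfolding Q_def using smono by (intro sum_nonneg) auto
  obtain J where "J \<in> borel_measurable M" "(\<integral>\<^sup>+\<omega>. ennreal ((J \<omega>)\<^sup>2) \<partial>M) \<le> (\<integral>\<^sup>+\<omega>. ennreal (min b (Q \<omega>)) \<partial>M)"
    "\<And>\<omega>. Q \<omega> \<le> b \<Longrightarrow> J \<omega> = (\<Sum>i<n+2. \<eta> i \<omega> * (W (s (Suc i)) \<omega> - W (s i) \<omega>))"
    using discrete_truncated_isometry[of s "n+2" \<eta> b, OF _ smono \<eta>m \<eta>b b, folded Q_def] s0 by auto
  moreover have "ennreal (min b (Q \<omega>)) = min (ennreal b) (A \<omega>)" for \<omega>
    using b Qnn by (simp add: AQ min_def)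
  ultimately show ?thesis
    using b Qnn by (intro bexI[of _ J]) (auto simp: AQ SI[symmetric])
qed

end

subsection \<open>Ito integrals\<close>

text \<open>The difference of the two sides is a perfect square divided by \<open>e\<close>. With
  \<open>e\<close> tending to 0 the factor of the first square tends to 1, which keeps the constant
  of the isometry; with \<open>e = 1\<close> this is the usual bound with factor 2.\<close>

lemma square_add_le_weighted:
  fixes x y e :: real
  assumes "0 < e"
  shows "(x + y)\<^sup>2 \<le> (1 + e) * x\<^sup>2 + (1 + 1 / e) * y\<^sup>2"
proof -
  have "(1 + e) * x\<^sup>2 + (1 + 1 / e) * y\<^sup>2 - (x + y)\<^sup>2 = (e * x - y)\<^sup>2 / e"
    using assms by (simp add: field_simps power2_eq_square)
  moreover have "0 \<le> (e * x - y)\<^sup>2 / e" using assms by simp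
  ultimately show ?thesis by linarith
qed

text \<open>Choose the j-th index so that exceeding 2^-j has probability below 2^-j. These
  probabilities are summable, and Borel-Cantelli leaves almost surely only finitely many
  exceedances.\<close>

lemma (in prob_space) vanishes_in_prob_AE_subseq:
  assumes D: "vanishes_in_prob M D" and [measurable]: "\<And>k. D k \<in> borel_measurable M"
  obtains r :: "nat \<Rightarrow> nat" where "strict_mono r" "AE \<omega> in M. (\<lambda>k. D (r k) \<omega>) \<longlonglongrightarrow> 0"
proof -
  let ?A = "\<lambda>j k. {\<omega>\<in>space M. ennreal ((1 / 2) ^ j) < D k \<omega>}"
  have ex: "\<exists>k>N. prob (?A j k) < (1 / 2) ^ j" for j N
  proof -
    have "(\<lambda>k. prob (?A j k)) \<longlonglongrightarrow> 0"
      using D unfolding vanishes_in_prob_def by (auto dest: spec[of _ "(1 / 2) ^ j"])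
    then have "\<forall>\<^sub>F k in sequentially. prob (?A j k) < (1 / 2) ^ j"
      by (rule order_tendstoD) simp
    then have "\<forall>\<^sub>F k in sequentially. k > N \<and> prob (?A j k) < (1 / 2) ^ j"
      using eventually_gt_at_top[of N] by eventually_elim simp
    then show ?thesis by (auto simp: eventually_sequentially)
  qed
  have "\<exists>r. \<forall>j. prob (?A j (r j)) < (1 / 2) ^ j \<and> r j < r (Suc j)"
    by (rule dependent_nat_choice) (use ex in blast)+
  then obtain r where r: "\<And>j. prob (?A j (r j)) < (1 / 2) ^ j" "\<And>j. r j < r (Suc j)" by auto
  have "AE \<omega> in M. eventually (\<lambda>j. \<omega> \<in> space M - ?A j (r j)) sequentially"
  proof (rule borel_cantelli_AE1)
    show "summable (\<lambda>j. prob (?A j (r j)))"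
      by (rule summable_comparison_test'[of "\<lambda>j. (1 / 2 :: real) ^ j" 0]) (auto intro!: summable_geometric less_imp_le r)
  qed (auto simp: less_top[symmetric])
  then have "AE \<omega> in M. (\<lambda>j. D (r j) \<omega>) \<longlonglongrightarrow> 0"
  proof eventually_elim
    case (elim \<omega>)
    have lim: "(\<lambda>j. ennreal ((1 / 2) ^ j)) \<longlonglongrightarrow> 0"
      using tendsto_ennrealI[OF LIMSEQ_power_zero[of "1 / 2 :: real"]] by simp
    show ?case
      by (rule tendsto_sandwich[OF _ _ tendsto_const lim])
        (use elim in \<open>auto elim: eventually_mono\<close>)
  qed
  moreover have "strict_mono r" using r(2) by (rule strict_monoI_Suc)
  ultimately show ?thesis using that by blast
qed

lemma vanishes_in_prob_subseq:
  assumes "vanishes_in_prob M D" "strict_mono r"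
  shows "vanishes_in_prob M (\<lambda>k. D (r k))"
  unfolding vanishes_in_prob_def
proof (intro allI impI)
  fix \<epsilon> :: real assume "0 < \<epsilon>"
  then have "(\<lambda>k. measure M {\<omega>\<in>space M. ennreal \<epsilon> < D k \<omega>}) \<longlonglongrightarrow> 0"
    using assms by (simp add: vanishes_in_prob_def)
  from LIMSEQ_subseq_LIMSEQ[OF this assms(2)]
  show "(\<lambda>k. measure M {\<omega> \<in> space M. ennreal \<epsilon> < D (r k) \<omega>}) \<longlonglongrightarrow> 0" by (simp add: comp_def)
qed

context brownian_filtration
begin

text \<open>Clipping time into [0, t] gives a measurable map of the whole product into the space on
  which progressive measurability speaks; the sets of \<open>F t\<close> are sets of
  \<open>M\<close>.\<close>

lemma progressively_measurable_joint:
  assumes "progressively_measurable F H" "0 \<le> t"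
  shows "(\<lambda>(\<omega>, u). H (max 0 (min t u)) \<omega>) \<in> borel_measurable (M \<Otimes>\<^sub>M lborel)"
proof -
  have "(\<lambda>x. x) \<in> measurable M (F t)"
    using subalgebra_F[of t] by (auto simp: measurable_def subalgebra_def)
  then have "fst \<in> measurable (M \<Otimes>\<^sub>M lborel) (F t)"
    using measurable_compose[OF measurable_fst] by blast
  moreover have "(\<lambda>p. max 0 (min t (snd p))) \<in> measurable (M \<Otimes>\<^sub>M lborel) (restrict_space borel {0..t})"
    using assms(2) by (intro measurable_restrict_space2) auto
  ultimately have "(\<lambda>p. (max 0 (min t (snd p)), fst p)) \<in> measurable (M \<Otimes>\<^sub>M lborel) (restrict_space borel {0..t} \<Otimes>\<^sub>M F t)"
    by (intro measurable_Pair) auto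
  moreover have "(\<lambda>(s, \<omega>). H s \<omega>) \<in> borel_measurable (restrict_space borel {0..t} \<Otimes>\<^sub>M F t)"
    using assms by (auto simp: progressively_measurable_def)
  ultimately have "(\<lambda>p. (\<lambda>(s, \<omega>). H s \<omega>) (max 0 (min t (snd p)), fst p)) \<in> borel_measurable (M \<Otimes>\<^sub>M lborel)"
    by (rule measurable_compose)
  then show ?thesis by (simp add: split_beta')
qed

lemma energy_measurable:
  assumes "progressively_measurable F H" "0 \<le> t"
  shows "(\<lambda>\<omega>. \<integral>\<^sup>+u\<in>{0..t}. ennreal ((H u \<omega> - c)\<^sup>2) \<partial>lborel) \<in> borel_measurable M"
proof -
  note progressively_measurable_joint[OF assms, measurable]
  have "(\<lambda>\<omega>. \<integral>\<^sup>+u. ennreal ((H (max 0 (min t u)) \<omega> - c)\<^sup>2) * indicator {0..t} u \<partial>lborel) \<in> borel_measurable M"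
    by measurable
  moreover have "(\<lambda>\<omega>. \<integral>\<^sup>+u. ennreal ((H (max 0 (min t u)) \<omega> - c)\<^sup>2) * indicator {0..t} u \<partial>lborel)
    = (\<lambda>\<omega>. \<integral>\<^sup>+u\<in>{0..t}. ennreal ((H u \<omega> - c)\<^sup>2) \<partial>lborel)"
    by (intro ext nn_integral_cong) (auto simp: indicator_def)
  ultimately show ?thesis by simp
qed

text \<open>Fatou along an almost surely convergent subsequence of simple integrals. The strict
  inequality on the left gives room: where \<open>A\<close> is below \<open>b\<close>, the
  accumulated squares \<open>B k\<close> of the approximants are eventually at most
  \<open>b\<close>, so \<open>J k\<close> is eventually the true simple integral. On the right, the
  truncation at \<open>b\<close> supplies the dominating constant.\<close>

lemma ito_truncated_isometry:
  fixes b c t :: real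
  assumes ito: "has_ito_integral M F W H X" and t: "0 \<le> t" and b: "0 \<le> b"
  defines "A \<equiv> \<lambda>\<omega>. \<integral>\<^sup>+u\<in>{0..t}. ennreal ((H u \<omega> - c)\<^sup>2) \<partial>lborel"
  shows "(\<integral>\<^sup>+\<omega>. ennreal ((X t \<omega> - c * (W t \<omega> - W 0 \<omega>))\<^sup>2) * indicator {\<omega>. A \<omega> < ennreal b} \<omega> \<partial>M)
    \<le> (\<integral>\<^sup>+\<omega>. min (ennreal b) (A \<omega>) \<partial>M)"
proof -
  have prog: "progressively_measurable F H" and Xm[measurable]: "X t \<in> borel_measurable M"
    using ito t by (auto simp: has_ito_integral_def)
  obtain n \<tau> \<xi> where simple: "\<And>k. simple_process M F (n k) (\<tau> k) (\<xi> k)"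
    and van: "vanishes_in_prob M (\<lambda>k \<omega>. \<integral>\<^sup>+s\<in>{0..t}.
             ennreal ((simple_value (n k) (\<tau> k) (\<xi> k) s \<omega> - H s \<omega>)\<^sup>2) \<partial>lborel)"
      "vanishes_in_prob M (\<lambda>k \<omega>. ennreal \<bar>simple_integral W (n k) (\<tau> k) (\<xi> k) t \<omega> - X t \<omega>\<bar>)"
    using ito t unfolding has_ito_integral_def by blast
  define V where "V k s \<omega> = simple_value (n k) (\<tau> k) (\<xi> k) s \<omega>" for k s \<omega>
  define I where "I k \<omega> = simple_integral W (n k) (\<tau> k) (\<xi> k) t \<omega>" for k \<omega>
  define E where "E k \<omega> = (\<integral>\<^sup>+s\<in>{0..t}. ennreal ((V k s \<omega> - H s \<omega>)\<^sup>2) \<partial>lborel)" for k \<omega>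
  have \<xi>m: "\<xi> k i \<in> borel_measurable M" if "i < n k" for i k
    using simple[of k] that measurable_F_M by (auto simp: simple_process_def)
  have \<tau>nn: "i \<le> n k \<Longrightarrow> 0 \<le> \<tau> k i" for i k
  proof (induction i)
    case (Suc i) then have "\<tau> k i < \<tau> k (Suc i)" using simple[of k] by (auto simp: simple_process_def)
    then show ?case using Suc by simp
  qed (use simple[of k] in \<open>simp add: simple_process_def\<close>)
  note joint[measurable] = progressively_measurable_joint[OF prog t]
  have Vm[measurable]: "(\<lambda>(\<omega>, s). V k s \<omega>) \<in> borel_measurable (M \<Otimes>\<^sub>M lborel)" for k
    unfolding V_def simple_value_def split_beta'
    by (intro borel_measurable_sum borel_measurable_times measurable_compose[OF measurable_fst \<xi>m]) auto
  have Im[measurable]: "I k \<in> borel_measurable M" for k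
    unfolding I_def[abs_def] simple_integral_def using \<tau>nn t
    by (intro borel_measurable_sum borel_measurable_times borel_measurable_diff \<xi>m W_measurable) auto
  have Eclip: "E k \<omega> = (\<integral>\<^sup>+s. ennreal ((V k s \<omega> - H (max 0 (min t s)) \<omega>)\<^sup>2) * indicator {0..t} s \<partial>lborel)" for k \<omega>
    unfolding E_def by (intro nn_integral_cong) (auto simp: indicator_def)
  have Aclip: "A \<omega> = (\<integral>\<^sup>+s. ennreal ((H (max 0 (min t s)) \<omega> - c)\<^sup>2) * indicator {0..t} s \<partial>lborel)" for \<omega>
    unfolding A_def by (intro nn_integral_cong) (auto simp: indicator_def)
  have Em[measurable]: "E k \<in> borel_measurable M" for k
    unfolding Eclip[abs_def] by measurable
  have Am[measurable]: "A \<in> borel_measurable M"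
    unfolding A_def by (rule energy_measurable[OF prog t])
  have "vanishes_in_prob M E" using van(1) by (simp add: E_def[abs_def] V_def)
  then obtain r1 where r1: "strict_mono r1" "AE \<omega> in M. (\<lambda>k. E (r1 k) \<omega>) \<longlonglongrightarrow> 0"
    by (rule vanishes_in_prob_AE_subseq) auto
  have "vanishes_in_prob M (\<lambda>k \<omega>. ennreal \<bar>I (r1 k) \<omega> - X t \<omega>\<bar>)"
    using vanishes_in_prob_subseq[OF van(2) r1(1)] by (simp add: I_def)
  then obtain r2 where r2: "strict_mono r2" "AE \<omega> in M. (\<lambda>k. ennreal \<bar>I (r1 (r2 k)) \<omega> - X t \<omega>\<bar>) \<longlonglongrightarrow> 0"
    by (rule vanishes_in_prob_AE_subseq) auto
  \<comment> \<open>The second subsequence is taken out of the first, so that along \<open>r\<close>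
    both the integrands and the integrals converge almost surely.\<close>
  define r where "r k = r1 (r2 k)" for k
  have convE: "AE \<omega> in M. (\<lambda>k. E (r k) \<omega>) \<longlonglongrightarrow> 0"
    using r1(2) by eventually_elim (use LIMSEQ_subseq_LIMSEQ[OF _ r2(1)] in \<open>auto simp: r_def comp_def\<close>)
  have convI: "AE \<omega> in M. (\<lambda>k. I (r k) \<omega>) \<longlonglongrightarrow> X t \<omega>"
    using r2(2)
  proof eventually_elim
    case (elim \<omega>)
    then have "(\<lambda>k. \<bar>I (r k) \<omega> - X t \<omega>\<bar>) \<longlonglongrightarrow> 0"
      by (simp add: r_def ennreal_0[symmetric] tendsto_ennreal_iff del: ennreal_0)
    then show ?case by (simp add: tendsto_rabs_zero_iff LIM_zero_cancel)
  qed
  define B where "B k \<omega> = (\<integral>\<^sup>+s\<in>{0..t}. ennreal ((V (r k) s \<omega> - c)\<^sup>2) \<partial>lborel)" for k \<omega>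
  have Bm[measurable]: "B k \<in> borel_measurable M" for k unfolding B_def[abs_def] by measurable
  have BA: "B k \<omega> \<le> ennreal (1 + e) * A \<omega> + ennreal (1 + 1 / e) * E (r k) \<omega>"
    if e: "0 < e" and \<omega>[measurable]: "\<omega> \<in> space M" for e k \<omega>
  proof -
    have [measurable]: "(\<lambda>s. H (max 0 (min t s)) \<omega>) \<in> borel_measurable lborel" "(\<lambda>s. V (r k) s \<omega>) \<in> borel_measurable lborel"
      using measurable_Pair2[OF joint \<omega>] measurable_Pair2[OF Vm \<omega>] by auto
    have "B k \<omega> \<le> (\<integral>\<^sup>+s. ennreal (1 + e) * (ennreal ((H (max 0 (min t s)) \<omega> - c)\<^sup>2) * indicator {0..t} s) +
       ennreal (1 + 1 / e) * (ennreal ((V (r k) s \<omega> - H (max 0 (min t s)) \<omega>)\<^sup>2) * indicator {0..t} s) \<partial>lborel)"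
      unfolding B_def
    proof (rule nn_integral_mono)
      fix s
      have "(V (r k) s \<omega> - c)\<^sup>2 \<le> (1 + e) * (H s \<omega> - c)\<^sup>2 + (1 + 1 / e) * (V (r k) s \<omega> - H s \<omega>)\<^sup>2"
        using square_add_le_weighted[OF e, of "H s \<omega> - c" "V (r k) s \<omega> - H s \<omega>"] by simp
      then have "ennreal ((V (r k) s \<omega> - c)\<^sup>2) \<le> ennreal ((1 + e) * (H s \<omega> - c)\<^sup>2 + (1 + 1 / e) * (V (r k) s \<omega> - H s \<omega>)\<^sup>2)"
        by (rule ennreal_leI)
      also have "\<dots> = ennreal (1 + e) * ennreal ((H s \<omega> - c)\<^sup>2) + ennreal (1 + 1 / e) * ennreal ((V (r k) s \<omega> - H s \<omega>)\<^sup>2)"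
        using e by (simp add: ennreal_mult ennreal_plus)
      finally show "ennreal ((V (r k) s \<omega> - c)\<^sup>2) * indicator {0..t} s \<le>
        ennreal (1 + e) * (ennreal ((H (max 0 (min t s)) \<omega> - c)\<^sup>2) * indicator {0..t} s) +
         ennreal (1 + 1 / e) * (ennreal ((V (r k) s \<omega> - H (max 0 (min t s)) \<omega>)\<^sup>2) * indicator {0..t} s)"
        by (auto simp: indicator_def)
    qed
    also have "\<dots> = ennreal (1 + e) * A \<omega> + ennreal (1 + 1 / e) * E (r k) \<omega>"
      unfolding Aclip Eclip by (subst nn_integral_add) (auto simp: nn_integral_cmult)
    finally show ?thesis .
  qed
  have "\<forall>k. \<exists>J. J \<in> borel_measurable M \<and> (\<integral>\<^sup>+\<omega>. ennreal ((J \<omega>)\<^sup>2) \<partial>M) \<le> (\<integral>\<^sup>+\<omega>. min (ennreal b) (B k \<omega>) \<partial>M) \<and>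
    (\<forall>\<omega>. B k \<omega> \<le> ennreal b \<longrightarrow> J \<omega> = I (r k) \<omega> - c * (W t \<omega> - W 0 \<omega>))"
    using simple_truncated_isometry[OF simple t b, of _ c] unfolding B_def V_def I_def by blast
  then obtain J where Jm[measurable]: "\<And>k. J k \<in> borel_measurable M"
    and J2: "\<And>k. (\<integral>\<^sup>+\<omega>. ennreal ((J k \<omega>)\<^sup>2) \<partial>M) \<le> (\<integral>\<^sup>+\<omega>. min (ennreal b) (B k \<omega>) \<partial>M)"
    and JI: "\<And>k \<omega>. B k \<omega> \<le> ennreal b \<Longrightarrow> J k \<omega> = I (r k) \<omega> - c * (W t \<omega> - W 0 \<omega>)"
    by metis
  have lim_bound: "(\<lambda>k. ennreal (1 + e) * A \<omega> + ennreal (1 + 1 / e) * E (r k) \<omega>) \<longlonglongrightarrow> ennreal (1 + e) * A \<omega>"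
    if "(\<lambda>k. E (r k) \<omega>) \<longlonglongrightarrow> 0" for e \<omega>
    using tendsto_add[OF tendsto_const[of "ennreal (1 + e) * A \<omega>"] ennreal_tendsto_cmult[OF _ that, of "ennreal (1 + 1 / e)"]] by simp
  let ?L = "\<integral>\<^sup>+\<omega>. ennreal ((X t \<omega> - c * (W t \<omega> - W 0 \<omega>))\<^sup>2) * indicator {\<omega>. A \<omega> < ennreal b} \<omega> \<partial>M"
  have "?L \<le> (\<integral>\<^sup>+\<omega>. liminf (\<lambda>k. ennreal ((J k \<omega>)\<^sup>2)) \<partial>M)"
  proof (rule nn_integral_mono_AE)
    show "AE \<omega> in M. ennreal ((X t \<omega> - c * (W t \<omega> - W 0 \<omega>))\<^sup>2) * indicator {\<omega>. A \<omega> < ennreal b} \<omega>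
       \<le> liminf (\<lambda>k. ennreal ((J k \<omega>)\<^sup>2))"
      using convE convI AE_space
    proof eventually_elim
      case (elim \<omega>)
      show ?case
      proof (cases "A \<omega> < ennreal b")
        case True
        then obtain a where a: "A \<omega> = ennreal a" "0 \<le> a" "a < b"
          by (cases "A \<omega>") (auto simp: ennreal_less_iff)
        \<comment> \<open>Chosen so that (1 + e) a stays below the midpoint of \<open>a\<close> and
          \<open>b\<close>, or at it; dividing by \<open>a + 1\<close> instead of \<open>a\<close>
          admits \<open>a = 0\<close>.\<close>
        define e where "e = (b - a) / (2 * (a + 1))"
        have e: "0 < e" using a by (simp add: e_def)
        have "(1 + e) * a = a + (b - a) / 2 * (a / (a + 1))" using a by (simp add: e_def field_simps)
        also have "\<dots> \<le> a + (b - a) / 2 * 1" using a by (intro add_left_mono mult_left_mono) auto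
        also have "\<dots> < b" using a by (simp add: field_simps)
        finally have "(1 + e) * a < b" .
        moreover have "ennreal (1 + e) * A \<omega> = ennreal ((1 + e) * a)"
          using a e by (subst ennreal_mult) auto
        ultimately have "ennreal (1 + e) * A \<omega> < ennreal b"
          using a e by (simp add: ennreal_less_iff)
        from order_tendstoD(2)[OF lim_bound[OF elim(1)] this]
        have "\<forall>\<^sub>F k in sequentially. B k \<omega> \<le> ennreal b"
          by eventually_elim (use BA[OF e elim(3)] in \<open>meson less_imp_le order_trans\<close>)
        then have "\<forall>\<^sub>F k in sequentially. ennreal ((I (r k) \<omega> - c * (W t \<omega> - W 0 \<omega>))\<^sup>2) = ennreal ((J k \<omega>)\<^sup>2)"
          by eventually_elim (simp add: JI)
        moreover have "(\<lambda>k. ennreal ((I (r k) \<omega> - c * (W t \<omega> - W 0 \<omega>))\<^sup>2)) \<longlonglongrightarrow> ennreal ((X t \<omega> - c * (W t \<omega> - W 0 \<omega>))\<^sup>2)"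
          by (intro tendsto_intros elim)
        ultimately have "(\<lambda>k. ennreal ((J k \<omega>)\<^sup>2)) \<longlonglongrightarrow> ennreal ((X t \<omega> - c * (W t \<omega> - W 0 \<omega>))\<^sup>2)"
          using tendsto_cong by fastforce
        then have "liminf (\<lambda>k. ennreal ((J k \<omega>)\<^sup>2)) = ennreal ((X t \<omega> - c * (W t \<omega> - W 0 \<omega>))\<^sup>2)"
          by (rule lim_imp_Liminf[rotated]) simp
        then show ?thesis by (simp split: split_indicator)
      qed simp
    qed
  qed
  also have "\<dots> \<le> liminf (\<lambda>k. \<integral>\<^sup>+\<omega>. ennreal ((J k \<omega>)\<^sup>2) \<partial>M)"
    by (rule nn_integral_liminf) measurable
  finally have L: "?L \<le> liminf (\<lambda>k. \<integral>\<^sup>+\<omega>. ennreal ((J k \<omega>)\<^sup>2) \<partial>M)" .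
  let ?Z = "\<integral>\<^sup>+\<omega>. min (ennreal b) (A \<omega>) \<partial>M"
  \<comment> \<open>The \<open>e\<close> used for the left side depended on the sample point. This
    one is uniform, so it can be taken out of the integral and sent to 0 at the end.\<close>
  have Lz: "?L \<le> ennreal (1 + e) * ?Z" if e: "0 < e" for e
  proof -
    let ?u = "\<lambda>k \<omega>. min (ennreal b) (ennreal (1 + e) * A \<omega> + ennreal (1 + 1 / e) * E (r k) \<omega>)"
    have lim: "(\<lambda>k. \<integral>\<^sup>+\<omega>. ?u k \<omega> \<partial>M) \<longlonglongrightarrow> (\<integral>\<^sup>+\<omega>. min (ennreal b) (ennreal (1 + e) * A \<omega>) \<partial>M)"
    proof (rule nn_integral_dominated_convergence[where w="\<lambda>\<omega>. ennreal b"])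
      show "AE \<omega> in M. (\<lambda>k. ?u k \<omega>) \<longlonglongrightarrow> min (ennreal b) (ennreal (1 + e) * A \<omega>)"
        using convE by eventually_elim (intro tendsto_min tendsto_const lim_bound)
    qed (auto simp: emeasure_space_1)
    note L
    also have "liminf (\<lambda>k. \<integral>\<^sup>+\<omega>. ennreal ((J k \<omega>)\<^sup>2) \<partial>M) \<le> liminf (\<lambda>k. \<integral>\<^sup>+\<omega>. ?u k \<omega> \<partial>M)"
    proof (intro Liminf_mono always_eventually allI)
      fix k
      note J2[of k]
      also have "(\<integral>\<^sup>+\<omega>. min (ennreal b) (B k \<omega>) \<partial>M) \<le> (\<integral>\<^sup>+\<omega>. ?u k \<omega> \<partial>M)"
        using BA[OF e] by (intro nn_integral_mono min.mono) auto
      finally show "(\<integral>\<^sup>+\<omega>. ennreal ((J k \<omega>)\<^sup>2) \<partial>M) \<le> (\<integral>\<^sup>+\<omega>. ?u k \<omega> \<partial>M)" .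
    qed
    also have "liminf (\<lambda>k. \<integral>\<^sup>+\<omega>. ?u k \<omega> \<partial>M) = (\<integral>\<^sup>+\<omega>. min (ennreal b) (ennreal (1 + e) * A \<omega>) \<partial>M)"
      by (rule lim_imp_Liminf[OF _ lim]) simp
    also have "\<dots> \<le> (\<integral>\<^sup>+\<omega>. ennreal (1 + e) * min (ennreal b) (A \<omega>) \<partial>M)"
    proof (rule nn_integral_mono)
      fix \<omega>
      have "1 * ennreal b \<le> ennreal (1 + e) * ennreal b" using e by (intro mult_right_mono) auto
      then show "min (ennreal b) (ennreal (1 + e) * A \<omega>) \<le> ennreal (1 + e) * min (ennreal b) (A \<omega>)"
        by (cases "ennreal b \<le> A \<omega>") (auto simp: min_def intro: order_trans)
    qed
    also have "\<dots> = ennreal (1 + e) * ?Z" by (rule nn_integral_cmult) measurable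
    finally show ?thesis .
  qed
  have "?Z \<le> (\<integral>\<^sup>+\<omega>. ennreal b \<partial>M)" by (intro nn_integral_mono) auto
  then have Zfin: "?Z < top" by (auto simp: emeasure_space_1 intro: le_less_trans)
  have "(\<lambda>k. 1 + inverse (real (Suc k))) \<longlonglongrightarrow> 1 + 0"
    by (intro tendsto_add tendsto_const LIMSEQ_inverse_real_of_nat)
  from ennreal_tendsto_cmult[OF Zfin tendsto_ennrealI[OF this]]
  have "(\<lambda>k. ?Z * ennreal (1 + inverse (real (Suc k)))) \<longlonglongrightarrow> ?Z" by simp
  then show ?thesis
    by (rule LIMSEQ_le_const) (use Lz in \<open>auto simp: mult.commute simp del: of_nat_Suc\<close>)
qed

end

subsection \<open>The time integral of Brownian motion\<close>

text \<open>The i-th increment is contained in every later value, hence in n - i summands. This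
  rewrites a Riemann sum of a Brownian path as a weighted sum of independent increments.\<close>

lemma sum_by_parts_increments:
  fixes g :: "nat \<Rightarrow> real"
  shows "(\<Sum>i<n. g (Suc i) - g 0) = (\<Sum>i<n. (real n - real i) * (g (Suc i) - g i))"
proof (induction n)
  case (Suc n)
  have "(\<Sum>i<Suc n. (real (Suc n) - real i) * (g (Suc i) - g i))
      = (\<Sum>i<Suc n. (real n - real i) * (g (Suc i) - g i)) + (\<Sum>i<Suc n. g (Suc i) - g i)"
    unfolding sum.distrib[symmetric] by (intro sum.cong) (auto simp: algebra_simps)
  also have "(\<Sum>i<Suc n. g (Suc i) - g i) = g (Suc n) - g 0"
    by (rule sum_lessThan_telescope)
  finally show ?case using Suc by simp
qed simp

lemma sum_squares_descending: "(\<Sum>i<n. (real n - real i)\<^sup>2) = real n * (real n + 1) * (2 * real n + 1) / 6"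
proof -
  have "(\<Sum>i<n. (real n - real i)\<^sup>2) = (\<Sum>i<n. (real (Suc i))\<^sup>2)"
    by (rule sum.reindex_bij_witness[of _ "\<lambda>i. n - Suc i" "\<lambda>i. n - Suc i"]) (auto simp: of_nat_diff)
  also have "\<dots> = real n * (real n + 1) * (2 * real n + 1) / 6"
    by (induction n) (auto simp: field_simps power2_eq_square)
  finally show ?thesis .
qed

context brownian_filtration
begin

lemma nn_integral_swap:
  fixes f :: "'a \<Rightarrow> real \<Rightarrow> ennreal"
  assumes "case_prod f \<in> borel_measurable (M \<Otimes>\<^sub>M lborel)"
  shows "(\<integral>\<^sup>+\<omega>. \<integral>\<^sup>+u. f \<omega> u \<partial>lborel \<partial>M) = (\<integral>\<^sup>+u. \<integral>\<^sup>+\<omega>. f \<omega> u \<partial>M \<partial>lborel)"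
proof -
  interpret pair_sigma_finite M lborel ..
  show ?thesis using Fubini'[OF assms] by simp
qed

lemma time_integral_measurable:
  fixes Y :: "real \<Rightarrow> 'a \<Rightarrow> real"
  assumes cont: "\<And>\<omega>. \<omega> \<in> space M \<Longrightarrow> continuous_on {0..} (\<lambda>u. Y u \<omega>)"
    and meas: "\<And>u. 0 \<le> u \<Longrightarrow> Y u \<in> borel_measurable M"
    and a: "0 \<le> a"
  shows "(\<lambda>\<omega>. integral {a..b} (\<lambda>u. Y u \<omega>)) \<in> borel_measurable M"
proof -
  note joint[measurable] = continuous_paths_jointly_measurable[OF meas cont]
  have "integral {a..b} (\<lambda>u. Y u \<omega>) = (\<integral>u. indicator {a..b} u *\<^sub>R Y (max 0 u) \<omega> \<partial>lborel)" if "\<omega> \<in> space M" for \<omega>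
  proof -
    have "continuous_on {a..b} (\<lambda>u. Y u \<omega>)"
      by (rule continuous_on_subset[OF cont[OF that]]) (use a in auto)
    from set_borel_integral_eq_integral(2)[OF borel_integrable_atLeastAtMost'[OF this]]
    have "integral {a..b} (\<lambda>u. Y u \<omega>) = (LBINT u:{a..b}. Y u \<omega>)" by simp
    then show ?thesis unfolding set_lebesgue_integral_def using a
      by (auto simp: indicator_def intro!: Bochner_Integration.integral_cong)
  qed
  then have "(\<lambda>\<omega>. integral {a..b} (\<lambda>u. Y u \<omega>)) \<in> borel_measurable M \<longleftrightarrow>
    (\<lambda>\<omega>. \<integral>u. indicator {a..b} u *\<^sub>R Y (max 0 u) \<omega> \<partial>lborel) \<in> borel_measurable M"
    by (rule measurable_cong)
  then show ?thesis by simp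
qed

text \<open>The absolute value is moved inside the time integral and Tonelli exchanges the
  integrals. The moment bound is asked for only to the right of \<open>a\<close>: the linearization
  error is controlled at positive times, and a single time is a null set.\<close>

lemma nn_integral_abs_time_integral_le:
  fixes Y :: "real \<Rightarrow> 'a \<Rightarrow> real"
  assumes cont: "\<And>\<omega>. \<omega> \<in> space M \<Longrightarrow> continuous_on {0..} (\<lambda>u. Y u \<omega>)"
    and meas: "\<And>u. 0 \<le> u \<Longrightarrow> Y u \<in> borel_measurable M"
    and ab: "0 \<le> a" "a \<le> b" and K: "0 \<le> K"
    and le: "\<And>u. a < u \<Longrightarrow> u \<le> b \<Longrightarrow> (\<integral>\<^sup>+\<omega>. ennreal \<bar>Y u \<omega>\<bar> \<partial>M) \<le> ennreal K"
  shows "(\<integral>\<^sup>+\<omega>. ennreal \<bar>integral {a..b} (\<lambda>u. Y u \<omega>)\<bar> \<partial>M) \<le> ennreal ((b - a) * K)"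
proof -
  note joint[measurable] = continuous_paths_jointly_measurable[OF meas cont]
  have "(\<integral>\<^sup>+\<omega>. ennreal \<bar>integral {a..b} (\<lambda>u. Y u \<omega>)\<bar> \<partial>M)
    \<le> (\<integral>\<^sup>+\<omega>. \<integral>\<^sup>+u. ennreal \<bar>Y (max 0 u) \<omega>\<bar> * indicator {a..b} u \<partial>lborel \<partial>M)"
  proof (rule nn_integral_mono)
    fix \<omega> assume \<omega>: "\<omega> \<in> space M"
    have "continuous_on {a..b} (\<lambda>u. Y u \<omega>)"
      by (rule continuous_on_subset[OF cont[OF \<omega>]]) (use ab in auto)
    then have int: "set_integrable lborel {a..b} (\<lambda>u. Y u \<omega>)"
      by (rule borel_integrable_atLeastAtMost')
    have "ennreal \<bar>integral {a..b} (\<lambda>u. Y u \<omega>)\<bar> = ennreal (norm (LBINT u:{a..b}. Y u \<omega>))"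
      using set_borel_integral_eq_integral(2)[OF int] by simp
    also have "\<dots> \<le> (\<integral>\<^sup>+u. ennreal (norm (indicator {a..b} u *\<^sub>R Y u \<omega>)) \<partial>lborel)"
      using int unfolding set_lebesgue_integral_def set_integrable_def by (rule integral_norm_bound_ennreal)
    also have "\<dots> = (\<integral>\<^sup>+u. ennreal \<bar>Y (max 0 u) \<omega>\<bar> * indicator {a..b} u \<partial>lborel)"
      using ab by (intro nn_integral_cong) (auto simp: indicator_def)
    finally show "ennreal \<bar>integral {a..b} (\<lambda>u. Y u \<omega>)\<bar> \<le> \<dots>" .
  qed
  also have "\<dots> = (\<integral>\<^sup>+u. \<integral>\<^sup>+\<omega>. ennreal \<bar>Y (max 0 u) \<omega>\<bar> * indicator {a..b} u \<partial>M \<partial>lborel)"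
    by (rule nn_integral_swap) measurable
  also have "\<dots> \<le> (\<integral>\<^sup>+u. ennreal K * indicator {a..b} u \<partial>lborel)"
  proof (rule nn_integral_mono_AE)
    show "AE u in lborel. (\<integral>\<^sup>+\<omega>. ennreal \<bar>Y (max 0 u) \<omega>\<bar> * indicator {a..b} u \<partial>M) \<le> ennreal K * indicator {a..b} u"
      using AE_lborel_singleton[of a]
    proof eventually_elim
      case (elim u)
      then show ?case using le[of u] ab by (cases "u \<in> {a..b}") auto
    qed
  qed
  also have "\<dots> = ennreal ((b - a) * K)"
    using ab K by (simp add: nn_integral_cmult_indicator ennreal_mult mult.commute)
  finally show ?thesis .
qed

text \<open>From |x| \<le> s / 2 + x^2 / (2 s), whose mean is at most \<open>s\<close> when the
  variance is at most \<open>s\<^sup>2\<close>.\<close>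

lemma increment_nn_first_moment_le:
  assumes "0 \<le> u" "u \<le> b" "b - u \<le> s\<^sup>2" "0 < s"
  shows "(\<integral>\<^sup>+\<omega>. ennreal \<bar>W u \<omega> - W b \<omega>\<bar> \<partial>M) \<le> ennreal s"
proof -
  note mom = increment_moments[OF assms(1,2)]
  have "(\<integral>\<^sup>+\<omega>. ennreal \<bar>W u \<omega> - W b \<omega>\<bar> \<partial>M) \<le> (\<integral>\<^sup>+\<omega>. ennreal (s / 2 + (W b \<omega> - W u \<omega>)\<^sup>2 / (2 * s)) \<partial>M)"
  proof (intro nn_integral_mono ennreal_leI)
    fix \<omega>
    have "0 \<le> (\<bar>W u \<omega> - W b \<omega>\<bar> - s)\<^sup>2 / (2 * s)" using assms by simp
    also have "\<dots> = s / 2 + (W b \<omega> - W u \<omega>)\<^sup>2 / (2 * s) - \<bar>W u \<omega> - W b \<omega>\<bar>"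
      using assms by (simp add: power2_diff power2_commute[of "W b \<omega>"] field_simps power2_eq_square[of s])
    finally show "\<bar>W u \<omega> - W b \<omega>\<bar> \<le> s / 2 + (W b \<omega> - W u \<omega>)\<^sup>2 / (2 * s)" by simp
  qed
  also have "\<dots> = ennreal (expectation (\<lambda>\<omega>. s / 2 + (W b \<omega> - W u \<omega>)\<^sup>2 / (2 * s)))"
    using assms mom(3) by (intro nn_integral_eq_integral) auto
  also have "expectation (\<lambda>\<omega>. s / 2 + (W b \<omega> - W u \<omega>)\<^sup>2 / (2 * s)) = s / 2 + (b - u) / (2 * s)"
    using mom by (simp add: prob_space)
  also have "ennreal (s / 2 + (b - u) / (2 * s)) \<le> ennreal s"
  proof (rule ennreal_leI)
    have "(b - u) / (2 * s) \<le> s\<^sup>2 / (2 * s)" using assms by (intro divide_right_mono) auto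
    also have "\<dots> = s / 2" using assms by (simp add: power2_eq_square)
    finally show "s / 2 + (b - u) / (2 * s) \<le> s" by linarith
  qed
  finally show ?thesis .
qed

text \<open>Each new increment is independent of the earlier sum, and variances of independent
  normals add. Nonzero weights and at least one summand ensure a positive variance, hence a
  density.\<close>

lemma weighted_increments_normal:
  assumes h: "0 < h" and a: "\<And>i. i < Suc k \<Longrightarrow> a i \<noteq> 0"
  shows "distributed M lborel (\<lambda>\<omega>. \<Sum>i<Suc k. a i * (W (real (Suc i) * h) \<omega> - W (real i * h) \<omega>))
    (\<lambda>x. ennreal (normal_density 0 (sqrt (\<Sum>i<Suc k. (a i)\<^sup>2 * h)) x))"
  using a
proof (induction k)
  case (Suc k)
  let ?G = "\<lambda>k \<omega>. \<Sum>i<k. a i * (W (real (Suc i) * h) \<omega> - W (real i * h) \<omega>)"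
  let ?D = "\<lambda>\<omega>. W (real (Suc (Suc k)) * h) \<omega> - W (real (Suc k) * h) \<omega>"
  have st: "real (Suc (Suc k)) * h - real (Suc k) * h = h" by (simp add: algebra_simps)
  have D: "distributed M lborel (\<lambda>\<omega>. 0 + a (Suc k) * ?D \<omega>) (\<lambda>x. ennreal (normal_density (0 + a (Suc k) * 0) (\<bar>a (Suc k)\<bar> * sqrt h) x))"
    using increment_distributed[of "real (Suc k) * h" "real (Suc (Suc k)) * h"] Suc.prems[of "Suc k"] h
    unfolding st by (intro normal_density_affine) auto
  have "?G (Suc k) \<in> borel_measurable (F (real (Suc k) * h))"
    using h by (intro borel_measurable_sum borel_measurable_times borel_measurable_diff borel_measurable_const W_measurable_F mult_right_mono) auto
  from increment_indep[OF this, of "real (Suc (Suc k)) * h"]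
  have "indep_var borel (?G (Suc k)) borel ?D" using h by auto
  from indep_var_compose[OF this, of "\<lambda>x. x" borel "\<lambda>x. a (Suc k) * x" borel]
  have ind: "indep_var borel (?G (Suc k)) borel (\<lambda>\<omega>. a (Suc k) * ?D \<omega>)" by (simp add: comp_def)
  have pos: "0 < (\<Sum>i<Suc k. (a i)\<^sup>2 * h)" using h Suc.prems by (intro sum_pos) auto
  have "distributed M lborel (\<lambda>\<omega>. ?G (Suc k) \<omega> + a (Suc k) * ?D \<omega>)
    (\<lambda>x. ennreal (normal_density (0 + 0) (sqrt ((sqrt (\<Sum>i<Suc k. (a i)\<^sup>2 * h))\<^sup>2 + (\<bar>a (Suc k)\<bar> * sqrt h)\<^sup>2)) x))"
    using D h Suc.prems[of "Suc k"] pos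
    by (intro add_indep_normal[OF ind] Suc.IH Suc.prems) (auto simp del: sum.lessThan_Suc)
  moreover have "(sqrt (\<Sum>i<Suc k. (a i)\<^sup>2 * h))\<^sup>2 + (\<bar>a (Suc k)\<bar> * sqrt h)\<^sup>2 = (\<Sum>i<Suc (Suc k). (a i)\<^sup>2 * h)"
    using pos h by (simp add: power_mult_distrib del: sum.lessThan_Suc) simp
  ultimately show ?case by simp
next
  case 0
  have "distributed M lborel (\<lambda>\<omega>. 0 + a 0 * (W h \<omega> - W 0 \<omega>)) (\<lambda>x. ennreal (normal_density (0 + a 0 * 0) (\<bar>a 0\<bar> * sqrt h) x))"
    using increment_distributed[of 0 h] 0[of 0] h by (intro normal_density_affine) auto
  then show ?case using h by (simp add: real_sqrt_mult)
qed

text \<open>\<open>W 0\<close> vanishes only almost surely; subtracting it makes every path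
  functional depend on increments alone.\<close>

definition area :: "real \<Rightarrow> 'a \<Rightarrow> real" where
  "area T \<omega> = integral {0..T} (\<lambda>u. W u \<omega> - W 0 \<omega>)"

lemma area_measurable:
  assumes "0 \<le> T"
  shows "area T \<in> borel_measurable M"
  unfolding area_def[abs_def] using assms
  by (intro time_integral_measurable continuous_on_diff continuous_on_const borel_measurable_diff W_continuous W_measurable) auto

text \<open>On a cell of length \<open>h\<close> the path differs from its value at the right
  endpoint by at most \<open>sqrt h\<close> in mean, so each cell contributes at most
  \<open>h * sqrt h\<close>.\<close>

lemma area_riemann:
  assumes h: "0 < h"
  shows "(\<integral>\<^sup>+\<omega>. ennreal \<bar>area (real k * h) \<omega> - (\<Sum>i<k. h * (W (real (Suc i) * h) \<omega> - W 0 \<omega>))\<bar> \<partial>M)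
    \<le> ennreal (real k * (h * sqrt h))"
proof (induction k)
  case (Suc k)
  let ?E = "\<lambda>k \<omega>. area (real k * h) \<omega> - (\<Sum>i<k. h * (W (real (Suc i) * h) \<omega> - W 0 \<omega>))"
  let ?a = "real k * h" and ?b = "real (Suc k) * h"
  let ?Y = "\<lambda>u \<omega>. W u \<omega> - W ?b \<omega>"
  have ab: "0 \<le> ?a" "?a \<le> ?b" "?b - ?a = h" using h by (auto simp: algebra_simps)
  have meas: "?E k \<in> borel_measurable M"
    using h by (intro borel_measurable_diff area_measurable borel_measurable_sum borel_measurable_times
      borel_measurable_const W_measurable) auto
  have split: "?E (Suc k) \<omega> = ?E k \<omega> + integral {?a..?b} (\<lambda>u. ?Y u \<omega>)" if \<omega>: "\<omega> \<in> space M" for \<omega>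
  proof -
    have c: "continuous_on {0..?b} (\<lambda>u. W u \<omega>)" "continuous_on {?a..?b} (\<lambda>u. W u \<omega>)"
      using ab(1) by (auto intro!: continuous_on_subset[OF W_continuous[OF \<omega>]] intro: order_trans)
    have "area ?b \<omega> = area ?a \<omega> + integral {?a..?b} (\<lambda>u. W u \<omega> - W 0 \<omega>)"
      unfolding area_def using ab c
      by (intro Henstock_Kurzweil_Integration.integral_combine[symmetric] integrable_continuous_real continuous_intros) auto
    also have "integral {?a..?b} (\<lambda>u. W u \<omega> - W 0 \<omega>) = integral {?a..?b} (\<lambda>u. ?Y u \<omega> + (W ?b \<omega> - W 0 \<omega>))"
      by simp
    also have "\<dots> = integral {?a..?b} (\<lambda>u. ?Y u \<omega>) + integral {?a..?b} (\<lambda>u. W ?b \<omega> - W 0 \<omega>)"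
      using c by (intro Henstock_Kurzweil_Integration.integral_add integrable_continuous_real continuous_intros) auto
    also have "integral {?a..?b} (\<lambda>u. W ?b \<omega> - W 0 \<omega>) = h * (W ?b \<omega> - W 0 \<omega>)"
      using ab by simp
    finally show ?thesis by (simp add: algebra_simps)
  qed
  have "(\<integral>\<^sup>+\<omega>. ennreal \<bar>?E (Suc k) \<omega>\<bar> \<partial>M) \<le> (\<integral>\<^sup>+\<omega>. ennreal \<bar>?E k \<omega>\<bar> + ennreal \<bar>integral {?a..?b} (\<lambda>u. ?Y u \<omega>)\<bar> \<partial>M)"
  proof (rule nn_integral_mono)
    fix \<omega> assume "\<omega> \<in> space M"
    then have "ennreal \<bar>?E (Suc k) \<omega>\<bar> \<le> ennreal (\<bar>?E k \<omega>\<bar> + \<bar>integral {?a..?b} (\<lambda>u. ?Y u \<omega>)\<bar>)"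
      unfolding split[OF \<open>\<omega> \<in> space M\<close>] by (intro ennreal_leI abs_triangle_ineq)
    then show "ennreal \<bar>?E (Suc k) \<omega>\<bar> \<le> ennreal \<bar>?E k \<omega>\<bar> + ennreal \<bar>integral {?a..?b} (\<lambda>u. ?Y u \<omega>)\<bar>"
      by (simp only: ennreal_plus abs_ge_zero)
  qed
  also have "\<dots> = (\<integral>\<^sup>+\<omega>. ennreal \<bar>?E k \<omega>\<bar> \<partial>M) + (\<integral>\<^sup>+\<omega>. ennreal \<bar>integral {?a..?b} (\<lambda>u. ?Y u \<omega>)\<bar> \<partial>M)"
  proof (rule nn_integral_add)
    have "(\<lambda>\<omega>. integral {?a..?b} (\<lambda>u. ?Y u \<omega>)) \<in> borel_measurable M"
      using ab(1) h
      by (intro time_integral_measurable continuous_on_diff continuous_on_const borel_measurable_diff W_continuous W_measurable) auto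
    then show "(\<lambda>\<omega>. ennreal \<bar>integral {?a..?b} (\<lambda>u. ?Y u \<omega>)\<bar>) \<in> borel_measurable M" by simp
  qed (use meas in measurable)
  also have "\<dots> \<le> ennreal (real k * (h * sqrt h)) + ennreal ((?b - ?a) * sqrt h)"
  proof (intro add_mono Suc.IH nn_integral_abs_time_integral_le)
    show "continuous_on {0..} (\<lambda>u. ?Y u \<omega>)" if "\<omega> \<in> space M" for \<omega>
      by (intro continuous_on_diff continuous_on_const W_continuous[OF that])
    show "?Y u \<in> borel_measurable M" if "0 \<le> u" for u
      using that h by (intro borel_measurable_diff W_measurable) auto
    show "(\<integral>\<^sup>+\<omega>. ennreal \<bar>?Y u \<omega>\<bar> \<partial>M) \<le> ennreal (sqrt h)" if "?a < u" "u \<le> ?b" for u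
    proof (rule increment_nn_first_moment_le)
      show "0 \<le> u" using that(1) ab(1) by linarith
      show "?b - u \<le> (sqrt h)\<^sup>2" using that(1) ab(3) h by simp
    qed (use that h in auto)
  qed (use ab h in auto)
  also have "\<dots> = ennreal (real (Suc k) * (h * sqrt h))"
    using h ab(3) by (simp add: ennreal_plus[symmetric] algebra_simps del: ennreal_plus)
  finally show ?case .
qed (simp add: area_def)

text \<open>The Riemann sums \<open>R n\<close> are exactly normal, with variance tending to T^3 /
  3, and converge to the area in L^1; this carries both the mean and the absolute mean to the
  limit.\<close>

lemma area_moments:
  assumes T: "0 < T"
  shows "integrable M (area T)" "expectation (area T) = 0"
    "expectation (\<lambda>\<omega>. \<bar>area T \<omega>\<bar>) = sqrt (T ^ 3 / 3) * sqrt (2 / pi)"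
proof -
  define R where "R n \<omega> = (\<Sum>i<Suc n. T / real (Suc n) * (W (real (Suc i) * (T / real (Suc n))) \<omega> - W 0 \<omega>))" for n \<omega>
  \<comment> \<open>With N = n + 1 cells of length h = T / N, this is h^3 times the sum of the
    squares of 1, ..., N.\<close>
  define v where "v n = T ^ 3 * (1 + 1 / real (Suc n)) * (2 + 1 / real (Suc n)) / 6" for n
  have vpos: "0 < v n" for n
    unfolding v_def using T by (intro divide_pos_pos mult_pos_pos add_pos_pos zero_less_power) auto
  have dist: "distributed M lborel (R n) (\<lambda>x. ennreal (normal_density 0 (sqrt (v n)) x))" for n
  proof -
    define h where "h = T / real (Suc n)"
    have h: "0 < h" using T by (simp add: h_def)
    have Req: "R n = (\<lambda>\<omega>. \<Sum>i<Suc n. (h * (real (Suc n) - real i)) * (W (real (Suc i) * h) \<omega> - W (real i * h) \<omega>))"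
    proof
      fix \<omega>
      have "R n \<omega> = h * (\<Sum>i<Suc n. W (real (Suc i) * h) \<omega> - W 0 \<omega>)"
        unfolding R_def h_def sum_distrib_left ..
      also have "(\<Sum>i<Suc n. W (real (Suc i) * h) \<omega> - W 0 \<omega>)
          = (\<Sum>i<Suc n. (real (Suc n) - real i) * (W (real (Suc i) * h) \<omega> - W (real i * h) \<omega>))"
        using sum_by_parts_increments[of "\<lambda>i. W (real i * h) \<omega>" "Suc n"] by (simp del: sum.lessThan_Suc of_nat_Suc)
      also have "h * \<dots> = (\<Sum>i<Suc n. (h * (real (Suc n) - real i)) * (W (real (Suc i) * h) \<omega> - W (real i * h) \<omega>))"
        by (simp add: sum_distrib_left mult.assoc del: sum.lessThan_Suc of_nat_Suc)
      finally show "R n \<omega> = (\<Sum>i<Suc n. (h * (real (Suc n) - real i)) * (W (real (Suc i) * h) \<omega> - W (real i * h) \<omega>))" .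
    qed
    have veq: "(\<Sum>i<Suc n. (h * (real (Suc n) - real i))\<^sup>2 * h) = v n"
    proof -
      have "(\<Sum>i<Suc n. (h * (real (Suc n) - real i))\<^sup>2 * h) = h ^ 3 * (\<Sum>i<Suc n. (real (Suc n) - real i)\<^sup>2)"
        by (simp add: sum_distrib_left power_mult_distrib power3_eq_cube power2_eq_square mult_ac del: sum.lessThan_Suc)
      also have "\<dots> = v n"
        unfolding sum_squares_descending v_def h_def by (simp add: power_divide divide_simps del: of_nat_Suc) (simp add: power3_eq_cube algebra_simps)
      finally show ?thesis .
    qed
    have "h * (real (Suc n) - real i) \<noteq> 0" if "i < Suc n" for i using h that by auto
    from weighted_increments_normal[OF h, of n "\<lambda>i. h * (real (Suc n) - real i)", OF this] show ?thesis by (simp only: Req veq)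
  qed
  note mom = centered_normal_moments[OF dist real_sqrt_gt_zero[OF vpos]]
  have am[measurable]: "area T \<in> borel_measurable M" using T by (intro area_measurable) simp
  have Rm[measurable]: "R n \<in> borel_measurable M" for n using mom(1) by auto
  have err: "(\<integral>\<^sup>+\<omega>. ennreal \<bar>area T \<omega> - R n \<omega>\<bar> \<partial>M) \<le> ennreal (T * sqrt (T / real (Suc n)))" for n
    using area_riemann[of "T / real (Suc n)" "Suc n"] T by (simp add: R_def del: sum.lessThan_Suc of_nat_Suc)
  have intd: "integrable M (\<lambda>\<omega>. area T \<omega> - R n \<omega>)" for n
    using err[of n] by (intro integrableI_bounded) (auto intro: le_less_trans)
  have "integrable M (\<lambda>\<omega>. (area T \<omega> - R 0 \<omega>) + R 0 \<omega>)"
    using intd mom(1) by (intro Bochner_Integration.integrable_add)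
  then show int: "integrable M (area T)" by simp
  have err': "expectation (\<lambda>\<omega>. \<bar>area T \<omega> - R n \<omega>\<bar>) \<le> T * sqrt (T / real (Suc n))" for n
  proof -
    have "ennreal (expectation (\<lambda>\<omega>. \<bar>area T \<omega> - R n \<omega>\<bar>)) = (\<integral>\<^sup>+\<omega>. ennreal \<bar>area T \<omega> - R n \<omega>\<bar> \<partial>M)"
      using intd by (intro nn_integral_eq_integral[symmetric]) auto
    then have "ennreal (expectation (\<lambda>\<omega>. \<bar>area T \<omega> - R n \<omega>\<bar>)) \<le> ennreal (T * sqrt (T / real (Suc n)))"
      using err[of n] by (simp only:)
    then show ?thesis using T by (subst (asm) ennreal_le_iff) auto
  qed
  have "(\<lambda>n. T * sqrt (T * inverse (real (Suc n)))) \<longlonglongrightarrow> T * sqrt (T * 0)"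
    by (intro tendsto_intros LIMSEQ_inverse_real_of_nat)
  then have small: "(\<lambda>n. T * sqrt (T / real (Suc n))) \<longlonglongrightarrow> 0" by (simp add: divide_inverse)
  have "\<bar>expectation (area T)\<bar> \<le> T * sqrt (T / real (Suc n))" for n
  proof -
    have "expectation (area T) = expectation (\<lambda>\<omega>. area T \<omega> - R n \<omega>)"
      using int mom(1,2)[of n] by simp
    also have "\<bar>\<dots>\<bar> \<le> expectation (\<lambda>\<omega>. \<bar>area T \<omega> - R n \<omega>\<bar>)" by (rule integral_abs_bound)
    finally show ?thesis using err'[of n] by linarith
  qed
  then have "\<bar>expectation (area T)\<bar> \<le> 0" by (intro LIMSEQ_le_const[OF small]) blast
  then show "expectation (area T) = 0" by simp
  have "(\<lambda>n. expectation (\<lambda>\<omega>. \<bar>R n \<omega>\<bar>) - expectation (\<lambda>\<omega>. \<bar>area T \<omega>\<bar>)) \<longlonglongrightarrow> 0"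
  proof (rule Lim_null_comparison[OF _ small], intro always_eventually allI)
    fix n
    have "\<bar>expectation (\<lambda>\<omega>. \<bar>R n \<omega>\<bar>) - expectation (\<lambda>\<omega>. \<bar>area T \<omega>\<bar>)\<bar> = \<bar>expectation (\<lambda>\<omega>. \<bar>R n \<omega>\<bar> - \<bar>area T \<omega>\<bar>)\<bar>"
      using int mom(1)[of n] by simp
    also have "\<dots> \<le> expectation (\<lambda>\<omega>. \<bar>\<bar>R n \<omega>\<bar> - \<bar>area T \<omega>\<bar>\<bar>)" by (rule integral_abs_bound)
    also have "\<dots> \<le> expectation (\<lambda>\<omega>. \<bar>area T \<omega> - R n \<omega>\<bar>)"
      using int mom(1)[of n] intd[of n] by (intro integral_mono) auto
    finally show "norm (expectation (\<lambda>\<omega>. \<bar>R n \<omega>\<bar>) - expectation (\<lambda>\<omega>. \<bar>area T \<omega>\<bar>)) \<le> T * sqrt (T / real (Suc n))"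
      using err'[of n] by simp
  qed
  then have "(\<lambda>n. expectation (\<lambda>\<omega>. \<bar>R n \<omega>\<bar>)) \<longlonglongrightarrow> expectation (\<lambda>\<omega>. \<bar>area T \<omega>\<bar>)"
    by (rule LIM_zero_cancel)
  moreover have "(\<lambda>n. expectation (\<lambda>\<omega>. \<bar>R n \<omega>\<bar>)) \<longlonglongrightarrow> sqrt (T ^ 3 / 3) * sqrt (2 / pi)"
  proof -
    have "(\<lambda>n. sqrt (T ^ 3 * (1 + inverse (real (Suc n))) * (2 + inverse (real (Suc n))) / 6) * sqrt (2 / pi))
      \<longlonglongrightarrow> sqrt (T ^ 3 * (1 + 0) * (2 + 0) / 6) * sqrt (2 / pi)"
      by (intro tendsto_intros LIMSEQ_inverse_real_of_nat) simp
    then show ?thesis using mom(5) by (simp add: v_def inverse_eq_divide)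
  qed
  ultimately show "expectation (\<lambda>\<omega>. \<bar>area T \<omega>\<bar>) = sqrt (T ^ 3 / 3) * sqrt (2 / pi)"
    by (rule LIMSEQ_unique)
qed

end

subsection \<open>Powers and primitives\<close>

text \<open>After scaling to a = 1 the claim is that u^\<beta> lies between 1 and u. With one point
  fixed at a > 0 the bound is global: it reaches down to x = 0, where the slope of the power is
  infinite for \<beta> < 1.\<close>

lemma powr_diff_le_linear:
  fixes x a \<beta> :: real
  assumes x: "0 \<le> x" and a: "0 < a" and \<beta>: "0 < \<beta>" "\<beta> \<le> 1"
  shows "\<bar>x powr \<beta> - a powr \<beta>\<bar> \<le> a powr (\<beta> - 1) * \<bar>x - a\<bar>"
proof -
  define u where "u = x / a"
  have u: "0 \<le> u" "x = a * u" using x a by (auto simp: u_def)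
  have "\<bar>u powr \<beta> - 1\<bar> \<le> \<bar>u - 1\<bar>"
  proof (cases "1 \<le> u")
    case True
    then have "u powr \<beta> \<le> u powr 1" "1 \<le> u powr \<beta>"
      using \<beta> powr_mono[of \<beta> 1 u] by (auto intro!: ge_one_powr_ge_zero)
    then show ?thesis using True by simp
  next
    case False
    then have "u powr 1 \<le> u powr \<beta>" "u powr \<beta> \<le> 1"
      using \<beta> u powr_mono'[of \<beta> 1 u] by (auto intro!: powr_le1)
    then show ?thesis using False u by simp
  qed
  then have "a powr \<beta> * \<bar>u powr \<beta> - 1\<bar> \<le> a powr \<beta> * \<bar>u - 1\<bar>"
    by (rule mult_left_mono) simp
  moreover have "x powr \<beta> - a powr \<beta> = a powr \<beta> * (u powr \<beta> - 1)"
    using u a by (simp add: powr_mult right_diff_distrib)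
  moreover have "a powr (\<beta> - 1) * \<bar>x - a\<bar> = a powr \<beta> * \<bar>u - 1\<bar>"
  proof -
    have "\<bar>x - a\<bar> = a * \<bar>u - 1\<bar>" using u a by (simp add: abs_mult_pos' right_diff_distrib)
    moreover have "a powr (\<beta> - 1) * a = a powr \<beta>" using a by (simp add: powr_diff)
    ultimately show ?thesis by (simp add: mult.assoc[symmetric])
  qed
  ultimately show ?thesis by (simp add: abs_mult)
qed

lemma le_one_plus_powr:
  fixes x p :: real
  assumes "0 \<le> x" "1 \<le> p"
  shows "x \<le> 1 + x powr p"
proof (cases "1 \<le> x")
  case True
  then have "x powr 1 \<le> x powr p" using assms by (intro powr_mono) auto
  then show ?thesis using True by simp
qed (use powr_ge_zero[of x p] in linarith)

text \<open>Three integrals meet here: the nonnegative one of the energy, the Lebesgue integral of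
  the drift in the equation, and the gauge integral, for which continuity of primitives is at
  hand.\<close>

lemma nn_integral_Icc_continuous:
  fixes g :: "real \<Rightarrow> real"
  assumes g: "continuous_on {0..u} g" "\<And>v. v \<in> {0..u} \<Longrightarrow> 0 \<le> g v"
  shows "(\<integral>\<^sup>+v\<in>{0..u}. ennreal (g v) \<partial>lborel) = ennreal (integral {0..u} g)"
    "0 \<le> integral {0..u} g" "(LBINT v:{0..u}. g v) = integral {0..u} g"
proof -
  have int: "set_integrable lborel {0..u} g"
    using g(1) by (rule borel_integrable_atLeastAtMost')
  have "(\<integral>\<^sup>+v\<in>{0..u}. ennreal (g v) \<partial>lborel) = (\<integral>\<^sup>+v. ennreal (indicator {0..u} v *\<^sub>R g v) \<partial>lborel)"
    by (intro nn_integral_cong) (auto simp: indicator_def)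
  also have "\<dots> = ennreal (LBINT v:{0..u}. g v)"
    using int g(2) unfolding set_integrable_def set_lebesgue_integral_def
    by (intro nn_integral_eq_integral) (auto simp: indicator_def)
  finally show "(\<integral>\<^sup>+v\<in>{0..u}. ennreal (g v) \<partial>lborel) = ennreal (integral {0..u} g)"
    using set_borel_integral_eq_integral(2)[OF int] by simp
  show "0 \<le> integral {0..u} g"
    using g by (intro integral_nonneg integrable_continuous_real) auto
  show "(LBINT v:{0..u}. g v) = integral {0..u} g"
    using set_borel_integral_eq_integral(2)[OF int] .
qed

text \<open>
  By the intermediate value theorem \<open>A\<close> attains every value below \<open>min b A\<^sub>t\<close> before it reaches \<open>b\<close>. This
  replaces stopping at the hitting time of \<open>b\<close>.
\<close>

lemma min_primitive_le:
  fixes g :: "real \<Rightarrow> real" and b :: real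
  assumes g: "continuous_on {0..t} g" "\<And>v. v \<in> {0..t} \<Longrightarrow> 0 \<le> g v" and t: "0 \<le> t"
  defines "A \<equiv> \<lambda>u. \<integral>\<^sup>+v\<in>{0..u}. ennreal (g v) \<partial>lborel"
  shows "min (ennreal b) (A t) \<le> (\<integral>\<^sup>+u\<in>{0..t}. ennreal (g u) * indicator {u. A u < ennreal b} u \<partial>lborel)"
    (is "_ \<le> ?R")
proof -
  define a where "a u = integral {0..u} g" for u
  have Aa: "A u = ennreal (a u)" "0 \<le> a u" if "u \<in> {0..t}" for u
    using that continuous_on_subset[OF g(1)] g(2) unfolding A_def a_def
    by (auto intro!: nn_integral_Icc_continuous)
  have Amono: "A u \<le> A v" if "u \<le> v" for u v
    unfolding A_def using that by (intro nn_integral_mono) (auto simp: indicator_def)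
  \<comment> \<open>Since \<open>A\<close> is monotone, the indicator on the right equals 1
    throughout [0, v].\<close>
  have below: "A v \<le> ?R" if v: "v \<in> {0..t}" "A v < ennreal b" for v
    unfolding A_def
  proof (rule nn_integral_mono)
    fix u
    show "ennreal (g u) * indicator {0..v} u
      \<le> ennreal (g u) * indicator {u. (\<integral>\<^sup>+v\<in>{0..u}. ennreal (g v) \<partial>lborel) < ennreal b} u * indicator {0..t} u"
      using v Amono[of u v] unfolding A_def by (auto simp: indicator_def)
  qed
  show ?thesis
  proof (cases "A t < ennreal b")
    case True
    then show ?thesis using below[of t] t by (intro min.coboundedI2) auto
  next
    case False
    then have min: "min (ennreal b) (A t) = ennreal b" by (intro min.absorb1) (simp add: not_less)
    have bt: "b \<le> a t" using False Aa[of t] t by (simp add: not_less)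
    show ?thesis
    proof (cases "0 < b")
      case True
      have "ennreal b' \<le> ?R" if b': "0 < b'" "b' < b" for b'
      proof -
        have "\<exists>v\<ge>0. v \<le> t \<and> a v = b'"
        proof (rule IVT')
          show "a 0 \<le> b'" using b' by (simp add: a_def)
          show "b' \<le> a t" using b' bt by simp
          show "continuous_on {0..t} a" unfolding a_def
            by (rule indefinite_integral_continuous_1) (rule integrable_continuous_real[OF g(1)])
        qed (rule t)
        then obtain v where v: "v \<in> {0..t}" "a v = b'" by auto
        then show ?thesis using below[of v] Aa[of v] b' by (simp add: ennreal_less_iff)
      qed
      note low = this
      have "ennreal b \<le> ?R"
      proof (rule dense_le)
        fix y :: ennreal assume y: "y < ennreal b"
        then obtain z where z: "y = ennreal z" "0 \<le> z" "z < b"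
          by (cases y) (auto simp: ennreal_less_iff)
        \<comment> \<open>The midpoint replaces \<open>z\<close> because \<open>low\<close> asks for
          a positive value, and \<open>z\<close> may be 0.\<close>
        have "y \<le> ennreal ((z + b) / 2)" using z by (auto intro!: ennreal_leI)
        also have "\<dots> \<le> ?R" using z by (intro low) auto
        finally show "y \<le> ?R" .
      qed
      then show ?thesis by (simp add: min)
    qed (simp add: ennreal_neg min)
  qed
qed

subsection \<open>Moments of the CEV process\<close>

text \<open>\<open>I\<close> is a witness of the existential in \<open>sde_solution\<close>, and
  \<mu> stands for the drift rate \<open>r - q\<close>.\<close>

locale cev_model = brownian_filtration M F W
  for M :: "'a measure" and F W +
  fixes S I :: "real \<Rightarrow> 'a \<Rightarrow> real" and \<mu> \<sigma> \<beta> S0 :: real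
  assumes \<sigma>_pos: "0 < \<sigma>" and \<beta>_half: "1 / 2 \<le> \<beta>" and \<beta>_less: "\<beta> < 1" and S0_pos: "0 < S0"
    and S_adapted: "adapted F S"
    and S_continuous: "\<And>\<omega>. \<omega> \<in> space M \<Longrightarrow> continuous_on {0..} (\<lambda>t. S t \<omega>)"
    and S_nonneg: "AE \<omega> in M. \<forall>t\<ge>0. 0 \<le> S t \<omega>"
    and ito: "has_ito_integral M F W (\<lambda>s \<omega>. \<sigma> * S s \<omega> powr \<beta>) I"
    and solution: "AE \<omega> in M. \<forall>t\<ge>0. S t \<omega> = S0 + (LBINT s:{0..t}. \<mu> * S s \<omega>) + I t \<omega>"
begin

definition vol :: real where "vol = \<sigma> * S0 powr \<beta>"
definition lip :: real where "lip = \<sigma> * S0 powr (\<beta> - 1)"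

text \<open>The energy is the quadratic variation of the \<open>noise\<close> below, which
  represents the stochastic integral of the diffusion coefficient minus its initial value
  \<open>vol\<close>.\<close>

definition energy :: "real \<Rightarrow> 'a \<Rightarrow> ennreal" where
  "energy t \<omega> = (\<integral>\<^sup>+u\<in>{0..t}. ennreal ((\<sigma> * S u \<omega> powr \<beta> - vol)\<^sup>2) \<partial>lborel)"
definition noise :: "real \<Rightarrow> 'a \<Rightarrow> real" where
  "noise t \<omega> = I t \<omega> - vol * (W t \<omega> - W 0 \<omega>)"
definition cumul :: "real \<Rightarrow> 'a \<Rightarrow> ennreal" where
  "cumul t \<omega> = (\<integral>\<^sup>+u\<in>{0..t}. ennreal (S u \<omega>) \<partial>lborel)"
text \<open>The quantity of the Gronwall argument. The event depends on \<open>t\<close> and shrinks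
  as \<open>t\<close> grows, since energy accumulates.\<close>

definition trunc_dev :: "real \<Rightarrow> real \<Rightarrow> ennreal" where
  "trunc_dev b t = (\<integral>\<^sup>+\<omega>. ennreal ((S t \<omega> - S0)\<^sup>2) * indicator {\<omega>. energy t \<omega> < ennreal b} \<omega> \<partial>M)"

lemma S_measurable: "0 \<le> t \<Longrightarrow> S t \<in> borel_measurable M"
  using S_adapted measurable_F_M by (auto simp: adapted_def)

lemma S_compose_measurable[measurable (raw)]:
  assumes "f \<in> measurable N M" "g \<in> borel_measurable N"
  shows "(\<lambda>x. S (max 0 (g x)) (f x)) \<in> borel_measurable N"
proof -
  have "(\<lambda>x. (f x, g x)) \<in> measurable N (M \<Otimes>\<^sub>M lborel)"
    using assms by (intro measurable_Pair) auto
  from measurable_compose[OF this continuous_paths_jointly_measurable[OF S_measurable S_continuous]]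
  show ?thesis by simp
qed

lemma energy_clip:
  "energy t \<omega> = (\<integral>\<^sup>+u. ennreal ((\<sigma> * S (max 0 u) \<omega> powr \<beta> - vol)\<^sup>2) * indicator {0..t} u \<partial>lborel)"
  unfolding energy_def by (intro nn_integral_cong) (auto simp: indicator_def)

lemma cumul_clip:
  "cumul t \<omega> = (\<integral>\<^sup>+u. ennreal (S (max 0 u) \<omega>) * indicator {0..t} u \<partial>lborel)"
  unfolding cumul_def by (intro nn_integral_cong) (auto simp: indicator_def)

text \<open>The time is an argument here because the condition that the energy at time
  \<open>u\<close> is below \<open>b\<close> enters a double integral over the sample point and
  \<open>u\<close>.\<close>

lemma energy_compose_measurable[measurable (raw)]:
  assumes [measurable]: "f \<in> measurable N M" "g \<in> borel_measurable N"
  shows "(\<lambda>x. energy (g x) (f x)) \<in> borel_measurable N"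
proof -
  \<comment> \<open>Written as a condition on \<open>u\<close> and \<open>t\<close>, the integrand
    is visibly measurable in both, so the upper limit may vary.\<close>
  have "energy t \<omega> = (\<integral>\<^sup>+u. ennreal ((\<sigma> * S (max 0 u) \<omega> powr \<beta> - vol)\<^sup>2) * (if 0 \<le> u \<and> u \<le> t then 1 else 0) \<partial>lborel)" for t \<omega>
    unfolding energy_clip by (intro nn_integral_cong) (auto simp: indicator_def)
  then show ?thesis by simp
qed

lemma cumul_measurable[measurable]: "cumul t \<in> borel_measurable M"
  unfolding cumul_clip[abs_def] by measurable

lemma noise_measurable: "0 \<le> t \<Longrightarrow> noise t \<in> borel_measurable M"
  using ito W_measurable[of t] W_measurable[of 0] unfolding noise_def[abs_def] has_ito_integral_def by auto

lemma diffusion_dev_le: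
  assumes "0 \<le> x"
  shows "(\<sigma> * x powr \<beta> - vol)\<^sup>2 \<le> lip\<^sup>2 * (x - S0)\<^sup>2"
proof -
  have "\<bar>x powr \<beta> - S0 powr \<beta>\<bar> \<le> S0 powr (\<beta> - 1) * \<bar>x - S0\<bar>"
    using assms S0_pos \<beta>_half \<beta>_less by (intro powr_diff_le_linear) auto
  then have "\<sigma> * \<bar>x powr \<beta> - S0 powr \<beta>\<bar> \<le> \<sigma> * (S0 powr (\<beta> - 1) * \<bar>x - S0\<bar>)"
    using \<sigma>_pos by (intro mult_left_mono) auto
  then have "\<bar>\<sigma> * x powr \<beta> - vol\<bar> \<le> lip * \<bar>x - S0\<bar>"
    using \<sigma>_pos by (simp add: vol_def lip_def abs_mult right_diff_distrib[symmetric] mult.assoc)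
  then have "\<bar>\<sigma> * x powr \<beta> - vol\<bar>\<^sup>2 \<le> (lip * \<bar>x - S0\<bar>)\<^sup>2"
    by (rule power_mono) simp
  then show ?thesis by (simp add: power_mult_distrib)
qed

text \<open>This is where \<open>\<beta> \<ge> 1/2\<close> enters: on the event that the energy is small, so is the drift.\<close>

lemma state_le_diffusion_dev:
  assumes "0 \<le> x"
  shows "x \<le> (1 + 2 * vol\<^sup>2 / \<sigma>\<^sup>2) + 2 / \<sigma>\<^sup>2 * (\<sigma> * x powr \<beta> - vol)\<^sup>2"
proof -
  have "x powr (2 * \<beta>) = (x powr \<beta>)\<^sup>2" using assms by (simp add: powr_powr[symmetric] mult.commute)
  \<comment> \<open>Here the exponent \<open>2 * \<beta>\<close> has to be at least 1.\<close>
  then have "x \<le> 1 + (x powr \<beta>)\<^sup>2" using le_one_plus_powr[of x "2 * \<beta>"] assms \<beta>_half by simp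
  also have "(x powr \<beta>)\<^sup>2 = (\<sigma> * x powr \<beta>)\<^sup>2 / \<sigma>\<^sup>2" using \<sigma>_pos by (simp add: power_mult_distrib)
  also have "(\<sigma> * x powr \<beta>)\<^sup>2 \<le> 2 * (\<sigma> * x powr \<beta> - vol)\<^sup>2 + 2 * vol\<^sup>2"
    using square_add_le_weighted[of 1 "\<sigma> * x powr \<beta> - vol" vol] by simp
  finally show ?thesis using \<sigma>_pos by (simp add: divide_right_mono add_divide_distrib)
qed

lemma diffusion_continuous:
  assumes "\<omega> \<in> space M" "\<forall>t\<ge>0. 0 \<le> S t \<omega>"
  shows "continuous_on {0..t} (\<lambda>u. (\<sigma> * S u \<omega> powr \<beta> - vol)\<^sup>2)"
proof -
  have S: "continuous_on {0..t} (\<lambda>u. S u \<omega>)"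
    by (rule continuous_on_subset[OF S_continuous[OF assms(1)]]) auto
  have "continuous_on {0..t} (\<lambda>u. S u \<omega> powr \<beta>)"
    using assms(2) \<beta>_half by (intro continuous_on_powr' S continuous_on_const) auto
  then show ?thesis by (intro continuous_on_power continuous_on_diff continuous_on_mult continuous_on_const)
qed

lemma energy_finite:
  assumes "\<omega> \<in> space M" "\<forall>t\<ge>0. 0 \<le> S t \<omega>"
  shows "energy t \<omega> < top"
  unfolding energy_def using nn_integral_Icc_continuous(1)[OF diffusion_continuous[OF assms]] by simp

lemma cumul_drift:
  assumes \<omega>: "\<omega> \<in> space M" "\<forall>t\<ge>0. 0 \<le> S t \<omega>"
  obtains d where "0 \<le> d" "cumul t \<omega> = ennreal d" "(LBINT s:{0..t}. \<mu> * S s \<omega>) = \<mu> * d"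
proof -
  have c: "continuous_on {0..t} (\<lambda>u. S u \<omega>)" by (rule continuous_on_subset[OF S_continuous[OF \<omega>(1)]]) auto
  show ?thesis
    using that[of "integral {0..t} (\<lambda>u. S u \<omega>)"] nn_integral_Icc_continuous[OF c] \<omega>(2)
    by (simp add: cumul_def)
qed

text \<open>Drift, Brownian part and noise are separated pointwise; the 3 comes from squaring a sum
  of three terms. In \<open>ennreal\<close> the inequalities can be integrated before any moment is
  known to be finite.\<close>

lemma deviation_decomposition:
  assumes t: "0 \<le> t" and \<omega>: "\<omega> \<in> space M" "\<forall>t\<ge>0. 0 \<le> S t \<omega>"
    and sol: "\<forall>t\<ge>0. S t \<omega> = S0 + (LBINT s:{0..t}. \<mu> * S s \<omega>) + I t \<omega>"
  shows "ennreal ((S t \<omega> - S0)\<^sup>2) \<le> ennreal (3 * \<mu>\<^sup>2) * (cumul t \<omega>)\<^sup>2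
      + ennreal (3 * vol\<^sup>2) * ennreal ((W t \<omega> - W 0 \<omega>)\<^sup>2) + ennreal 3 * ennreal ((noise t \<omega>)\<^sup>2)"
    and "ennreal \<bar>S t \<omega> - S0 - vol * (W t \<omega> - W 0 \<omega>)\<bar> \<le> ennreal \<bar>\<mu>\<bar> * cumul t \<omega> + ennreal \<bar>noise t \<omega>\<bar>"
proof -
  obtain d where d: "0 \<le> d" "cumul t \<omega> = ennreal d" "(LBINT s:{0..t}. \<mu> * S s \<omega>) = \<mu> * d"
    using cumul_drift[OF \<omega>] .
  define w where "w = W t \<omega> - W 0 \<omega>"
  have eq: "S t \<omega> - S0 = \<mu> * d + vol * w + noise t \<omega>"
    using sol t d by (simp add: noise_def w_def)
  have sq: "(x + y + z)\<^sup>2 \<le> 3 * x\<^sup>2 + 3 * y\<^sup>2 + 3 * z\<^sup>2" for x y z :: real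
  proof -
    have "3 * x\<^sup>2 + 3 * y\<^sup>2 + 3 * z\<^sup>2 - (x + y + z)\<^sup>2 = (x - y)\<^sup>2 + (y - z)\<^sup>2 + (x - z)\<^sup>2"
      by (simp add: power2_eq_square algebra_simps)
    then show ?thesis using zero_le_power2[of "x - y"] zero_le_power2[of "y - z"] zero_le_power2[of "x - z"] by linarith
  qed
  have "(S t \<omega> - S0)\<^sup>2 \<le> 3 * \<mu>\<^sup>2 * d\<^sup>2 + 3 * vol\<^sup>2 * w\<^sup>2 + 3 * (noise t \<omega>)\<^sup>2"
    unfolding eq using sq[of "\<mu> * d" "vol * w" "noise t \<omega>"] by (simp add: power_mult_distrib)
  then have "ennreal ((S t \<omega> - S0)\<^sup>2) \<le> ennreal (3 * \<mu>\<^sup>2 * d\<^sup>2 + 3 * vol\<^sup>2 * w\<^sup>2 + 3 * (noise t \<omega>)\<^sup>2)"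
    by (rule ennreal_leI)
  also have "\<dots> = ennreal (3 * \<mu>\<^sup>2) * (cumul t \<omega>)\<^sup>2 + ennreal (3 * vol\<^sup>2) * ennreal (w\<^sup>2) + ennreal 3 * ennreal ((noise t \<omega>)\<^sup>2)"
    using d(1) by (simp add: d(2) ennreal_power ennreal_mult[symmetric] ennreal_plus[symmetric] del: ennreal_plus ennreal_numeral)
  finally show "ennreal ((S t \<omega> - S0)\<^sup>2) \<le> ennreal (3 * \<mu>\<^sup>2) * (cumul t \<omega>)\<^sup>2
      + ennreal (3 * vol\<^sup>2) * ennreal ((W t \<omega> - W 0 \<omega>)\<^sup>2) + ennreal 3 * ennreal ((noise t \<omega>)\<^sup>2)"
    by (simp add: w_def)
  have "\<bar>S t \<omega> - S0 - vol * w\<bar> \<le> \<bar>\<mu>\<bar> * d + \<bar>noise t \<omega>\<bar>"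
    using eq d(1) abs_triangle_ineq[of "\<mu> * d" "noise t \<omega>"] by (simp add: abs_mult)
  then have "ennreal \<bar>S t \<omega> - S0 - vol * w\<bar> \<le> ennreal (\<bar>\<mu>\<bar> * d + \<bar>noise t \<omega>\<bar>)" by (rule ennreal_leI)
  then show "ennreal \<bar>S t \<omega> - S0 - vol * (W t \<omega> - W 0 \<omega>)\<bar> \<le> ennreal \<bar>\<mu>\<bar> * cumul t \<omega> + ennreal \<bar>noise t \<omega>\<bar>"
    using d(1) by (simp add: d(2) w_def ennreal_mult ennreal_plus)
qed

lemma increment_nn_second_moment:
  "0 \<le> t \<Longrightarrow> (\<integral>\<^sup>+\<omega>. ennreal ((W t \<omega> - W 0 \<omega>)\<^sup>2) \<partial>M) = ennreal t"
  using nn_integral_eq_integral[OF increment_moments(3)[of 0 t]] increment_moments(4)[of 0 t] by simp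

lemma noise_truncated_isometry:
  assumes "0 \<le> t" "0 \<le> b"
  shows "(\<integral>\<^sup>+\<omega>. ennreal ((noise t \<omega>)\<^sup>2) * indicator {\<omega>. energy t \<omega> < ennreal b} \<omega> \<partial>M)
    \<le> (\<integral>\<^sup>+\<omega>. min (ennreal b) (energy t \<omega>) \<partial>M)"
  using ito_truncated_isometry[OF ito assms, of vol] unfolding energy_def noise_def .

text \<open>The truncation is kept on the drift and on the noise, where finiteness is at stake, and
  dropped on the Brownian part, whose second moment is \<open>t\<close>. The noise is then handed to
  the isometry.\<close>

lemma trunc_dev_le:
  assumes t: "0 \<le> t" and b: "0 \<le> b"
  shows "trunc_dev b t \<le>
    ennreal (3 * \<mu>\<^sup>2) * (\<integral>\<^sup>+\<omega>. (cumul t \<omega>)\<^sup>2 * indicator {\<omega>. energy t \<omega> < ennreal b} \<omega> \<partial>M)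
    + ennreal (3 * vol\<^sup>2 * t) + ennreal 3 * (\<integral>\<^sup>+\<omega>. min (ennreal b) (energy t \<omega>) \<partial>M)"
proof -
  let ?E = "\<lambda>\<omega>. indicator {\<omega>. energy t \<omega> < ennreal b} \<omega> :: ennreal"
  have [measurable]: "?E \<in> borel_measurable M" by measurable
  have [measurable]: "noise t \<in> borel_measurable M" "W t \<in> borel_measurable M" "W 0 \<in> borel_measurable M"
    using t by (auto intro: noise_measurable W_measurable)
  have "trunc_dev b t \<le> (\<integral>\<^sup>+\<omega>. ennreal (3 * \<mu>\<^sup>2) * ((cumul t \<omega>)\<^sup>2 * ?E \<omega>)
      + ennreal (3 * vol\<^sup>2) * ennreal ((W t \<omega> - W 0 \<omega>)\<^sup>2) + ennreal 3 * (ennreal ((noise t \<omega>)\<^sup>2) * ?E \<omega>) \<partial>M)"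
    unfolding trunc_dev_def
  proof (rule nn_integral_mono_AE)
    show "AE \<omega> in M. ennreal ((S t \<omega> - S0)\<^sup>2) * ?E \<omega> \<le> ennreal (3 * \<mu>\<^sup>2) * ((cumul t \<omega>)\<^sup>2 * ?E \<omega>)
      + ennreal (3 * vol\<^sup>2) * ennreal ((W t \<omega> - W 0 \<omega>)\<^sup>2) + ennreal 3 * (ennreal ((noise t \<omega>)\<^sup>2) * ?E \<omega>)"
      using S_nonneg solution AE_space
    proof eventually_elim
      case (elim \<omega>)
      from deviation_decomposition(1)[OF t elim(3,1,2)] show ?case
        by (cases "energy t \<omega> < ennreal b") auto
    qed
  qed
  also have "\<dots> = ennreal (3 * \<mu>\<^sup>2) * (\<integral>\<^sup>+\<omega>. (cumul t \<omega>)\<^sup>2 * ?E \<omega> \<partial>M) +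
      ennreal (3 * vol\<^sup>2) * ennreal t + ennreal 3 * (\<integral>\<^sup>+\<omega>. ennreal ((noise t \<omega>)\<^sup>2) * ?E \<omega> \<partial>M)"
    using increment_nn_second_moment[OF t] by (simp add: nn_integral_add nn_integral_cmult del: ennreal_numeral)
  also have "\<dots> \<le> ennreal (3 * \<mu>\<^sup>2) * (\<integral>\<^sup>+\<omega>. (cumul t \<omega>)\<^sup>2 * ?E \<omega> \<partial>M) +
      ennreal (3 * vol\<^sup>2) * ennreal t + ennreal 3 * (\<integral>\<^sup>+\<omega>. min (ennreal b) (energy t \<omega>) \<partial>M)"
    by (intro add_left_mono mult_left_mono noise_truncated_isometry t b) simp
  finally show ?thesis using t by (simp add: ennreal_mult)
qed

text \<open>The a priori bound that makes the later supremum finite; it grows with \<open>b\<close>.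
  On the event, the linear bound of the state by the squared diffusion deviation turns energy below
  \<open>b\<close> into a bound on the integrated state.\<close>

lemma trunc_dev_bounded:
  assumes b: "0 \<le> b"
  obtains K :: real where "0 \<le> K" "\<And>t. t \<in> {0..1} \<Longrightarrow> trunc_dev b t \<le> ennreal K"
proof -
  define k1 where "k1 = 1 + 2 * vol\<^sup>2 / \<sigma>\<^sup>2"
  define k2 where "k2 = 2 / \<sigma>\<^sup>2"
  have k: "0 \<le> k1" "0 \<le> k2" by (auto simp: k1_def k2_def)
  have cumul: "(cumul t \<omega>)\<^sup>2 * indicator {\<omega>. energy t \<omega> < ennreal b} \<omega> \<le> ennreal ((k1 + k2 * b)\<^sup>2)"
    if t: "t \<in> {0..1}" and \<omega>: "\<omega> \<in> space M" "\<forall>t\<ge>0. 0 \<le> S t \<omega>" for t \<omega>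
  proof (cases "energy t \<omega> < ennreal b")
    case True
    have "cumul t \<omega> \<le> (\<integral>\<^sup>+u. ennreal k1 * indicator {0..t} u + ennreal k2 * (ennreal ((\<sigma> * S (max 0 u) \<omega> powr \<beta> - vol)\<^sup>2) * indicator {0..t} u) \<partial>lborel)"
      unfolding cumul_clip
    proof (rule nn_integral_mono)
      fix u
      have "ennreal (S (max 0 u) \<omega>) \<le> ennreal (k1 + k2 * (\<sigma> * S (max 0 u) \<omega> powr \<beta> - vol)\<^sup>2)"
        using \<omega> state_le_diffusion_dev[of "S (max 0 u) \<omega>"] by (intro ennreal_leI) (simp add: k1_def k2_def)
      also have "\<dots> = ennreal k1 + ennreal k2 * ennreal ((\<sigma> * S (max 0 u) \<omega> powr \<beta> - vol)\<^sup>2)"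
        using k by (simp add: ennreal_plus ennreal_mult)
      finally show "ennreal (S (max 0 u) \<omega>) * indicator {0..t} u \<le>
        ennreal k1 * indicator {0..t} u + ennreal k2 * (ennreal ((\<sigma> * S (max 0 u) \<omega> powr \<beta> - vol)\<^sup>2) * indicator {0..t} u)"
        by (cases "u \<in> {0..t}") auto
    qed
    also have "\<dots> = ennreal k1 * ennreal t + ennreal k2 * energy t \<omega>"
      unfolding energy_clip using t \<omega>(1)
      by (subst nn_integral_add) (auto simp: nn_integral_cmult nn_integral_cmult_indicator)
    also have "\<dots> \<le> ennreal k1 * ennreal 1 + ennreal k2 * ennreal b"
      using t True by (intro add_mono mult_left_mono) auto
    also have "\<dots> = ennreal (k1 + k2 * b)" using k b by (simp add: ennreal_plus ennreal_mult)
    finally have "(cumul t \<omega>)\<^sup>2 \<le> (ennreal (k1 + k2 * b))\<^sup>2" by (rule power_mono) simp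
    then show ?thesis using True k b by (simp add: ennreal_power del: ennreal_plus)
  qed simp
  define K where "K = 3 * \<mu>\<^sup>2 * (k1 + k2 * b)\<^sup>2 + 3 * vol\<^sup>2 + 3 * b"
  have "trunc_dev b t \<le> ennreal K" if t: "t \<in> {0..1}" for t
  proof -
    have "(\<integral>\<^sup>+\<omega>. (cumul t \<omega>)\<^sup>2 * indicator {\<omega>. energy t \<omega> < ennreal b} \<omega> \<partial>M) \<le> (\<integral>\<^sup>+\<omega>. ennreal ((k1 + k2 * b)\<^sup>2) \<partial>M)"
    proof (rule nn_integral_mono_AE)
      show "AE \<omega> in M. (cumul t \<omega>)\<^sup>2 * indicator {\<omega>. energy t \<omega> < ennreal b} \<omega> \<le> ennreal ((k1 + k2 * b)\<^sup>2)"
        using S_nonneg AE_space by eventually_elim (rule cumul[OF t])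
    qed
    then have 1: "(\<integral>\<^sup>+\<omega>. (cumul t \<omega>)\<^sup>2 * indicator {\<omega>. energy t \<omega> < ennreal b} \<omega> \<partial>M) \<le> ennreal ((k1 + k2 * b)\<^sup>2)"
      by (simp add: emeasure_space_1)
    have "(\<integral>\<^sup>+\<omega>. min (ennreal b) (energy t \<omega>) \<partial>M) \<le> (\<integral>\<^sup>+\<omega>. ennreal b \<partial>M)"
      by (rule nn_integral_mono) simp
    then have 2: "(\<integral>\<^sup>+\<omega>. min (ennreal b) (energy t \<omega>) \<partial>M) \<le> ennreal b" by (simp add: emeasure_space_1)
    have 3: "ennreal (3 * vol\<^sup>2 * t) \<le> ennreal (3 * vol\<^sup>2)" using t by (intro ennreal_leI) (auto intro: mult_left_le)
    have "trunc_dev b t \<le> ennreal (3 * \<mu>\<^sup>2) * ennreal ((k1 + k2 * b)\<^sup>2) + ennreal (3 * vol\<^sup>2) + ennreal 3 * ennreal b"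
      using t b by (intro order_trans[OF trunc_dev_le] add_mono mult_left_mono 1 2 3) auto
    also have "\<dots> = ennreal K"
      using b by (simp add: K_def ennreal_mult[symmetric] ennreal_plus[symmetric] del: ennreal_plus ennreal_numeral)
    finally show ?thesis .
  qed
  moreover have "0 \<le> K" using b by (simp add: K_def)
  ultimately show ?thesis using that by blast
qed

text \<open>Cauchy-Schwarz against the indicator of [0, t], whose square has integral t \<le> 1. The
  indicator is idempotent, so it can serve as both factors.\<close>

lemma cumul_sq_le:
  assumes "0 \<le> t" "t \<le> 1" "\<omega> \<in> space M"
  shows "(cumul t \<omega>)\<^sup>2 \<le> (\<integral>\<^sup>+u. (ennreal (S (max 0 u) \<omega>))\<^sup>2 * indicator {0..t} u \<partial>lborel)"
proof -
  note assms(3)[measurable]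
  have "(cumul t \<omega>)\<^sup>2 = (\<integral>\<^sup>+u. (ennreal (S (max 0 u) \<omega>) * indicator {0..t} u) * indicator {0..t} u \<partial>lborel)\<^sup>2"
    unfolding cumul_clip by (intro arg_cong[where f="\<lambda>x. x\<^sup>2"] nn_integral_cong) (auto simp: indicator_def)
  also have "\<dots> \<le> (\<integral>\<^sup>+u. (ennreal (S (max 0 u) \<omega>) * indicator {0..t} u)\<^sup>2 \<partial>lborel) * (\<integral>\<^sup>+u. (indicator {0..t} u)\<^sup>2 \<partial>lborel)"
    by (rule Cauchy_Schwarz_nn_integral) auto
  also have "(\<integral>\<^sup>+u. (indicator {0..t} u :: ennreal)\<^sup>2 \<partial>lborel) = (\<integral>\<^sup>+u. indicator {0..t} u \<partial>lborel)"
    by (intro nn_integral_cong) (auto simp: indicator_def)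
  also have "\<dots> = ennreal t" using assms by simp
  also have "(\<integral>\<^sup>+u. (ennreal (S (max 0 u) \<omega>) * indicator {0..t} u)\<^sup>2 \<partial>lborel) * ennreal t
     \<le> (\<integral>\<^sup>+u. (ennreal (S (max 0 u) \<omega>) * indicator {0..t} u)\<^sup>2 \<partial>lborel) * 1"
    using assms by (intro mult_left_mono) auto
  also have "\<dots> = (\<integral>\<^sup>+u. (ennreal (S (max 0 u) \<omega>))\<^sup>2 * indicator {0..t} u \<partial>lborel)"
    unfolding mult_1_right by (intro nn_integral_cong) (auto simp: indicator_def)
  finally show ?thesis .
qed

text \<open>One Gronwall iteration. Both random terms are bounded by the time integral
  \<open>G\<close> of the squared deviation on the event at the earlier time \<open>u\<close>: the
  drift because energy below \<open>b\<close> at \<open>t\<close> implies the same at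
  \<open>u\<close>, the noise by the intermediate value argument for \<open>min b A\<close>. Tonelli
  then returns the truncated deviation at time \<open>u\<close>.\<close>

lemma trunc_dev_step:
  assumes t: "0 \<le> t" "t \<le> 1" and b: "0 \<le> b" and m: "0 \<le> m"
    and le: "\<And>u. u \<in> {0..t} \<Longrightarrow> trunc_dev b u \<le> ennreal m"
  shows "trunc_dev b t \<le> ennreal ((6 * \<mu>\<^sup>2 * (S0\<^sup>2 + 1) + 3 * vol\<^sup>2 + 3 * lip\<^sup>2) * t * (1 + m))"
proof -
  define G where "G \<omega> u = ennreal ((S (max 0 u) \<omega> - S0)\<^sup>2) * indicator {u. energy u \<omega> < ennreal b} u * indicator {0..t} u" for \<omega> u
  have Gm[measurable]: "case_prod G \<in> borel_measurable (M \<Otimes>\<^sub>M lborel)"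
  proof -
    have "case_prod G = (\<lambda>p. ennreal ((S (max 0 (snd p)) (fst p) - S0)\<^sup>2) *
        (if energy (snd p) (fst p) < ennreal b then 1 else 0) * indicator {0..t} (snd p))"
      by (auto simp: G_def fun_eq_iff indicator_def)
    then show ?thesis by simp
  qed
  have G: "(\<integral>\<^sup>+\<omega>. \<integral>\<^sup>+u. G \<omega> u \<partial>lborel \<partial>M) \<le> ennreal (m * t)"
  proof -
    have "(\<integral>\<^sup>+\<omega>. \<integral>\<^sup>+u. G \<omega> u \<partial>lborel \<partial>M) = (\<integral>\<^sup>+u. \<integral>\<^sup>+\<omega>. G \<omega> u \<partial>M \<partial>lborel)"
      by (rule nn_integral_swap) measurable
    also have "\<dots> \<le> (\<integral>\<^sup>+u. ennreal m * indicator {0..t} u \<partial>lborel)"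
    proof (rule nn_integral_mono)
      fix u
      show "(\<integral>\<^sup>+\<omega>. G \<omega> u \<partial>M) \<le> ennreal m * indicator {0..t} u"
      proof (cases "u \<in> {0..t}")
        case True
        then have "(\<integral>\<^sup>+\<omega>. G \<omega> u \<partial>M) = trunc_dev b u"
          unfolding trunc_dev_def G_def by (intro nn_integral_cong) (auto simp: indicator_def)
        then show ?thesis using le[OF True] True by simp
      qed (simp add: G_def)
    qed
    also have "\<dots> = ennreal (m * t)" using t m by (simp add: nn_integral_cmult_indicator ennreal_mult)
    finally show ?thesis .
  qed
  have energy_mono: "energy u \<omega> \<le> energy v \<omega>" if "u \<le> v" for u v \<omega>
    unfolding energy_def using that by (intro nn_integral_mono) (auto simp: indicator_def)
  have Gm1: "G \<omega> \<in> borel_measurable lborel" if "\<omega> \<in> space M" for \<omega>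
    using measurable_Pair2[OF Gm that] by simp
  have "(\<integral>\<^sup>+\<omega>. (cumul t \<omega>)\<^sup>2 * indicator {\<omega>. energy t \<omega> < ennreal b} \<omega> \<partial>M)
    \<le> (\<integral>\<^sup>+\<omega>. ennreal (2 * S0\<^sup>2 * t) + ennreal 2 * (\<integral>\<^sup>+u. G \<omega> u \<partial>lborel) \<partial>M)"
  proof (rule nn_integral_mono)
    fix \<omega> assume \<omega>: "\<omega> \<in> space M"
    show "(cumul t \<omega>)\<^sup>2 * indicator {\<omega>. energy t \<omega> < ennreal b} \<omega> \<le> ennreal (2 * S0\<^sup>2 * t) + ennreal 2 * (\<integral>\<^sup>+u. G \<omega> u \<partial>lborel)"
    proof (cases "energy t \<omega> < ennreal b")
      case True
      have "(cumul t \<omega>)\<^sup>2 \<le> (\<integral>\<^sup>+u. (ennreal (S (max 0 u) \<omega>))\<^sup>2 * indicator {0..t} u \<partial>lborel)"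
        by (rule cumul_sq_le[OF t \<omega>])
      also have "\<dots> \<le> (\<integral>\<^sup>+u. ennreal (2 * S0\<^sup>2) * indicator {0..t} u + ennreal 2 * G \<omega> u \<partial>lborel)"
      proof (rule nn_integral_mono)
        fix u
        show "(ennreal (S (max 0 u) \<omega>))\<^sup>2 * indicator {0..t} u \<le> ennreal (2 * S0\<^sup>2) * indicator {0..t} u + ennreal 2 * G \<omega> u"
        proof (cases "u \<in> {0..t}")
          case u: True
          let ?x = "S (max 0 u) \<omega>"
          have "(ennreal ?x)\<^sup>2 \<le> ennreal (?x\<^sup>2)"
            by (cases "0 \<le> ?x") (auto simp: ennreal_power ennreal_neg)
          also have "\<dots> \<le> ennreal (2 * S0\<^sup>2 + 2 * (?x - S0)\<^sup>2)"
            using square_add_le_weighted[of 1 "?x - S0" S0] by (intro ennreal_leI) simp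
          also have "\<dots> = ennreal (2 * S0\<^sup>2) + ennreal 2 * ennreal ((?x - S0)\<^sup>2)"
            by (simp add: ennreal_plus ennreal_mult del: ennreal_numeral)
          finally have *: "(ennreal ?x)\<^sup>2 \<le> ennreal (2 * S0\<^sup>2) + ennreal 2 * ennreal ((?x - S0)\<^sup>2)" .
          have "energy u \<omega> < ennreal b" using True energy_mono[of u t \<omega>] u by auto
          then show ?thesis using u * by (simp add: G_def del: ennreal_numeral)
        qed (simp add: G_def)
      qed
      also have "\<dots> = ennreal (2 * S0\<^sup>2 * t) + ennreal 2 * (\<integral>\<^sup>+u. G \<omega> u \<partial>lborel)"
        using Gm1[OF \<omega>] t by (simp add: nn_integral_add nn_integral_cmult nn_integral_cmult_indicator ennreal_mult del: ennreal_numeral)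
      finally show ?thesis using True by simp
    qed simp
  qed
  also have "\<dots> = ennreal (2 * S0\<^sup>2 * t) + ennreal 2 * (\<integral>\<^sup>+\<omega>. \<integral>\<^sup>+u. G \<omega> u \<partial>lborel \<partial>M)"
    by (subst nn_integral_add) (auto simp: nn_integral_cmult emeasure_space_1 simp del: ennreal_numeral)
  also have "\<dots> \<le> ennreal (2 * S0\<^sup>2 * t) + ennreal 2 * ennreal (m * t)"
    by (intro add_left_mono mult_left_mono G) simp
  also have "\<dots> = ennreal (2 * S0\<^sup>2 * t + 2 * (m * t))"
    using t m by (simp add: ennreal_mult[symmetric] ennreal_plus[symmetric] del: ennreal_plus ennreal_numeral)
  finally have 1: "(\<integral>\<^sup>+\<omega>. (cumul t \<omega>)\<^sup>2 * indicator {\<omega>. energy t \<omega> < ennreal b} \<omega> \<partial>M) \<le> ennreal (2 * S0\<^sup>2 * t + 2 * (m * t))" .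
  have "(\<integral>\<^sup>+\<omega>. min (ennreal b) (energy t \<omega>) \<partial>M) \<le> (\<integral>\<^sup>+\<omega>. ennreal (lip\<^sup>2) * (\<integral>\<^sup>+u. G \<omega> u \<partial>lborel) \<partial>M)"
  proof (rule nn_integral_mono_AE)
    show "AE \<omega> in M. min (ennreal b) (energy t \<omega>) \<le> ennreal (lip\<^sup>2) * (\<integral>\<^sup>+u. G \<omega> u \<partial>lborel)"
      using S_nonneg AE_space
    proof eventually_elim
      case (elim \<omega>)
      have "min (ennreal b) (energy t \<omega>) \<le>
        (\<integral>\<^sup>+u\<in>{0..t}. ennreal ((\<sigma> * S u \<omega> powr \<beta> - vol)\<^sup>2) * indicator {u. energy u \<omega> < ennreal b} u \<partial>lborel)"
        unfolding energy_def
        by (rule min_primitive_le[OF diffusion_continuous[OF elim(2,1)] _ t(1)]) simp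
      also have "\<dots> \<le> (\<integral>\<^sup>+u. ennreal (lip\<^sup>2) * G \<omega> u \<partial>lborel)"
      proof (rule nn_integral_mono)
        fix u
        show "ennreal ((\<sigma> * S u \<omega> powr \<beta> - vol)\<^sup>2) * indicator {u. energy u \<omega> < ennreal b} u * indicator {0..t} u \<le> ennreal (lip\<^sup>2) * G \<omega> u"
        proof (cases "u \<in> {0..t}")
          case True
          then have "ennreal ((\<sigma> * S u \<omega> powr \<beta> - vol)\<^sup>2) \<le> ennreal (lip\<^sup>2) * ennreal ((S (max 0 u) \<omega> - S0)\<^sup>2)"
            using diffusion_dev_le[of "S u \<omega>"] elim(1) by (auto simp: ennreal_mult[symmetric] intro!: ennreal_leI)
          then show ?thesis using True by (auto simp: G_def split: split_indicator)
        qed simp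
      qed
      also have "\<dots> = ennreal (lip\<^sup>2) * (\<integral>\<^sup>+u. G \<omega> u \<partial>lborel)"
        by (rule nn_integral_cmult[OF Gm1[OF elim(2)]])
      finally show ?case .
    qed
  qed
  also have "\<dots> = ennreal (lip\<^sup>2) * (\<integral>\<^sup>+\<omega>. \<integral>\<^sup>+u. G \<omega> u \<partial>lborel \<partial>M)"
    by (rule nn_integral_cmult) measurable
  also have "\<dots> \<le> ennreal (lip\<^sup>2) * ennreal (m * t)"
    by (intro mult_left_mono G) simp
  finally have 2: "(\<integral>\<^sup>+\<omega>. min (ennreal b) (energy t \<omega>) \<partial>M) \<le> ennreal (lip\<^sup>2) * ennreal (m * t)" .
  have "trunc_dev b t \<le> ennreal (3 * \<mu>\<^sup>2) * ennreal (2 * S0\<^sup>2 * t + 2 * (m * t)) + ennreal (3 * vol\<^sup>2 * t)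
      + ennreal 3 * (ennreal (lip\<^sup>2) * ennreal (m * t))"
    using t b by (intro order_trans[OF trunc_dev_le] add_mono mult_left_mono 1 2) auto
  also have "\<dots> = ennreal (3 * \<mu>\<^sup>2 * (2 * S0\<^sup>2 * t + 2 * (m * t)) + 3 * vol\<^sup>2 * t + 3 * (lip\<^sup>2 * (m * t)))"
    using t m by (simp add: ennreal_mult[symmetric] ennreal_plus[symmetric] del: ennreal_plus ennreal_numeral)
  \<comment> \<open>The coefficients of \<open>t\<close> and of \<open>m * t\<close> are both
    enlarged to one common constant, which brings the bound to the form constant * t * (1 +
    m).\<close>
  also have "\<dots> \<le> ennreal ((6 * \<mu>\<^sup>2 * (S0\<^sup>2 + 1) + 3 * vol\<^sup>2 + 3 * lip\<^sup>2) * t * (1 + m))"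
  proof (rule ennreal_leI)
    have "(6 * \<mu>\<^sup>2 * (S0\<^sup>2 + 1) + 3 * vol\<^sup>2 + 3 * lip\<^sup>2) * t * (1 + m)
      - (3 * \<mu>\<^sup>2 * (2 * S0\<^sup>2 * t + 2 * (m * t)) + 3 * vol\<^sup>2 * t + 3 * (lip\<^sup>2 * (m * t)))
      = 6 * \<mu>\<^sup>2 * S0\<^sup>2 * (t * m) + 6 * \<mu>\<^sup>2 * t + 3 * vol\<^sup>2 * (t * m) + 3 * lip\<^sup>2 * t"
      by (simp add: algebra_simps)
    moreover have "0 \<le> 6 * \<mu>\<^sup>2 * S0\<^sup>2 * (t * m) + 6 * \<mu>\<^sup>2 * t + 3 * vol\<^sup>2 * (t * m) + 3 * lip\<^sup>2 * t"
      using t m by simp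
    ultimately show "3 * \<mu>\<^sup>2 * (2 * S0\<^sup>2 * t + 2 * (m * t)) + 3 * vol\<^sup>2 * t + 3 * (lip\<^sup>2 * (m * t))
      \<le> (6 * \<mu>\<^sup>2 * (S0\<^sup>2 + 1) + 3 * vol\<^sup>2 + 3 * lip\<^sup>2) * t * (1 + m)" by linarith
  qed
  finally show ?thesis .
qed

end

section \<open>Removing the truncation, and the linearization error\<close>

context cev_model
begin

text \<open>The energy at a fixed time is almost surely finite, so for almost every sample point the
  indicator is eventually 1; Fatou does the rest.\<close>

lemma nn_integral_untruncate:
  fixes f :: "'a \<Rightarrow> ennreal"
  assumes [measurable]: "f \<in> borel_measurable M"
    and le: "\<And>n::nat. (\<integral>\<^sup>+\<omega>. f \<omega> * indicator {\<omega>. energy t \<omega> < ennreal (real n)} \<omega> \<partial>M) \<le> K"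
  shows "(\<integral>\<^sup>+\<omega>. f \<omega> \<partial>M) \<le> K"
proof -
  let ?f = "\<lambda>n \<omega>. f \<omega> * indicator {\<omega>. energy t \<omega> < ennreal (real n)} \<omega>"
  have "(\<integral>\<^sup>+\<omega>. f \<omega> \<partial>M) \<le> (\<integral>\<^sup>+\<omega>. liminf (\<lambda>n. ?f n \<omega>) \<partial>M)"
  proof (rule nn_integral_mono_AE)
    show "AE \<omega> in M. f \<omega> \<le> liminf (\<lambda>n. ?f n \<omega>)"
      using S_nonneg AE_space
    proof eventually_elim
      case (elim \<omega>)
      obtain e where e: "energy t \<omega> = ennreal e" "0 \<le> e"
        using energy_finite[OF elim(2,1), of t] by (cases "energy t \<omega>") auto
      obtain N :: nat where "e < real N" using reals_Archimedean2 by blast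
      then have "f \<omega> \<le> ?f n \<omega>" if "N \<le> n" for n
        using that e by (simp add: ennreal_less_iff)
      then have "\<forall>\<^sub>F n in sequentially. f \<omega> \<le> ?f n \<omega>" by (rule eventually_sequentiallyI)
      then show ?case by (rule Liminf_bounded)
    qed
  qed
  also have "\<dots> \<le> liminf (\<lambda>n. \<integral>\<^sup>+\<omega>. ?f n \<omega> \<partial>M)"
    by (rule nn_integral_liminf) measurable
  also have "\<dots> \<le> K" using le by (intro Liminf_le) auto
  finally show ?thesis .
qed

text \<open>With \<open>m\<close> the finite supremum over [0, t0], one iteration gives m \<le> (1 +
  m) / 2, hence m \<le> 1. Feeding this back bounds the truncated moment by 2 C t for every
  \<open>b\<close>, and the truncation can be lifted.\<close>

lemma deviation_second_moment:
  obtains C t0 :: real where "0 \<le> C" "0 < t0" "t0 \<le> 1"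
    "\<And>t. t \<in> {0..t0} \<Longrightarrow> (\<integral>\<^sup>+\<omega>. ennreal ((S t \<omega> - S0)\<^sup>2) \<partial>M) \<le> ennreal (C * t)"
proof -
  define C where "C = 6 * \<mu>\<^sup>2 * (S0\<^sup>2 + 1) + 3 * vol\<^sup>2 + 3 * lip\<^sup>2"
  have C: "0 \<le> C" by (simp add: C_def)
  \<comment> \<open>Makes C t0 at most 1/2 and t0 at most 1, and stays meaningful for C = 0.\<close>
  define t0 where "t0 = 1 / (2 * C + 1)"
  have t0: "0 < t0" "t0 \<le> 1" "C * t0 \<le> 1 / 2" using C by (auto simp: t0_def field_simps)
  have trunc: "trunc_dev b t \<le> ennreal (2 * C * t)" if b: "0 \<le> b" and t: "t \<in> {0..t0}" for b t
  proof -
    obtain K where K: "0 \<le> K" "\<And>t. t \<in> {0..1} \<Longrightarrow> trunc_dev b t \<le> ennreal K"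
      using trunc_dev_bounded[OF b] by blast
    define s where "s = (SUP t\<in>{0..t0}. trunc_dev b t)"
    have "s \<le> ennreal K" unfolding s_def using K t0 by (intro SUP_least) auto
    then have "s \<noteq> top" by (auto simp: top_unique)
    then obtain m where m: "s = ennreal m" "0 \<le> m" by (cases s) auto
    have le: "trunc_dev b u \<le> ennreal m" if "u \<in> {0..t0}" for u
      unfolding m(1)[symmetric] s_def using that by (rule SUP_upper)
    have step: "trunc_dev b u \<le> ennreal (C * u * (1 + m))" if u: "u \<in> {0..t0}" for u
      unfolding C_def using u t0 le by (intro trunc_dev_step b m(2)) auto
    have "s \<le> ennreal (1 / 2 * (1 + m))"
      unfolding s_def
    proof (rule SUP_least)
      fix u assume u: "u \<in> {0..t0}"
      have "C * u \<le> C * t0" using u C by (intro mult_left_mono) auto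
      then have "C * u * (1 + m) \<le> 1 / 2 * (1 + m)" using t0(3) m(2) by (intro mult_right_mono) auto
      then show "trunc_dev b u \<le> ennreal (1 / 2 * (1 + m))"
        by (intro order_trans[OF step[OF u]] ennreal_leI)
    qed
    then have "m \<le> 1" using m by (simp add: ennreal_le_iff)
    then have "C * t * (1 + m) \<le> C * t * 2" using C t by (intro mult_left_mono) auto
    then show ?thesis by (intro order_trans[OF step[OF t]] ennreal_leI) (simp add: mult_ac)
  qed
  have "(\<integral>\<^sup>+\<omega>. ennreal ((S t \<omega> - S0)\<^sup>2) \<partial>M) \<le> ennreal (2 * C * t)" if t: "t \<in> {0..t0}" for t
  proof (rule nn_integral_untruncate)
    have [measurable]: "S t \<in> borel_measurable M" using t by (intro S_measurable) auto
    show "(\<lambda>\<omega>. ennreal ((S t \<omega> - S0)\<^sup>2)) \<in> borel_measurable M" by measurable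
    show "(\<integral>\<^sup>+\<omega>. ennreal ((S t \<omega> - S0)\<^sup>2) * indicator {\<omega>. energy t \<omega> < ennreal (real n)} \<omega> \<partial>M) \<le> ennreal (2 * C * t)" for n
      using trunc[OF _ t, of "real n"] unfolding trunc_dev_def by simp
  qed
  then show ?thesis using that[of "2 * C" t0] C t0 by auto
qed

lemma nn_integral_over_time_le:
  fixes f :: "'a \<Rightarrow> real \<Rightarrow> ennreal"
  assumes [measurable]: "case_prod f \<in> borel_measurable (M \<Otimes>\<^sub>M lborel)" and t: "0 \<le> t" and K: "0 \<le> K"
    and le: "\<And>u. u \<in> {0..t} \<Longrightarrow> (\<integral>\<^sup>+\<omega>. f \<omega> u \<partial>M) \<le> ennreal K"
  shows "(\<integral>\<^sup>+\<omega>. \<integral>\<^sup>+u. f \<omega> u * indicator {0..t} u \<partial>lborel \<partial>M) \<le> ennreal (K * t)"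
proof -
  have "(\<integral>\<^sup>+\<omega>. \<integral>\<^sup>+u. f \<omega> u * indicator {0..t} u \<partial>lborel \<partial>M) = (\<integral>\<^sup>+u. \<integral>\<^sup>+\<omega>. f \<omega> u * indicator {0..t} u \<partial>M \<partial>lborel)"
    by (rule nn_integral_swap) measurable
  also have "\<dots> \<le> (\<integral>\<^sup>+u. ennreal K * indicator {0..t} u \<partial>lborel)"
    using le by (intro nn_integral_mono) (auto split: split_indicator)
  also have "\<dots> = ennreal (K * t)" using t K by (simp add: nn_integral_cmult_indicator ennreal_mult)
  finally show ?thesis .
qed

text \<open>The expected energy is an integral of O(u) over [0, t], hence O(t^2); by the isometry
  the noise has second moment O(t^2) and mean size O(t). The drift is O(t) because the mean of
  \<open>S\<close> is bounded on the interval.\<close>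

lemma linear_error:
  obtains D t0 :: real where "0 \<le> D" "0 < t0" "t0 \<le> 1"
    "\<And>t. 0 < t \<Longrightarrow> t \<le> t0 \<Longrightarrow> (\<integral>\<^sup>+\<omega>. ennreal \<bar>S t \<omega> - S0 - vol * (W t \<omega> - W 0 \<omega>)\<bar> \<partial>M) \<le> ennreal (D * t)"
proof -
  obtain C t0 :: real where C: "0 \<le> C" and t0: "0 < t0" "t0 \<le> 1"
    and dev: "\<And>t. t \<in> {0..t0} \<Longrightarrow> (\<integral>\<^sup>+\<omega>. ennreal ((S t \<omega> - S0)\<^sup>2) \<partial>M) \<le> ennreal (C * t)"
    using deviation_second_moment by blast
  define D where "D = \<bar>\<mu>\<bar> * (S0 + 1 + C) + (1 / 2 + lip\<^sup>2 * C / 2)"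
  have main: "(\<integral>\<^sup>+\<omega>. ennreal \<bar>S t \<omega> - S0 - vol * (W t \<omega> - W 0 \<omega>)\<bar> \<partial>M) \<le> ennreal (D * t)"
    if t: "0 < t" "t \<le> t0" for t
  proof -
    have [measurable]: "noise t \<in> borel_measurable M" using t by (intro noise_measurable) auto
    have "(\<integral>\<^sup>+\<omega>. energy t \<omega> \<partial>M) \<le> (\<integral>\<^sup>+\<omega>. \<integral>\<^sup>+u. ennreal (lip\<^sup>2) * ennreal ((S (max 0 u) \<omega> - S0)\<^sup>2) * indicator {0..t} u \<partial>lborel \<partial>M)"
    proof (rule nn_integral_mono_AE)
      show "AE \<omega> in M. energy t \<omega> \<le> (\<integral>\<^sup>+u. ennreal (lip\<^sup>2) * ennreal ((S (max 0 u) \<omega> - S0)\<^sup>2) * indicator {0..t} u \<partial>lborel)"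
        using S_nonneg
      proof eventually_elim
        case (elim \<omega>)
        have "ennreal ((\<sigma> * S (max 0 u) \<omega> powr \<beta> - vol)\<^sup>2) \<le> ennreal (lip\<^sup>2) * ennreal ((S (max 0 u) \<omega> - S0)\<^sup>2)" for u
        proof -
          have "ennreal ((\<sigma> * S (max 0 u) \<omega> powr \<beta> - vol)\<^sup>2) \<le> ennreal (lip\<^sup>2 * (S (max 0 u) \<omega> - S0)\<^sup>2)"
            using elim by (intro ennreal_leI diffusion_dev_le) simp
          also have "\<dots> = ennreal (lip\<^sup>2) * ennreal ((S (max 0 u) \<omega> - S0)\<^sup>2)" by (rule ennreal_mult) auto
          finally show ?thesis .
        qed
        then show ?case unfolding energy_clip by (intro nn_integral_mono mult_right_mono) auto
      qed
    qed
    also have "\<dots> \<le> ennreal (lip\<^sup>2 * (C * t) * t)"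
    proof (rule nn_integral_over_time_le)
      fix u assume u: "u \<in> {0..t}"
      have [measurable]: "S u \<in> borel_measurable M" using u by (intro S_measurable) auto
      have "(\<integral>\<^sup>+\<omega>. ennreal (lip\<^sup>2) * ennreal ((S (max 0 u) \<omega> - S0)\<^sup>2) \<partial>M) = ennreal (lip\<^sup>2) * (\<integral>\<^sup>+\<omega>. ennreal ((S u \<omega> - S0)\<^sup>2) \<partial>M)"
        using u by (simp add: nn_integral_cmult)
      also have "\<dots> \<le> ennreal (lip\<^sup>2) * ennreal (C * t)"
        using u t C by (intro mult_left_mono order_trans[OF dev] ennreal_leI) auto
      also have "\<dots> = ennreal (lip\<^sup>2 * (C * t))" using C t by (simp add: ennreal_mult)
      finally show "(\<integral>\<^sup>+\<omega>. ennreal (lip\<^sup>2) * ennreal ((S (max 0 u) \<omega> - S0)\<^sup>2) \<partial>M) \<le> ennreal (lip\<^sup>2 * (C * t))" .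
    qed (use C t in auto)
    finally have energy: "(\<integral>\<^sup>+\<omega>. energy t \<omega> \<partial>M) \<le> ennreal (lip\<^sup>2 * (C * t) * t)" .
    have noise2: "(\<integral>\<^sup>+\<omega>. ennreal ((noise t \<omega>)\<^sup>2) \<partial>M) \<le> ennreal (lip\<^sup>2 * (C * t) * t)"
    proof (rule nn_integral_untruncate)
      fix n :: nat
      have "(\<integral>\<^sup>+\<omega>. ennreal ((noise t \<omega>)\<^sup>2) * indicator {\<omega>. energy t \<omega> < ennreal (real n)} \<omega> \<partial>M)
        \<le> (\<integral>\<^sup>+\<omega>. min (ennreal (real n)) (energy t \<omega>) \<partial>M)"
        using t by (intro noise_truncated_isometry) auto
      also have "\<dots> \<le> (\<integral>\<^sup>+\<omega>. energy t \<omega> \<partial>M)" by (intro nn_integral_mono) simp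
      finally show "(\<integral>\<^sup>+\<omega>. ennreal ((noise t \<omega>)\<^sup>2) * indicator {\<omega>. energy t \<omega> < ennreal (real n)} \<omega> \<partial>M)
        \<le> ennreal (lip\<^sup>2 * (C * t) * t)" using energy by (rule order_trans)
    qed measurable
    have "(\<integral>\<^sup>+\<omega>. ennreal \<bar>noise t \<omega>\<bar> \<partial>M) \<le> (\<integral>\<^sup>+\<omega>. ennreal (t / 2) + ennreal (1 / (2 * t)) * ennreal ((noise t \<omega>)\<^sup>2) \<partial>M)"
    proof (rule nn_integral_mono)
      fix \<omega>
      \<comment> \<open>The weight \<open>t\<close> balances the two terms: the second moment is of
        order t^2, so dividing it by 2 t leaves order t.\<close>
      have "0 \<le> (\<bar>noise t \<omega>\<bar> - t)\<^sup>2 / (2 * t)" using t by simp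
      also have "\<dots> = t / 2 + 1 / (2 * t) * (noise t \<omega>)\<^sup>2 - \<bar>noise t \<omega>\<bar>"
        using t by (simp add: power2_diff field_simps power2_eq_square[of t])
      finally have "ennreal \<bar>noise t \<omega>\<bar> \<le> ennreal (t / 2 + 1 / (2 * t) * (noise t \<omega>)\<^sup>2)" by (intro ennreal_leI) simp
      also have "\<dots> = ennreal (t / 2) + ennreal (1 / (2 * t)) * ennreal ((noise t \<omega>)\<^sup>2)"
        using t by (subst ennreal_plus) (auto simp: ennreal_mult[symmetric])
      finally show "ennreal \<bar>noise t \<omega>\<bar> \<le> ennreal (t / 2) + ennreal (1 / (2 * t)) * ennreal ((noise t \<omega>)\<^sup>2)" .
    qed
    also have "\<dots> = ennreal (t / 2) + ennreal (1 / (2 * t)) * (\<integral>\<^sup>+\<omega>. ennreal ((noise t \<omega>)\<^sup>2) \<partial>M)"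
      by (subst nn_integral_add) (auto simp: nn_integral_cmult emeasure_space_1)
    also have "\<dots> \<le> ennreal (t / 2) + ennreal (1 / (2 * t)) * ennreal (lip\<^sup>2 * (C * t) * t)"
      by (intro add_left_mono mult_left_mono noise2) simp
    also have "\<dots> = ennreal (t / 2 + 1 / (2 * t) * (lip\<^sup>2 * (C * t) * t))"
      using t C by (subst ennreal_plus) (auto simp: ennreal_mult[symmetric])
    also have "t / 2 + 1 / (2 * t) * (lip\<^sup>2 * (C * t) * t) = (1 / 2 + lip\<^sup>2 * C / 2) * t"
      using t by (simp add: field_simps)
    finally have noise1: "(\<integral>\<^sup>+\<omega>. ennreal \<bar>noise t \<omega>\<bar> \<partial>M) \<le> ennreal ((1 / 2 + lip\<^sup>2 * C / 2) * t)" .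
    have "(\<integral>\<^sup>+\<omega>. cumul t \<omega> \<partial>M) \<le> ennreal ((S0 + 1 + C) * t)"
      unfolding cumul_clip
    proof (rule nn_integral_over_time_le)
      fix u assume u: "u \<in> {0..t}"
      have [measurable]: "S u \<in> borel_measurable M" using u by (intro S_measurable) auto
      have "(\<integral>\<^sup>+\<omega>. ennreal (S (max 0 u) \<omega>) \<partial>M) \<le> (\<integral>\<^sup>+\<omega>. ennreal (S0 + 1) + ennreal ((S u \<omega> - S0)\<^sup>2) \<partial>M)"
      proof (rule nn_integral_mono)
        fix \<omega>
        \<comment> \<open>Completing the square bounds the mean of the state by the second moment of
          its deviation, the only moment known so far.\<close>
        have "0 \<le> (S u \<omega> - S0 - 1 / 2)\<^sup>2" by simp
        then have "S u \<omega> \<le> (S0 + 1) + (S u \<omega> - S0)\<^sup>2" by (simp add: power2_eq_square algebra_simps)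
        then have "ennreal (S u \<omega>) \<le> ennreal ((S0 + 1) + (S u \<omega> - S0)\<^sup>2)" by (rule ennreal_leI)
        also have "\<dots> = ennreal (S0 + 1) + ennreal ((S u \<omega> - S0)\<^sup>2)" using S0_pos by (intro ennreal_plus) auto
        finally show "ennreal (S (max 0 u) \<omega>) \<le> ennreal (S0 + 1) + ennreal ((S u \<omega> - S0)\<^sup>2)" using u by simp
      qed
      also have "\<dots> = ennreal (S0 + 1) + (\<integral>\<^sup>+\<omega>. ennreal ((S u \<omega> - S0)\<^sup>2) \<partial>M)"
        by (subst nn_integral_add) (auto simp: emeasure_space_1)
      also have "\<dots> \<le> ennreal (S0 + 1) + ennreal C"
      proof (intro add_left_mono order_trans[OF dev] ennreal_leI)
        show "C * u \<le> C" using u t t0 C by (intro mult_left_le) auto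
      qed (use u t in auto)
      also have "\<dots> = ennreal (S0 + 1 + C)" using S0_pos C by (intro ennreal_plus[symmetric]) auto
      finally show "(\<integral>\<^sup>+\<omega>. ennreal (S (max 0 u) \<omega>) \<partial>M) \<le> ennreal (S0 + 1 + C)" .
    qed (use S0_pos C t in auto)
    note cumul1 = this
    have "(\<integral>\<^sup>+\<omega>. ennreal \<bar>S t \<omega> - S0 - vol * (W t \<omega> - W 0 \<omega>)\<bar> \<partial>M) \<le> (\<integral>\<^sup>+\<omega>. ennreal \<bar>\<mu>\<bar> * cumul t \<omega> + ennreal \<bar>noise t \<omega>\<bar> \<partial>M)"
    proof (rule nn_integral_mono_AE)
      show "AE \<omega> in M. ennreal \<bar>S t \<omega> - S0 - vol * (W t \<omega> - W 0 \<omega>)\<bar> \<le> ennreal \<bar>\<mu>\<bar> * cumul t \<omega> + ennreal \<bar>noise t \<omega>\<bar>"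
        using S_nonneg solution AE_space
      proof eventually_elim
        case (elim \<omega>)
        show ?case by (rule deviation_decomposition(2)[OF _ elim(3,1,2)]) (use t in simp)
      qed
    qed
    also have "\<dots> = ennreal \<bar>\<mu>\<bar> * (\<integral>\<^sup>+\<omega>. cumul t \<omega> \<partial>M) + (\<integral>\<^sup>+\<omega>. ennreal \<bar>noise t \<omega>\<bar> \<partial>M)"
      by (subst nn_integral_add) (auto simp: nn_integral_cmult)
    also have "\<dots> \<le> ennreal \<bar>\<mu>\<bar> * ennreal ((S0 + 1 + C) * t) + ennreal ((1 / 2 + lip\<^sup>2 * C / 2) * t)"
      by (intro add_mono mult_left_mono cumul1 noise1) simp
    also have "\<dots> = ennreal (\<bar>\<mu>\<bar> * ((S0 + 1 + C) * t) + (1 / 2 + lip\<^sup>2 * C / 2) * t)"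
      using t C S0_pos by (subst ennreal_plus) (auto simp: ennreal_mult)
    also have "\<bar>\<mu>\<bar> * ((S0 + 1 + C) * t) + (1 / 2 + lip\<^sup>2 * C / 2) * t = D * t"
      by (simp add: D_def algebra_simps)
    finally show ?thesis .
  qed
  have "0 \<le> D" using C S0_pos by (simp add: D_def)
  then show ?thesis using that t0 main by blast
qed

section \<open>Time averages, payoffs and discounting\<close>

definition excess :: "real \<Rightarrow> 'a \<Rightarrow> real" where
  "excess T \<omega> = 1 / T * (LBINT t:{0..T}. S t \<omega>) - S0"

text \<open>The error at each time of [0, T] is at most D T in mean; integrating over time and
  dividing by T preserves this bound.\<close>

lemma average_error:
  assumes T: "0 < T" and D: "0 \<le> D"
    and err: "\<And>t. 0 < t \<Longrightarrow> t \<le> T \<Longrightarrow>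
      (\<integral>\<^sup>+\<omega>. ennreal \<bar>S t \<omega> - S0 - vol * (W t \<omega> - W 0 \<omega>)\<bar> \<partial>M) \<le> ennreal (D * t)"
  shows "integrable M (\<lambda>\<omega>. excess T \<omega> - vol / T * area T \<omega>)"
    "expectation (\<lambda>\<omega>. \<bar>excess T \<omega> - vol / T * area T \<omega>\<bar>) \<le> D * T"
proof -
  let ?Y = "\<lambda>u \<omega>. S u \<omega> - S0 - vol * (W u \<omega> - W 0 \<omega>)"
  let ?I = "\<lambda>\<omega>. integral {0..T} (\<lambda>u. ?Y u \<omega>)"
  have cont: "continuous_on {0..} (\<lambda>u. ?Y u \<omega>)" if "\<omega> \<in> space M" for \<omega>
    by (intro continuous_on_diff continuous_on_mult continuous_on_const S_continuous[OF that] W_continuous[OF that])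
  have meas: "?Y u \<in> borel_measurable M" if "0 \<le> u" for u
    using that by (intro borel_measurable_diff borel_measurable_times borel_measurable_const S_measurable W_measurable) auto
  have Im: "?I \<in> borel_measurable M" by (intro time_integral_measurable cont meas) auto
  have eq: "excess T \<omega> - vol / T * area T \<omega> = 1 / T * ?I \<omega>" if \<omega>: "\<omega> \<in> space M" for \<omega>
  proof -
    have c: "continuous_on {0..T} (\<lambda>u. S u \<omega>)" "continuous_on {0..T} (\<lambda>u. W u \<omega>)"
      by (auto intro: continuous_on_subset[OF W_continuous[OF \<omega>]] continuous_on_subset[OF S_continuous[OF \<omega>]])
    have "?I \<omega> = integral {0..T} (\<lambda>u. S u \<omega> - S0) - integral {0..T} (\<lambda>u. vol * (W u \<omega> - W 0 \<omega>))"
      using c by (intro Henstock_Kurzweil_Integration.integral_diff integrable_continuous_real continuous_intros) auto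
    also have "integral {0..T} (\<lambda>u. S u \<omega> - S0) = integral {0..T} (\<lambda>u. S u \<omega>) - integral {0..T} (\<lambda>u. S0)"
      using c by (intro Henstock_Kurzweil_Integration.integral_diff integrable_continuous_real continuous_intros) auto
    also have "integral {0..T} (\<lambda>u. vol * (W u \<omega> - W 0 \<omega>)) = vol * area T \<omega>"
      by (simp add: area_def)
    also have "integral {0..T} (\<lambda>u. S u \<omega>) = (LBINT t:{0..T}. S t \<omega>)"
      using set_borel_integral_eq_integral(2)[OF borel_integrable_atLeastAtMost'[OF c(1)]] by simp
    also have "integral {0..T} (\<lambda>u. S0) = T * S0" using T by simp
    finally show ?thesis using T unfolding excess_def by (simp only:) (simp add: field_simps)
  qed
  have bound: "(\<integral>\<^sup>+\<omega>. ennreal \<bar>?I \<omega>\<bar> \<partial>M) \<le> ennreal ((T - 0) * (D * T))"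
  proof (rule nn_integral_abs_time_integral_le[OF cont meas])
    fix u assume u: "0 < u" "u \<le> T"
    then have "D * u \<le> D * T" using D by (intro mult_left_mono) auto
    then show "(\<integral>\<^sup>+\<omega>. ennreal \<bar>?Y u \<omega>\<bar> \<partial>M) \<le> ennreal (D * T)"
      by (intro order_trans[OF err[OF u]] ennreal_leI)
  qed (use T D in auto)
  have int: "integrable M ?I"
    using Im bound by (intro integrableI_bounded) (auto intro: le_less_trans)
  then show "integrable M (\<lambda>\<omega>. excess T \<omega> - vol / T * area T \<omega>)"
    by (subst Bochner_Integration.integrable_cong[OF refl eq]) auto
  have "ennreal (expectation (\<lambda>\<omega>. \<bar>?I \<omega>\<bar>)) = (\<integral>\<^sup>+\<omega>. ennreal \<bar>?I \<omega>\<bar> \<partial>M)"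
    using int by (intro nn_integral_eq_integral[symmetric]) auto
  then have "ennreal (expectation (\<lambda>\<omega>. \<bar>?I \<omega>\<bar>)) \<le> ennreal ((T - 0) * (D * T))"
    using bound by (simp only:)
  then have "expectation (\<lambda>\<omega>. \<bar>?I \<omega>\<bar>) \<le> T * (D * T)"
    using T D by (subst (asm) ennreal_le_iff) auto
  moreover have "expectation (\<lambda>\<omega>. \<bar>excess T \<omega> - vol / T * area T \<omega>\<bar>) = expectation (\<lambda>\<omega>. 1 / T * \<bar>?I \<omega>\<bar>)"
    using T by (intro Bochner_Integration.integral_cong refl) (simp only: eq abs_mult, simp)
  ultimately show "expectation (\<lambda>\<omega>. \<bar>excess T \<omega> - vol / T * area T \<omega>\<bar>) \<le> D * T"
    using T by (simp add: field_simps)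
qed

text \<open>The left side is half the absolute moment of the Gaussian average, with sqrt (T^3 / 3)
  the standard deviation of the area and sqrt (2 / pi) the absolute moment of a standard normal
  variable.\<close>

lemma normal_payoff_constant:
  assumes T: "0 < T"
  shows "vol / T * (sqrt (T ^ 3 / 3) * sqrt (2 / pi)) / 2 = vol * (sqrt T / sqrt (6 * pi))"
proof -
  have "sqrt (T ^ 3 / 3) * sqrt (2 / pi) = sqrt ((2 * T)\<^sup>2 * (T / (6 * pi)))"
    unfolding real_sqrt_mult[symmetric] by (simp add: power3_eq_cube power2_eq_square)
  also have "\<dots> = 2 * T * (sqrt T / sqrt (6 * pi))"
    unfolding real_sqrt_mult[of "(2 * T)\<^sup>2"] real_sqrt_divide real_sqrt_abs using T by simp
  finally show ?thesis using T by simp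
qed

text \<open>The sign \<open>s\<close> treats call and put together: 1 is the call, -1 the put. The
  positive part is 1-Lipschitz, so replacing the excess by the Gaussian average costs no more than
  the mean error of the average.\<close>

lemma payoff_error:
  assumes T: "0 < T" and D: "0 \<le> D" and s: "\<bar>s\<bar> = 1"
    and err: "\<And>t. 0 < t \<Longrightarrow> t \<le> T \<Longrightarrow>
      (\<integral>\<^sup>+\<omega>. ennreal \<bar>S t \<omega> - S0 - vol * (W t \<omega> - W 0 \<omega>)\<bar> \<partial>M) \<le> ennreal (D * t)"
  shows "\<bar>expectation (\<lambda>\<omega>. max 0 (s * excess T \<omega>)) - vol * (sqrt T / sqrt (6 * pi))\<bar> \<le> D * T"
proof -
  let ?V = "\<lambda>\<omega>. vol / T * area T \<omega>"
  note avg = average_error[OF T D err]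
  note mom = area_moments[OF T]
  have V: "integrable M ?V" using mom(1) by simp
  have "integrable M (\<lambda>\<omega>. (excess T \<omega> - ?V \<omega>) + ?V \<omega>)"
    using avg(1) V by (rule Bochner_Integration.integrable_add)
  then have U: "integrable M (excess T)" by simp
  have vol: "0 \<le> vol / T" using T \<sigma>_pos by (simp add: vol_def)
  have "expectation (\<lambda>\<omega>. max 0 (s * ?V \<omega>)) = expectation (\<lambda>\<omega>. (vol / T * \<bar>area T \<omega>\<bar> + s * (vol / T) * area T \<omega>) / 2)"
  proof (intro Bochner_Integration.integral_cong refl)
    fix \<omega>
    have "max 0 x = (\<bar>x\<bar> + x) / 2" for x :: real by (simp add: max_def)
    then have "max 0 (s * ?V \<omega>) = (\<bar>s * ?V \<omega>\<bar> + s * ?V \<omega>) / 2" .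
    also have "\<bar>s * ?V \<omega>\<bar> = vol / T * \<bar>area T \<omega>\<bar>" using abs_of_nonneg[OF vol] by (simp only: abs_mult s mult_1_left)
    finally show "max 0 (s * ?V \<omega>) = (vol / T * \<bar>area T \<omega>\<bar> + s * (vol / T) * area T \<omega>) / 2" by (simp add: mult.assoc)
  qed
  also have "\<dots> = (vol / T * (sqrt (T ^ 3 / 3) * sqrt (2 / pi)) + s * (vol / T) * 0) / 2"
    using mom by simp
  also have "\<dots> = vol * (sqrt T / sqrt (6 * pi))" using normal_payoff_constant[OF T] by simp
  finally have EV: "expectation (\<lambda>\<omega>. max 0 (s * ?V \<omega>)) = vol * (sqrt T / sqrt (6 * pi))" .
  have i: "integrable M (\<lambda>\<omega>. max 0 (s * excess T \<omega>))" "integrable M (\<lambda>\<omega>. max 0 (s * ?V \<omega>))"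
    using U V by (auto intro!: integrable_max simp del: times_divide_eq_left)
  have "\<bar>expectation (\<lambda>\<omega>. max 0 (s * excess T \<omega>)) - expectation (\<lambda>\<omega>. max 0 (s * ?V \<omega>))\<bar>
      = \<bar>expectation (\<lambda>\<omega>. max 0 (s * excess T \<omega>) - max 0 (s * ?V \<omega>))\<bar>"
    using i by (simp only: Bochner_Integration.integral_diff)
  also have "\<dots> \<le> expectation (\<lambda>\<omega>. \<bar>max 0 (s * excess T \<omega>) - max 0 (s * ?V \<omega>)\<bar>)" by (rule integral_abs_bound)
  also have "\<dots> \<le> expectation (\<lambda>\<omega>. \<bar>excess T \<omega> - ?V \<omega>\<bar>)"
  proof (rule integral_mono)
    fix \<omega>
    have "\<bar>max 0 (s * excess T \<omega>) - max 0 (s * ?V \<omega>)\<bar> \<le> \<bar>s * excess T \<omega> - s * ?V \<omega>\<bar>" by linarith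
    also have "\<dots> = \<bar>excess T \<omega> - ?V \<omega>\<bar>" by (simp only: right_diff_distrib[symmetric] abs_mult s mult_1_left)
    finally show "\<bar>max 0 (s * excess T \<omega>) - max 0 (s * ?V \<omega>)\<bar> \<le> \<bar>excess T \<omega> - ?V \<omega>\<bar>" .
  qed (use i avg(1) in \<open>auto simp del: times_divide_eq_left\<close>)
  finally show ?thesis using avg(2) EV by simp
qed

text \<open>Discounting changes the leading term by the factor 1 - O(T). As that term is bounded for
  small T, the change is absorbed in the error.\<close>

lemma discounted_payoff_bigo:
  assumes r: "0 \<le> r" and s: "\<bar>s\<bar> = 1"
  shows "(\<lambda>T. exp (- r * T) * expectation (\<lambda>\<omega>. max 0 (s * excess T \<omega>)) - vol * (sqrt T / sqrt (6 * pi)))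
    \<in> O[at_right 0](\<lambda>T. T)"
proof -
  obtain D t0 :: real where D: "0 \<le> D" and t0: "0 < t0" "t0 \<le> 1"
    and err: "\<And>t. 0 < t \<Longrightarrow> t \<le> t0 \<Longrightarrow> (\<integral>\<^sup>+\<omega>. ennreal \<bar>S t \<omega> - S0 - vol * (W t \<omega> - W 0 \<omega>)\<bar> \<partial>M) \<le> ennreal (D * t)"
    using linear_error by blast
  have vol: "0 \<le> vol" using \<sigma>_pos by (simp add: vol_def)
  have "norm (exp (- r * T) * expectation (\<lambda>\<omega>. max 0 (s * excess T \<omega>)) - vol * (sqrt T / sqrt (6 * pi)))
      \<le> (D + vol * r) * norm T" if T: "0 < T" "T < t0" for T
  proof -
    let ?E = "expectation (\<lambda>\<omega>. max 0 (s * excess T \<omega>))"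
    let ?g = "vol * (sqrt T / sqrt (6 * pi))"
    have E: "\<bar>?E - ?g\<bar> \<le> D * T" using T err by (intro payoff_error D s) auto
    have e: "0 \<le> exp (- r * T)" "exp (- r * T) \<le> 1" "1 - exp (- r * T) \<le> r * T"
      using r T exp_ge_add_one_self[of "- r * T"] by auto
    \<comment> \<open>Since T < 1 < 6 pi, the leading term is at most \<open>vol\<close>, a bound
      free of T.\<close>
    have "sqrt T \<le> sqrt (6 * pi)" using T t0 pi_gt3 by (intro real_sqrt_le_mono) linarith
    then have "sqrt T / sqrt (6 * pi) \<le> 1" by (simp add: divide_le_eq_1)
    then have g: "?g \<le> vol" by (rule mult_left_le[OF _ vol])
    have g0: "0 \<le> ?g" using vol T by simp
    have "e * x - y = e * (x - y) - (1 - e) * y" for e x y :: real by (simp add: algebra_simps)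
    then have "\<bar>exp (- r * T) * ?E - ?g\<bar> = \<bar>exp (- r * T) * (?E - ?g) - (1 - exp (- r * T)) * ?g\<bar>"
      by (rule arg_cong)
    also have "\<dots> \<le> \<bar>exp (- r * T) * (?E - ?g)\<bar> + \<bar>(1 - exp (- r * T)) * ?g\<bar>" by (rule abs_triangle_ineq4)
    also have "\<bar>exp (- r * T) * (?E - ?g)\<bar> \<le> 1 * (D * T)"
      unfolding abs_mult using e E by (intro mult_mono) auto
    also have "\<bar>(1 - exp (- r * T)) * ?g\<bar> \<le> r * T * vol"
      unfolding abs_mult using e g g0 r T by (intro mult_mono) auto
    finally show ?thesis using T by (simp add: algebra_simps)
  qed
  then have "\<forall>\<^sub>F T in at_right 0. norm (exp (- r * T) * expectation (\<lambda>\<omega>. max 0 (s * excess T \<omega>)) - vol * (sqrt T / sqrt (6 * pi)))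
      \<le> (D + vol * r) * norm T"
    using t0(1) unfolding eventually_at_right_field by blast
  then show ?thesis by (rule bigoI)
qed

end

theorem theorem6:
  fixes M :: "'a measure" and F :: "real \<Rightarrow> 'a measure"
    and W S :: "real \<Rightarrow> 'a \<Rightarrow> real" and r q \<sigma> \<beta> S0 :: real
  assumes "filtered_prob_space M F"
    and "brownian_motion M F W"
    and "0 \<le> r" and "0 \<le> q" and "0 < \<sigma>"
    and "1 / 2 \<le> \<beta>" and "\<beta> < 1"
    and "0 < S0"
    and "cev_process M F W r q \<sigma> \<beta> S0 S"
  shows "(\<lambda>T. asian_call M S r S0 T - \<sigma> * S0 powr \<beta> * (sqrt T / sqrt (6 * pi)))
           \<in> O[at_right 0](\<lambda>T. T) \<and>
         (\<lambda>T. asian_put M S r S0 T - \<sigma> * S0 powr \<beta> * (sqrt T / sqrt (6 * pi)))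
           \<in> O[at_right 0](\<lambda>T. T)"
proof -
  interpret filtered_prob_space M F by fact
  have sde: "sde_solution M F W (\<lambda>x. (r - q) * x) (\<lambda>x. \<sigma> * x powr \<beta>) S0 S"
    and nonneg: "AE \<omega> in M. \<forall>t\<ge>0. 0 \<le> S t \<omega>"
    using assms by (auto simp: cev_process_def)
  obtain I where I: "has_ito_integral M F W (\<lambda>s \<omega>. \<sigma> * S s \<omega> powr \<beta>) I"
      "AE \<omega> in M. \<forall>t\<ge>0. S t \<omega> = S0 + (LBINT s:{0..t}. (r - q) * S s \<omega>) + I t \<omega>"
    using sde unfolding sde_solution_def by blast
  interpret cev_model M F W S I "r - q" \<sigma> \<beta> S0
  proof unfold_locales
    show "\<omega> \<in> space M \<Longrightarrow> continuous_on {0..} (\<lambda>t. S t \<omega>)" for \<omega>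
      using sde by (simp add: sde_solution_def)
  qed (use assms sde nonneg I in \<open>auto simp: sde_solution_def\<close>)
  have call: "asian_call M S r S0 T = exp (- r * T) * expectation (\<lambda>\<omega>. max 0 (1 * excess T \<omega>))" for T
    by (simp add: asian_call_def excess_def)
  have put: "asian_put M S r S0 T = exp (- r * T) * expectation (\<lambda>\<omega>. max 0 (- 1 * excess T \<omega>))" for T
    by (simp add: asian_put_def excess_def)
  show ?thesis
    using discounted_payoff_bigo[OF \<open>0 \<le> r\<close>, of 1] discounted_payoff_bigo[OF \<open>0 \<le> r\<close>, of "- 1"]
    unfolding call put vol_def by simp
qed

end
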